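(* Let $n\ge 1$, let $\mathsf e\in\mathbb E_n$ and let $\Gamma=\Gamma_{\mathsf e}$ be the corresponding unit interval graph. (1) For every integer $m\ge 1$, $$\mathbf X^{(m)}_{\Gamma}(q,t):=t^{n(m-1)}\,\mathsf S^{(m)}_{1,\mathsf e(1)}\mathsf S^{(m)}_{2,\mathsf e(2)}\cdots \mathsf S^{(m)}_{n,\mathsf e(n)}\bullet (X_1X_2\cdots X_n)\ \in\ \mathbb Z[q^{-1},t^{\pm1}][X_1,\dots,X_m]^{\mathfrak S_m},$$ where $X_{i+km}=q^{-k}X_i$ for $1\le i\le m$ and $k\in\mathbb Z$. (2) For any $0<m'<m$, $$\pi_{m,m'}\big(\mathbf X^{(m)}_{\Gamma}(q,t)\big)=\mathbf X^{(m')}_{\Gamma}(q,t).$$ In particular there is a well-defined symmetric function $\mathbf X_\Gamma(q,t):=\varprojlim_m \mathbf X_\Gamma^{(m)}(q,t)\in\Lambda_{q,t}$. (3) We have $$\mathbf X_\Gamma(1,t)=\mathbf N(\mathbf X_\Gamma(t)),$$ where $\mathbf X_\Gamma(1,t)$ is the specialization of $\mathbf X_\Gamma(q,t)$ at $q=1$, $\mathbf X_\Gamma(t)$ is the chromatic quasisymmetric function of $\Gamma$ (which is symmetric), and $\mathbf N$ is the $\mathbb Q(q,t)$-algebra automorphism of $\Lambda_{q,t}$ characterized by $\mathbf N(e_r(X))=t^{r(r-1)/2}e_r(X)$ for all $r\ge 1$, $e_r(X)$ being the $r$-th elementary symmetric function.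
   Context: Let $q,t$ be indeterminates and $\mathbb Q_{q,t}=\mathbb Q(q,t)$. For $m\ge1$ put $\mathbb Q_{q,t}[X]_{(m)}=\mathbb Q_{q,t}[X_1,\dots,X_m]\subset\mathbb Q_{q,t}[X^{\pm1}]_{(m)}=\mathbb Q_{q,t}[X_1^{\pm1},\dots,X_m^{\pm1}]$, with the convention $X_{i+km}=q^{-k}X_i$ for $1\le i\le m$, $k\in\mathbb Z$ (so $X_0=qX_m$, $X_{m+1}=q^{-1}X_1$). Affine Hecke algebra: $\mathscr H_m$ is the $\mathbb Q_{q,t}$-algebra generated by $T_i$ ($i\in\mathbb Z/m\mathbb Z$) and $\Pi^{\pm1}$ with relations $(T_i-t)(T_i+1)=0$; $T_iT_{i+1}T_i=T_{i+1}T_iT_{i+1}$ if $m>2$; $T_iT_j=T_jT_i$ if $j\ne i\pm1$; $\Pi T_i=T_{i+1}\Pi$. (For $m=1$ no $T_i$ are present: $\mathscr H_1$ is generated by $\Pi^{\pm1}$.) It acts (action denoted $\bullet$; the level one representation) on $\mathbb Q_{q,t}[X^{\pm1}]_{(m)}$ by $$T_i\bullet F=t\,s_i(F)+(t-1)\frac{F-s_i(F)}{1-X_iX_{i+1}^{-1}},\qquad \Pi\bullet F=X_1F(X_2,\dots,X_m,X_{m+1}),$$ where for $1\le i\le m-1$ $s_i$ swaps $X_i$ and $X_{i+1}$, and $s_0(F)=X_1X_0^{-1}F(X_0,X_2,\dots,X_{m-1},X_{m+1})$. For integers $i,e$ with $e<i$, $\mathsf S^{(m)}_{i,e}:=1+T_i^{-1}+T_{i+1}^{-1}T_i^{-1}+\cdots+T_{m+e-1}^{-1}T_{m+e-2}^{-1}\cdots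 T_i^{-1}\in\mathscr H_m$ if $e\ge i-m$ ($m+e-i+1$ terms, indices of $T$ modulo $m$), and $\mathsf S^{(m)}_{i,e}:=0$ if $e<i-m$. $\pi_{m,m'}:\mathbb Q_{q,t}[X]_{(m)}\to\mathbb Q_{q,t}[X]_{(m')}$ sets $X_{m'+1}=\dots=X_m=0$. $\Lambda_{q,t}=\bigoplus_{d\ge0}\varprojlim_m(\mathbb Q_{q,t}[X]_{(m)})_d^{\mathfrak S_m}$ (limit along $\pi_{m,m'}$, $d$ = degree) is the ring of symmetric functions over $\mathbb Q_{q,t}$. $\mathbb E_n=\{\mathsf e:\{1,\dots,n\}\to\mathbb Z\mid 0\le\mathsf e(i)<i,\ \mathsf e(i)\le\mathsf e(i+1)\}$. The unit interval graph $\Gamma_{\mathsf e}$ has vertex set $\{1,\dots,n\}$ and an oriented edge $j\to i$ exactly when $\mathsf e(i)<j<i$. The chromatic quasisymmetric function of an oriented graph $\Gamma$ is $\mathbf X_\Gamma(t)=\sum_\kappa t^{\mathrm{asc}(\kappa)}\prod_{v}X_{\kappa(v)}$, the sum over proper colorings $\kappa$ from vertices to $\mathbb Z_{>0}$ ($\kappa(v)\ne\kappa(w)$ for every edge $v\to w$), with $\mathrm{asc}(\kappa)$ the number of edges $v\to w$ with $\kappa(v)<\kappa(w)$. It is known to be symmetric when $\Gamma$ is a unit interval graph. *)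

theory Defs
  imports
    "HOL-Library.Poly_Mapping"
    "HOL-Library.FuncSet"
    "HOL-Combinatorics.Permutations"
    "HOL-Computational_Algebra.Polynomial"
    "HOL-Computational_Algebra.Fraction_Field"
    "HOL-Algebra.QuotRing"
begin

section \<open>The field of rational functions in q and t\<close>

text \<open>Polynomials in q whose coefficients are polynomials in t: the outer variable is q.\<close>

type_synonym qt = "rat poly poly fract"

definition qq :: qt where
  "qq = Fract [:0, 1:] 1"

definition tt :: qt where
  "tt = Fract [:[:0, 1:]:] 1"

text \<open>The subring \<open>\<int>[q\<^sup>-\<^sup>1, t\<^sup>\<plusminus>\<^sup>1]\<close>.\<close>

definition qt_integral :: "qt set" where
  "qt_integral = {c. \<exists>(A :: (nat \<times> int) set) a. finite A \<and>
     c = (\<Sum>(i, j)\<in>A. of_int (a (i, j)) * inverse qq ^ i * tt powi j)}"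

text \<open>Evaluation at q = 1 of a fraction that has a representation whose denominator does not
  vanish at q = 1.\<close>

definition spec_q1 :: "qt \<Rightarrow> qt" where
  "spec_q1 c = (THE d. \<exists>a b. poly b 1 \<noteq> 0 \<and> c = Fract a b \<and>
     d = Fract [:poly a 1:] [:poly b 1:])"


section \<open>Laurent polynomials\<close>

text \<open>Laurent polynomials in variables indexed by the natural numbers, as finitely supported
  functions on exponent vectors with the convolution product.  The rings in m variables are the
  subsets in which only the variables with index in \<open>{1..m}\<close> occur.\<close>

type_synonym laurent = "(nat \<Rightarrow>\<^sub>0 int) \<Rightarrow>\<^sub>0 qt"

definition lconst :: "qt \<Rightarrow> laurent" where
  "lconst c = Poly_Mapping.single 0 c"

definition lvar :: "nat \<Rightarrow> laurent" where
  "lvar i = Poly_Mapping.single (Poly_Mapping.single i 1) 1"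

definition laurent_ring :: "nat \<Rightarrow> laurent set" where
  "laurent_ring m = {F. \<forall>\<mu>\<in>Poly_Mapping.keys F. Poly_Mapping.keys \<mu> \<subseteq> {1..m}}"

definition poly_ring :: "nat \<Rightarrow> laurent set" where
  "poly_ring m = {F \<in> laurent_ring m.
     \<forall>\<mu>\<in>Poly_Mapping.keys F. \<forall>i. 0 \<le> Poly_Mapping.lookup \<mu> i}"

text \<open>Exact division.  Laurent polynomials form an integral domain, so that the quotient by a
  nonzero element is unique if it exists.\<close>

definition lquot :: "laurent \<Rightarrow> laurent \<Rightarrow> laurent" where
  "lquot F G = (THE H. H * G = F)"

definition lpow :: "laurent \<Rightarrow> int \<Rightarrow> laurent" where
  "lpow G k = (if 0 \<le> k then G ^ nat k else lquot 1 G ^ nat (- k))"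

text \<open>\<open>lsubst G F\<close> is \<open>F(G 1, G 2, \<dots>)\<close>.  Only variables that occur in \<open>F\<close> with a negative
  exponent have to be replaced by units.\<close>

definition lsubst :: "(nat \<Rightarrow> laurent) \<Rightarrow> laurent \<Rightarrow> laurent" where
  "lsubst G F = (\<Sum>\<mu>\<in>Poly_Mapping.keys F. lconst (Poly_Mapping.lookup F \<mu>) *
     (\<Prod>i\<in>Poly_Mapping.keys \<mu>. lpow (G i) (Poly_Mapping.lookup \<mu> i)))"

definition sym_poly_ring :: "nat \<Rightarrow> laurent set" where
  "sym_poly_ring m = {F \<in> poly_ring m.
     \<forall>\<sigma>. \<sigma> permutes {1..m} \<longrightarrow> lsubst (\<lambda>i. lvar (\<sigma> i)) F = F}"

definition homogeneous :: "nat \<Rightarrow> laurent \<Rightarrow> bool" where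
  "homogeneous d F \<longleftrightarrow> (\<forall>\<mu>\<in>Poly_Mapping.keys F.
     (\<Sum>i\<in>Poly_Mapping.keys \<mu>. Poly_Mapping.lookup \<mu> i) = int d)"

text \<open>\<open>proj m'\<close> restricted to \<open>poly_ring m\<close> is the map \<open>\<pi>\<close> with indices \<open>m, m'\<close>.\<close>

definition proj :: "nat \<Rightarrow> laurent \<Rightarrow> laurent" where
  "proj m' F = lsubst (\<lambda>i. if i \<le> m' then lvar i else 0) F"

text \<open>The periodic convention: \<open>Xv m (i + k * m) = q\<^sup>-\<^sup>k X\<^sub>i\<close> for \<open>1 \<le> i \<le> m\<close>.\<close>

definition Xv :: "nat \<Rightarrow> int \<Rightarrow> laurent" where
  "Xv m i = lconst (qq powi (- ((i - 1) div int m))) * lvar (nat ((i - 1) mod int m + 1))"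


section \<open>The affine Hecke algebra\<close>

text \<open>Words under concatenation; the free algebra is the corresponding monoid algebra.\<close>

instantiation list :: (type) monoid_add
begin
definition zero_list :: "'a list" where "zero_list = []"
definition plus_list :: "'a list \<Rightarrow> 'a list \<Rightarrow> 'a list" where "plus_list = (@)"
instance by standard (simp_all add: zero_list_def plus_list_def)
end

datatype hecke_gen = GenT nat | GenPi | GenPi_inv

type_synonym hecke_free = "hecke_gen list \<Rightarrow>\<^sub>0 qt"

text \<open>The residue class of i modulo m is represented by an element of \<open>{..<m}\<close>.  There are no
  generators \<open>T\<^sub>i\<close> if m = 1.\<close>

definition hecke_letters :: "nat \<Rightarrow> hecke_gen set" where
  "hecke_letters m = {GenPi, GenPi_inv} \<union> (if 2 \<le> m then GenT ` {..<m} else {})"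

definition free_algebra :: "nat \<Rightarrow> hecke_free ring" where
  "free_algebra m = \<lparr>carrier = {x. \<forall>w\<in>Poly_Mapping.keys x. set w \<subseteq> hecke_letters m},
     monoid.mult = (*), one = 1, ring.zero = 0, add = (+)\<rparr>"

definition fscal :: "qt \<Rightarrow> hecke_free" where
  "fscal c = Poly_Mapping.single [] c"

definition fT :: "nat \<Rightarrow> int \<Rightarrow> hecke_free" where
  "fT m i = Poly_Mapping.single [GenT (nat (i mod int m))] 1"

definition fPi :: hecke_free where
  "fPi = Poly_Mapping.single [GenPi] 1"

definition fPi_inv :: hecke_free where
  "fPi_inv = Poly_Mapping.single [GenPi_inv] 1"

definition hecke_relators :: "nat \<Rightarrow> hecke_free set" where
  "hecke_relators m =
     {fPi * fPi_inv - 1, fPi_inv * fPi - 1} \<union>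
     (if 2 \<le> m then
        {(fT m i - fscal tt) * (fT m i + 1) | i. True} \<union>
        {fT m i * fT m j - fT m j * fT m i | i j.
           j mod int m \<noteq> (i + 1) mod int m \<and> j mod int m \<noteq> (i - 1) mod int m} \<union>
        {fPi * fT m i - fT m (i + 1) * fPi | i. True}
      else {}) \<union>
     (if 2 < m then
        {fT m i * fT m (i + 1) * fT m i - fT m (i + 1) * fT m i * fT m (i + 1) | i. True}
      else {})"

definition hecke_ideal :: "nat \<Rightarrow> hecke_free set" where
  "hecke_ideal m = genideal (free_algebra m) (hecke_relators m)"

definition hecke :: "nat \<Rightarrow> hecke_free set ring" where
  "hecke m = free_algebra m Quot hecke_ideal m"

definition hecke_T :: "nat \<Rightarrow> int \<Rightarrow> hecke_free set" where
  "hecke_T m i = hecke_ideal m +>\<^bsub>free_algebra m\<^esub> fT m i"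


section \<open>The level one representation\<close>

definition s_op :: "nat \<Rightarrow> nat \<Rightarrow> laurent \<Rightarrow> laurent" where
  "s_op m i F =
     (if i = 0
      then Xv m 1 * lquot 1 (Xv m 0) *
        lsubst (\<lambda>j. if j = 1 then Xv m 0 else if j = m then Xv m (int m + 1) else lvar j) F
      else lsubst (\<lambda>j. lvar (transpose i (i + 1) j)) F)"

definition T_op :: "nat \<Rightarrow> nat \<Rightarrow> laurent \<Rightarrow> laurent" where
  "T_op m i F = lconst tt * s_op m i F +
     lconst (tt - 1) *
       lquot (F - s_op m i F) (1 - Xv m (int i) * lquot 1 (Xv m (int i + 1)))"

definition Pi_op :: "nat \<Rightarrow> laurent \<Rightarrow> laurent" where
  "Pi_op m F = Xv m 1 * lsubst (\<lambda>j. Xv m (int j + 1)) F"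

fun gen_act :: "nat \<Rightarrow> hecke_gen \<Rightarrow> laurent \<Rightarrow> laurent" where
  "gen_act m (GenT i) F = T_op m i F"
| "gen_act m GenPi F = Pi_op m F"
| "gen_act m GenPi_inv F = inv_into (laurent_ring m) (Pi_op m) F"

definition free_act :: "nat \<Rightarrow> hecke_free \<Rightarrow> laurent \<Rightarrow> laurent" where
  "free_act m x F = (\<Sum>w\<in>Poly_Mapping.keys x.
     lconst (Poly_Mapping.lookup x w) * foldr (gen_act m) w F)"

text \<open>The action of a residue class is the common action of its representatives: the operators
  above satisfy the defining relations on \<open>laurent_ring m\<close>.\<close>

definition hecke_act :: "nat \<Rightarrow> hecke_free set \<Rightarrow> laurent \<Rightarrow> laurent" where
  "hecke_act m h F = the_elem ((\<lambda>x. free_act m x F) ` h)"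


section \<open>The elements S and the polynomials attached to a unit interval graph\<close>

text \<open>\<open>T_inv_prod m i k\<close> is the product of the inverses of \<open>T\<^sub>i\<^sub>+\<^sub>k\<^sub>-\<^sub>1, \<dots>, T\<^sub>i\<close>, in this order.\<close>

primrec T_inv_prod :: "nat \<Rightarrow> int \<Rightarrow> nat \<Rightarrow> hecke_free set" where
  "T_inv_prod m i 0 = \<one>\<^bsub>hecke m\<^esub>"
| "T_inv_prod m i (Suc k) =
     inv\<^bsub>hecke m\<^esub> (hecke_T m (i + int k)) \<otimes>\<^bsub>hecke m\<^esub> T_inv_prod m i k"

definition S_elem :: "nat \<Rightarrow> int \<Rightarrow> int \<Rightarrow> hecke_free set" where
  "S_elem m i e =
     (if i - int m \<le> e
      then finsum (hecke m) (T_inv_prod m i) {0..nat (int m + e - i)}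
      else \<zero>\<^bsub>hecke m\<^esub>)"

definition unit_interval_fun :: "nat \<Rightarrow> (nat \<Rightarrow> int) set" where
  "unit_interval_fun n = {e. (\<forall>i\<in>{1..n}. 0 \<le> e i \<and> e i < int i) \<and>
     (\<forall>i. 1 \<le> i \<and> i < n \<longrightarrow> e i \<le> e (i + 1))}"

text \<open>A pair \<open>(v, w)\<close> is an edge from v to w.\<close>

definition unit_interval_edges :: "nat \<Rightarrow> (nat \<Rightarrow> int) \<Rightarrow> (nat \<times> nat) set" where
  "unit_interval_edges n e =
     {(j, i). j \<in> {1..n} \<and> i \<in> {1..n} \<and> e i < int j \<and> j < i}"

definition XG_qt :: "nat \<Rightarrow> nat \<Rightarrow> (nat \<Rightarrow> int) \<Rightarrow> laurent" where
  "XG_qt m n e = lconst (tt ^ (n * (m - 1))) *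
     hecke_act m
       (foldr (\<lambda>i h. S_elem m (int i) (e i) \<otimes>\<^bsub>hecke m\<^esub> h) [1..<n + 1] \<one>\<^bsub>hecke m\<^esub>)
       (\<Prod>i = 1..n. Xv m (int i))"


section \<open>Symmetric functions\<close>

text \<open>Elements of the graded inverse limit are compatible families indexed by \<open>m \<ge> 1\<close>.\<close>

definition Lambda_deg :: "nat \<Rightarrow> (nat \<Rightarrow> laurent) set" where
  "Lambda_deg d = {f \<in> extensional {1..}.
     (\<forall>m\<ge>1. f m \<in> sym_poly_ring m \<and> homogeneous d (f m)) \<and>
     (\<forall>m m'. 0 < m' \<and> m' < m \<longrightarrow> proj m' (f m) = f m')}"

definition Lambda :: "(nat \<Rightarrow> laurent) ring" where
  "Lambda = \<lparr>carrier = {f. \<exists>D g. (\<forall>d\<le>D. g d \<in> Lambda_deg d) \<and>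
       f = (\<lambda>m\<in>{1..}. \<Sum>d\<le>D. g d m)},
     monoid.mult = (\<lambda>f g. \<lambda>m\<in>{1..}. f m * g m), one = (\<lambda>m\<in>{1..}. 1),
     ring.zero = (\<lambda>m\<in>{1..}. 0), add = (\<lambda>f g. \<lambda>m\<in>{1..}. f m + g m)\<rparr>"

definition Lambda_smult :: "qt \<Rightarrow> (nat \<Rightarrow> laurent) \<Rightarrow> nat \<Rightarrow> laurent" where
  "Lambda_smult c f = (\<lambda>m\<in>{1..}. lconst c * f m)"

definition elem_sym :: "nat \<Rightarrow> nat \<Rightarrow> laurent" where
  "elem_sym r = (\<lambda>m\<in>{1..}. \<Sum>A | A \<subseteq> {1..m} \<and> card A = r. \<Prod>i\<in>A. lvar i)"

text \<open>By the fundamental theorem on symmetric functions there is exactly one such map on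
  \<open>carrier Lambda\<close>.\<close>

definition is_N :: "((nat \<Rightarrow> laurent) \<Rightarrow> nat \<Rightarrow> laurent) \<Rightarrow> bool" where
  "is_N N \<longleftrightarrow> N \<in> ring_iso Lambda Lambda \<and>
     (\<forall>c. \<forall>f\<in>carrier Lambda. N (Lambda_smult c f) = Lambda_smult c (N f)) \<and>
     (\<forall>r\<ge>1. N (elem_sym r) = Lambda_smult (tt ^ (r * (r - 1) div 2)) (elem_sym r))"

definition XG_lim :: "nat \<Rightarrow> (nat \<Rightarrow> int) \<Rightarrow> nat \<Rightarrow> laurent" where
  "XG_lim n e = (\<lambda>m\<in>{1..}. XG_qt m n e)"

definition Lambda_spec_q1 :: "(nat \<Rightarrow> laurent) \<Rightarrow> nat \<Rightarrow> laurent" where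
  "Lambda_spec_q1 f = (\<lambda>m\<in>{1..}. Poly_Mapping.map spec_q1 (f m))"


section \<open>Chromatic quasisymmetric functions\<close>

definition proper_colorings :: "'v set \<Rightarrow> ('v \<times> 'v) set \<Rightarrow> ('v \<Rightarrow> nat) set" where
  "proper_colorings V E = {\<kappa> \<in> V \<rightarrow>\<^sub>E {1..}. \<forall>(v, w)\<in>E. \<kappa> v \<noteq> \<kappa> w}"

definition asc :: "('v \<times> 'v) set \<Rightarrow> ('v \<Rightarrow> nat) \<Rightarrow> nat" where
  "asc E \<kappa> = card {(v, w) \<in> E. \<kappa> v < \<kappa> w}"

text \<open>A formal power series in \<open>X\<^sub>1, X\<^sub>2, \<dots>\<close>, given by its coefficients; for finite \<open>V\<close> only
  finitely many colorings contribute to each coefficient.\<close>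

definition chromatic_qsym :: "'v set \<Rightarrow> ('v \<times> 'v) set \<Rightarrow> (nat \<Rightarrow>\<^sub>0 int) \<Rightarrow> qt" where
  "chromatic_qsym V E \<mu> =
     (\<Sum>\<kappa> | \<kappa> \<in> proper_colorings V E \<and> (\<Sum>v\<in>V. Poly_Mapping.single (\<kappa> v) 1) = \<mu>.
        tt ^ asc E \<kappa>)"

text \<open>The family of the truncations of a formal power series to the first m variables.  For a
  series of bounded degree these are polynomials.\<close>

definition series_family :: "((nat \<Rightarrow>\<^sub>0 int) \<Rightarrow> qt) \<Rightarrow> nat \<Rightarrow> laurent" where
  "series_family c = (\<lambda>m\<in>{1..}. Abs_poly_mapping
     (\<lambda>\<mu>. if Poly_Mapping.keys \<mu> \<subseteq> {1..m} then c \<mu> else 0))"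

end

theory Submission
  imports Defs
begin

text \<open>
  Since \<open>X\<^sub>1 \<dots> X\<^sub>n = \<Pi>\<^sup>n \<bullet> 1\<close> and conjugation by \<open>\<Pi>\<close> shifts the indices of the \<open>T\<^sub>i\<close>, the polynomial
  is \<open>A\<^bsub>d(1)\<^esub> \<dots> A\<^bsub>d(n)\<^esub> 1\<close> with \<open>d(i) = i - 1 - e(i)\<close> and
  \<open>A\<^sub>d = t\<^bsup>m-1\<^esup> (1 + T\<^sub>1\<^sup>-\<^sup>1 + \<dots> + T\<^bsub>m-1-d\<^esub>\<^sup>-\<^sup>1 \<dots> T\<^sub>1\<^sup>-\<^sup>1) \<Pi>\<close>; neither \<open>T\<^sub>0\<close> nor its inverse is involved.
  The sum in \<open>A\<^sub>d\<close> is a coset symmetrizer, so by induction the partial words are invariant under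
  \<open>T\<^sub>1, \<dots>, T\<^bsub>m-1-d\<^esub>\<close>, which gives symmetry.  Stability holds operator by operator: setting
  \<open>X\<^sub>1 = 0\<close> and shifting the remaining variables turns \<open>A\<^sub>d\<close> for \<open>m\<close> into \<open>A\<^sub>d\<close> for \<open>m - 1\<close>.

  For the specialization, color the vertices one after the other and regard the vertices that are
  already colored as ghosts.  Exchanging the colors \<open>c\<close> and \<open>c + 1\<close> of the ghosts is a
  Demazure--Lusztig operator \<open>T'\<^sub>c\<close>, hence the chromatic polynomial is the word in the operators
  \<open>\<Sum> T'\<^sub>b \<dots> T'\<^bsub>m-1\<^esub> x\<^sub>m\<close> for the same \<open>d(i)\<close>.  At \<open>q = 1\<close> the map \<open>\<phi>(f) = f(Y) \<bullet> 1\<close>, with \<open>Y\<close> the commuting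
  Bernstein operators, intertwines \<open>T'\<^sub>c\<close> with \<open>T\<^sub>c\<close> and \<open>x\<^sub>c\<close> with \<open>Y\<^sub>c\<close>, and maps this word to the one
  above.  As all operators are then linear over symmetric polynomials, \<open>\<phi>\<close> is multiplicative on
  symmetric polynomials, and \<open>\<phi>(e\<^sub>r) = t\<^bsup>r(r-1)/2\<^esup> e\<^sub>r\<close> follows from the complete graph on \<open>r\<close>
  vertices; so \<open>\<phi>\<close> is \<open>N\<close>.
\<close>

text \<open>The algebra is a quotient of a free algebra and its action is read off from
  representatives, so the operators have to satisfy all relations, including those with
  \<open>T_0\<close>. Defining \<open>T_0\<close> as the conjugate of \<open>T_{m-1}\<close> by
  \<open>\<Pi>\<close> carries every relation to indices between \<open>1\<close> and
  \<open>m - 1\<close>. There the Demazure--Lusztig operators are determined by the way they pass a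
  variable; since variables are units, an identity for \<open>F\<close> is equivalent to the same
  identity for \<open>X_j F\<close>. All inverses are cleared as
  \<open>t T_i^{-1} = T_i - (t - 1)\<close>, which spends the prefactor \<open>t^{n(m-1)}\<close> in
  shares of \<open>t^{m-1}\<close> per vertex. The number \<open>d(i)\<close> counts the earlier
  neighbours of \<open>i\<close>. Symmetry and stability use of the graph only that
  \<open>d(1) = 0\<close> and \<open>d(i + 1) \<le> d(i) + 1\<close>, the latter being the
  monotonicity of \<open>e\<close>. The value \<open>q = 1\<close> matters because the cyclic shift
  then merely permutes the variables and fixes symmetric polynomials. The exponent
  \<open>r(r - 1)/2\<close> is the sum of the \<open>r - 1 - k\<close> for \<open>k < r\<close>: by
  the factor \<open>t^{r-1-k}\<close> the two words for the complete graph differ at each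
  letter.\<close>

abbreviation lookup :: "('a \<Rightarrow>\<^sub>0 'b::zero) \<Rightarrow> 'a \<Rightarrow> 'b" where
  "lookup \<equiv> Poly_Mapping.lookup"

abbreviation keys :: "('a \<Rightarrow>\<^sub>0 'b::zero) \<Rightarrow> 'a set" where
  "keys \<equiv> Poly_Mapping.keys"

section \<open>Laurent polynomials: monomials, coefficients and induction over variables\<close>

definition linv :: "nat \<Rightarrow> laurent" where
  "linv i = Poly_Mapping.single (Poly_Mapping.single i (- 1)) 1"

lemma lvar_linv [simp]: "lvar i * linv i = 1" "linv i * lvar i = 1"
  by (simp_all add: lvar_def linv_def mult_single single_add[symmetric])

lemma lvar_linv_mult [simp]: "lvar i * (linv i * F) = F" "linv i * (lvar i * F) = F"
  by (simp_all add: mult.assoc[symmetric])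

lemma lvar_nonzero [simp]: "lvar i \<noteq> 0"
  using lvar_linv(1)[of i] by force

lemma lookup_lvar: "lookup (lvar i) \<mu> = (1 when \<mu> = Poly_Mapping.single i 1)"
  by (simp add: lvar_def lookup_single when_def)

lemma lvar_eq_iff [simp]: "lvar i = lvar j \<longleftrightarrow> i = j"
  unfolding lvar_def using lookup_single_eq lookup_single_not_eq
  by (metis zero_neq_one)

lemma lconst_add: "lconst (c + d) = lconst c + lconst d"
  by (simp add: lconst_def single_add)
lemma lconst_mult: "lconst (c * d) = lconst c * lconst d"
  by (simp add: lconst_def mult_single)
lemma lconst_diff: "lconst (c - d) = lconst c - lconst d"
  by (simp add: lconst_def single_diff)
lemma lconst_uminus: "lconst (- c) = - lconst c"
  by (simp add: lconst_def single_uminus)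
lemma lconst_0 [simp]: "lconst 0 = 0"
  by (simp add: lconst_def)
lemma lconst_1 [simp]: "lconst 1 = 1"
  by (simp add: lconst_def)
lemma lconst_power: "lconst (c ^ n) = lconst c ^ n"
  by (induction n) (simp_all add: lconst_mult)
lemma lconst_sum: "lconst (sum f A) = (\<Sum>x\<in>A. lconst (f x))"
  by (induction A rule: infinite_finite_induct) (simp_all add: lconst_add)
lemma lconst_eq_iff [simp]: "lconst c = lconst d \<longleftrightarrow> c = d"
  unfolding lconst_def by (metis lookup_single_eq)

lemma lconst_eq_0_iff [simp]: "lconst c = 0 \<longleftrightarrow> c = 0"
  using lconst_eq_iff[of c 0] by simp

lemma lookup_lconst_mult: "lookup (lconst c * F) \<mu> = c * lookup F \<mu>"
proof -
  have "lconst c * F = Poly_Mapping.map ((*) c) F"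
    by (simp add: lconst_def mult_map_scale_conv_mult)
  then show ?thesis by (simp add: Poly_Mapping.map.rep_eq when_def)
qed

lemma lvar_single: "lvar j * Poly_Mapping.single \<mu> d = Poly_Mapping.single (Poly_Mapping.single j 1 + \<mu>) d"
  by (simp add: lvar_def mult_single)

lemma lookup_lvar_mult: "lookup (lvar j * F) \<mu> = lookup F (\<mu> - Poly_Mapping.single j 1)"
proof -
  have "lookup (lvar j * (F::laurent)) \<mu> = lookup F (\<mu> - Poly_Mapping.single j 1)"
    for F
  proof (induction F rule: update_induct)
    case const
    then show ?case by simp
  next
    case (update F a b)
    have e: "Poly_Mapping.update a b F = F + Poly_Mapping.single a b"
      by (rule poly_mapping_eqI)
        (use update in \<open>auto simp: lookup_update lookup_add lookup_single when_def in_keys_iff\<close>)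
    have k: "Poly_Mapping.single j 1 + a = \<mu> \<longleftrightarrow> a = \<mu> - Poly_Mapping.single j 1" by (auto simp: algebra_simps)
    show ?case unfolding e
      using update by (simp add: distrib_left lookup_add lvar_single lookup_single k when_def)
  qed
  then show ?thesis .
qed

lemma poly_mapping_sum_singles: "F = (\<Sum>\<mu>\<in>keys F. Poly_Mapping.single \<mu> (lookup F \<mu>))"
  by (rule poly_mapping_eqI) (simp add: lookup_sum lookup_single when_def in_keys_iff sum.delta')

text \<open>Negative exponents are reached by dividing, so the variable step has to be an
  equivalence. For an operator identity it is one as soon as both sides change in the same
  invertible way under multiplication by \<open>lvar j\<close>.\<close>

lemma laurent_induct [case_names const add var]:
  fixes P :: "laurent \<Rightarrow> bool"
  assumes const: "\<And>c. P (lconst c)"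
    and add: "\<And>F G. P F \<Longrightarrow> P G \<Longrightarrow> P (F + G)"
    and var: "\<And>j F. P (lvar j * F) \<longleftrightarrow> P F"
  shows "P F"
proof -
  have pow: "P (Poly_Mapping.single (Poly_Mapping.single j (int k) + \<mu>) c) \<longleftrightarrow> P (Poly_Mapping.single \<mu> c)" for j k \<mu> c
  proof (induction k)
    case (Suc k)
    have "Poly_Mapping.single (Poly_Mapping.single j (int (Suc k)) + \<mu>) c
       = lvar j * Poly_Mapping.single (Poly_Mapping.single j (int k) + \<mu>) c"
      by (simp only: lvar_single of_nat_Suc single_add add.assoc)
    then show ?case using Suc var by metis
  qed simp
  have pow': "P (Poly_Mapping.single (Poly_Mapping.single j i + \<mu>) c) \<longleftrightarrow> P (Poly_Mapping.single \<mu> c)" for j i \<mu> c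
  proof (cases "0 \<le> i")
    case True
    then show ?thesis using pow[of j "nat i"] by simp
  next
    case False
    \<comment> \<open>To be read backwards: the monomial with exponent \<open>i\<close> becomes
      \<open>\<mu>\<close> after \<open>- i\<close> multiplications by
      \<open>lvar j\<close>.\<close>
    have "P (Poly_Mapping.single (Poly_Mapping.single j (int (nat (- i))) + (Poly_Mapping.single j i + \<mu>)) c)
       \<longleftrightarrow> P (Poly_Mapping.single (Poly_Mapping.single j i + \<mu>) c)" by (rule pow)
    moreover have "Poly_Mapping.single j (int (nat (- i))) + (Poly_Mapping.single j i + \<mu>) = \<mu>"
      using False by (simp only: add.assoc[symmetric] single_add[symmetric]) simp
    ultimately show ?thesis by metis
  qed
  have mon: "P (Poly_Mapping.single \<mu> c)" for \<mu> c
  proof -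
    have "P (Poly_Mapping.single (\<Sum>j\<in>S. Poly_Mapping.single j (lookup \<mu> j)) c)" if "finite S" for S
      using that
    proof (induction S)
      case empty
      then show ?case using const[of c] by (simp add: lconst_def)
    next
      case (insert x S)
      then show ?case by (simp add: pow')
    qed
    from this[OF finite_keys[of \<mu>]] show ?thesis unfolding poly_mapping_sum_singles[symmetric] .
  qed
  have "P (\<Sum>\<mu>\<in>S. Poly_Mapping.single \<mu> (lookup F \<mu>))" if "finite S" for S
    using that by (induction S) (use const[of 0] mon add in auto)
  from this[OF finite_keys[of F]] show ?thesis unfolding poly_mapping_sum_singles[symmetric] .
qed

text \<open>The coefficient set is a parameter: \<open>UNIV\<close> serves for degree and symmetry,
  \<open>qt_integral\<close> for integrality and \<open>reg1\<close> for the specialization.\<close>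

definition hpoly :: "qt set \<Rightarrow> nat \<Rightarrow> nat \<Rightarrow> laurent set" where
  "hpoly C m d = {F \<in> poly_ring m. homogeneous d F \<and> (\<forall>\<mu>. lookup F \<mu> \<in> C)}"

definition mdeg :: "(nat \<Rightarrow>\<^sub>0 int) \<Rightarrow> int" where
  "mdeg \<mu> = (\<Sum>i\<in>keys \<mu>. lookup \<mu> i)"

lemma mdeg_superset: "finite S \<Longrightarrow> keys \<mu> \<subseteq> S \<Longrightarrow> mdeg \<mu> = (\<Sum>i\<in>S. lookup \<mu> i)"
  unfolding mdeg_def by (rule sum.mono_neutral_left) (auto simp: in_keys_iff)

lemma mdeg_add: "mdeg (\<mu> + \<nu>) = mdeg \<mu> + mdeg \<nu>"
proof -
  let ?S = "keys \<mu> \<union> keys \<nu>"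
  have "keys (\<mu> + \<nu>) \<subseteq> ?S" by (rule keys_add)
  then show ?thesis
    by (simp add: mdeg_superset[of ?S] lookup_add sum.distrib)
qed

lemma mdeg_single [simp]: "mdeg (Poly_Mapping.single i k) = k"
  by (simp add: mdeg_def)

lemma mdeg_0 [simp]: "mdeg 0 = 0"
  by (simp add: mdeg_def)

definition pexp :: "nat \<Rightarrow> (nat \<Rightarrow>\<^sub>0 int) \<Rightarrow> bool" where
  "pexp m \<mu> \<longleftrightarrow> keys \<mu> \<subseteq> {1..m} \<and> (\<forall>i. 0 \<le> lookup \<mu> i)"

lemma poly_ring_iff: "F \<in> poly_ring m \<longleftrightarrow> (\<forall>\<mu>\<in>keys F. pexp m \<mu>)"
  by (auto simp: poly_ring_def laurent_ring_def pexp_def)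

lemma homogeneous_iff: "homogeneous d F \<longleftrightarrow> (\<forall>\<mu>\<in>keys F. mdeg \<mu> = int d)"
  by (simp add: homogeneous_def mdeg_def)

lemma hpoly_iff: "F \<in> hpoly C m d \<longleftrightarrow> (\<forall>\<mu>. lookup F \<mu> \<in> C) \<and> (\<forall>\<mu>\<in>keys F. pexp m \<mu> \<and> mdeg \<mu> = int d)"
  by (auto simp: hpoly_def poly_ring_iff homogeneous_iff)

lemma hpoly_add':
  assumes "F \<in> hpoly C m d" "G \<in> hpoly C m d" "\<And>a b. a \<in> C \<Longrightarrow> b \<in> C \<Longrightarrow> a + b \<in> C"
  shows "F + G \<in> hpoly C m d"
proof -
  have "pexp m \<mu> \<and> mdeg \<mu> = int d" if "\<mu> \<in> keys (F + G)" for \<mu>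
    using that assms keys_add[of F G] unfolding hpoly_iff by blast
  then show ?thesis using assms by (auto simp: hpoly_iff lookup_add)
qed

text \<open>Going up suffices for nonnegative exponents, so the variable step is an implication
  here. That admits operations such as setting a variable to \<open>0\<close>, which cannot be
  undone, and carries the degree and the range of \<open>j\<close> along.\<close>

lemma hpoly_induct [consumes 1, case_names zero const add var]:
  assumes F: "F \<in> hpoly C m d"
    and zero: "\<And>d. P d 0"
    and const: "\<And>c. c \<in> C \<Longrightarrow> P 0 (lconst c)"
    and add: "\<And>d F G. F \<in> hpoly C m d \<Longrightarrow> G \<in> hpoly C m d \<Longrightarrow> P d F \<Longrightarrow> P d G \<Longrightarrow> P d (F + G)"
    and var: "\<And>d j F. 1 \<le> j \<Longrightarrow> j \<le> m \<Longrightarrow> F \<in> hpoly C m d \<Longrightarrow> P d F \<Longrightarrow> P (Suc d) (lvar j * F)"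
    and C: "0 \<in> C" "\<And>a b. a \<in> C \<Longrightarrow> b \<in> C \<Longrightarrow> a + b \<in> C"
  shows "P d F"
proof -
  have hs: "Poly_Mapping.single \<mu> c \<in> hpoly C m d" if "c \<in> C" "pexp m \<mu>" "mdeg \<mu> = int d" for \<mu> c d
    using that C(1) by (auto simp: hpoly_iff lookup_single when_def)
  have mon: "P d (Poly_Mapping.single \<mu> c)" if "c \<in> C" "pexp m \<mu>" "mdeg \<mu> = int d" for \<mu> c d
    using that
  proof (induction d arbitrary: \<mu>)
    case 0
    have "lookup \<mu> i = 0" for i
    proof (rule ccontr)
      assume a: "lookup \<mu> i \<noteq> 0"
      have "0 < mdeg \<mu>" unfolding mdeg_def
        by (rule sum_pos2[of _ i]) (use a 0 in \<open>auto simp: pexp_def in_keys_iff order_le_neq_trans\<close>)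
      then show False using 0 by simp
    qed
    then have "\<mu> = 0" by (intro poly_mapping_eqI) simp
    then show ?case using const[OF 0(1)] by (simp add: lconst_def)
  next
    case (Suc d)
    then have "\<mu> \<noteq> 0" by auto
    then obtain i where i: "i \<in> keys \<mu>" by (metis equals0I keys_eq_empty)
    then have im: "1 \<le> i" "i \<le> m" using Suc by (auto simp: pexp_def)
    define \<nu> where "\<nu> = \<mu> - Poly_Mapping.single i 1"
    have mu: "\<mu> = Poly_Mapping.single i 1 + \<nu>" by (simp add: \<nu>_def)
    have "mdeg \<nu> = int d" using Suc(4) by (simp add: mu mdeg_add)
    moreover have "pexp m \<nu>"
    proof -
      have "1 \<le> lookup \<mu> i" using i Suc(3) by (simp add: pexp_def in_keys_iff order_le_neq_trans int_one_le_iff_zero_less)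
      moreover have "keys \<nu> \<subseteq> keys \<mu> \<union> {i}" unfolding \<nu>_def by (metis keys_diff keys_single zero_neq_one)
      ultimately show ?thesis using Suc(3) i
        by (auto simp: pexp_def \<nu>_def lookup_minus lookup_single when_def)
    qed
    ultimately show ?case
      unfolding mu lvar_single[symmetric] using Suc im hs by (intro var) auto
  qed
  have "(\<Sum>\<mu>\<in>S. Poly_Mapping.single \<mu> (lookup F \<mu>)) \<in> hpoly C m d \<and> P d (\<Sum>\<mu>\<in>S. Poly_Mapping.single \<mu> (lookup F \<mu>))"
    if "finite S" "S \<subseteq> keys F" for S
    using that
  proof (induction S)
    case empty
    then show ?case using zero C by (simp add: hpoly_iff)
  next
    case (insert x S)
    let ?G = "\<Sum>\<mu>\<in>S. Poly_Mapping.single \<mu> (lookup F \<mu>)"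
    have "lookup F x \<in> C" "pexp m x" "mdeg x = int d"
      using F insert(4) unfolding hpoly_iff by blast+
    then have x: "Poly_Mapping.single x (lookup F x) \<in> hpoly C m d" "P d (Poly_Mapping.single x (lookup F x))"
      using hs mon by blast+
    have G: "?G \<in> hpoly C m d" "P d ?G" using insert by blast+
    have "Poly_Mapping.single x (lookup F x) + ?G \<in> hpoly C m d"
      using x(1) G(1) by (rule hpoly_add') (rule C)
    then show ?case using insert(1,2) x G add by simp
  qed
  from this[OF finite_keys[of F] order_refl] show ?thesis unfolding poly_mapping_sum_singles[symmetric] by simp
qed

section \<open>Substitution\<close>

lemma lquot_eq:
  assumes "H * G = F" "G \<noteq> 0"
  shows "lquot F G = H"
  unfolding lquot_def using assms by (intro the_equality) auto

lemma lquot_1: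
  assumes "G * H = 1"
  shows "lquot 1 G = H"
  by (rule lquot_eq) (use assms in \<open>auto simp: mult.commute\<close>)

lemma lpow_0 [simp]: "lpow G 0 = 1"
  by (simp add: lpow_def)

text \<open>A negative exponent makes sense for units only, and \<open>lquot 1 0\<close> is an
  arbitrary value. The disjunction keeps the case \<open>G = 0\<close> with nonnegative exponents,
  on which the projections rest.\<close>

lemma lpow_Suc:
  assumes "0 \<le> k \<or> G * H = 1"
  shows "lpow G (k + 1) = G * lpow G k"
proof (cases "0 \<le> k")
  case True
  then show ?thesis by (simp add: lpow_def nat_add_distrib)
next
  case False
  with assms have H: "G * H = 1" by simp
  have q: "lquot 1 G = H" using H by (rule lquot_1)
  obtain n where n: "k = - int (Suc n)" using False
    by (metis linorder_not_less negD)
  have "nat (int (Suc n) - 1) = n" by simp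
  then show ?thesis using H by (simp add: lpow_def q n mult.assoc[symmetric] del: of_nat_Suc)
qed

definition lmon :: "(nat \<Rightarrow> laurent) \<Rightarrow> (nat \<Rightarrow>\<^sub>0 int) \<Rightarrow> laurent" where
  "lmon G \<mu> = (\<Prod>i\<in>keys \<mu>. lpow (G i) (lookup \<mu> i))"

lemma lmon_superset: "finite S \<Longrightarrow> keys \<mu> \<subseteq> S \<Longrightarrow> lmon G \<mu> = (\<Prod>i\<in>S. lpow (G i) (lookup \<mu> i))"
  unfolding lmon_def by (rule prod.mono_neutral_left) (auto simp: in_keys_iff)

lemma lmon_var:
  assumes "0 \<le> lookup \<mu> j \<or> G j * H = 1"
  shows "lmon G (Poly_Mapping.single j 1 + \<mu>) = G j * lmon G \<mu>"
proof -
  let ?S = "insert j (keys \<mu>)" and ?\<nu> = "Poly_Mapping.single j 1 + \<mu>"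
  have k: "keys ?\<nu> \<subseteq> ?S" using keys_add[of "Poly_Mapping.single j (1::int)" \<mu>] by (auto split: if_splits)
  have "lmon G ?\<nu> = (\<Prod>i\<in>?S. lpow (G i) (lookup ?\<nu> i))"
    by (rule lmon_superset) (use k in auto)
  also have "\<dots> = lpow (G j) (lookup \<mu> j + 1) * (\<Prod>i\<in>?S - {j}. lpow (G i) (lookup ?\<nu> i))"
    by (subst prod.remove[of _ j]) (auto simp: lookup_add add.commute)
  also have "(\<Prod>i\<in>?S - {j}. lpow (G i) (lookup ?\<nu> i)) = (\<Prod>i\<in>?S - {j}. lpow (G i) (lookup \<mu> i))"
    by (rule prod.cong) (auto simp: lookup_add lookup_single when_def)
  also have "lpow (G j) (lookup \<mu> j + 1) * \<dots> = G j * (lpow (G j) (lookup \<mu> j) * (\<Prod>i\<in>?S - {j}. lpow (G i) (lookup \<mu> i)))"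
    using lpow_Suc[OF assms] by (simp add: mult.assoc)
  also have "lpow (G j) (lookup \<mu> j) * (\<Prod>i\<in>?S - {j}. lpow (G i) (lookup \<mu> i)) = (\<Prod>i\<in>?S. lpow (G i) (lookup \<mu> i))"
    by (subst prod.remove[of ?S j]) auto
  also have "\<dots> = lmon G \<mu>" by (rule lmon_superset[symmetric]) auto
  finally show ?thesis .
qed

lemma lsubst_superset:
  assumes "finite S" "keys F \<subseteq> S"
  shows "lsubst G F = (\<Sum>\<mu>\<in>S. lconst (lookup F \<mu>) * lmon G \<mu>)"
  unfolding lsubst_def lmon_def using assms
  by (intro sum.mono_neutral_left) (auto simp: in_keys_iff)

lemma lsubst_add: "lsubst G (F + H) = lsubst G F + lsubst G H"
proof -
  let ?S = "keys F \<union> keys H"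
  have "keys (F + H) \<subseteq> ?S" by (rule keys_add)
  then show ?thesis
    by (simp add: lsubst_superset[of ?S] lookup_add lconst_add distrib_right sum.distrib)
qed

lemma lsubst_0 [simp]: "lsubst G 0 = 0"
  by (simp add: lsubst_def)

lemma lsubst_single: "lsubst G (Poly_Mapping.single \<mu> c) = lconst c * lmon G \<mu>"
  by (subst lsubst_superset[of "{\<mu>}"]) auto

lemma lsubst_lconst [simp]: "lsubst G (lconst c) = lconst c"
  by (simp add: lconst_def[of c] lsubst_single[of G 0] ) (simp add: lmon_def lconst_def)

lemma lsubst_1 [simp]: "lsubst G 1 = 1"
  using lsubst_lconst[of G 1] by simp

lemma lsubst_lvar_mult:
  assumes "(\<forall>\<mu>\<in>keys F. 0 \<le> lookup \<mu> j) \<or> G j * H = 1"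
  shows "lsubst G (lvar j * F) = G j * lsubst G F"
proof -
  have "lsubst G (lvar j * (\<Sum>\<mu>\<in>S. Poly_Mapping.single \<mu> (lookup F \<mu>))) = G j * lsubst G (\<Sum>\<mu>\<in>S. Poly_Mapping.single \<mu> (lookup F \<mu>))"
    if "finite S" "S \<subseteq> keys F" for S
    using that
  proof (induction S)
    case (insert x S)
    then have "lmon G (Poly_Mapping.single j 1 + x) = G j * lmon G x"
      using lmon_var[of x j G H] assms by auto
    then show ?case using insert
      by (simp add: distrib_left lsubst_add lvar_single lsubst_single algebra_simps)
  qed auto
  from this[OF finite_keys[of F] order_refl] show ?thesis unfolding poly_mapping_sum_singles[symmetric] by simp
qed

lemma lsubst_cong:
  assumes "\<And>i \<mu>. \<mu> \<in> keys F \<Longrightarrow> i \<in> keys \<mu> \<Longrightarrow> G i = H i"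
  shows "lsubst G F = lsubst H F"
  unfolding lsubst_def using assms by (intro sum.cong prod.cong refl arg_cong2[of _ _ _ _ "(*)"]) auto

text \<open>Substituting units gives a ring endomorphism of all Laurent polynomials; permutations,
  rescalings and cyclic shifts of the variables are of this kind.\<close>

definition unit_family :: "(nat \<Rightarrow> laurent) \<Rightarrow> bool" where
  "unit_family G \<longleftrightarrow> (\<forall>j. \<exists>H. G j * H = 1)"

lemma unit_family_nonzero: "unit_family G \<Longrightarrow> G j \<noteq> 0"
  unfolding unit_family_def by (metis mult_zero_left zero_neq_one)

lemma lsubst_unit_lvar_mult [simp]: "unit_family G \<Longrightarrow> lsubst G (lvar j * F) = G j * lsubst G F"
  unfolding unit_family_def using lsubst_lvar_mult by metis

lemma lsubst_lvar [simp]: "unit_family G \<Longrightarrow> lsubst G (lvar j) = G j"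
  using lsubst_unit_lvar_mult[of G j 1] by simp

lemma lsubst_unit_mult:
  assumes "unit_family G"
  shows "lsubst G (F * H) = lsubst G F * lsubst G H"
proof (induction F arbitrary: H rule: laurent_induct)
  case (const c)
  show ?case
  proof (induction H rule: laurent_induct)
    case (const d)
    then show ?case by (simp add: lconst_mult[symmetric])
  next
    case (add F G)
    then show ?case by (simp add: distrib_left lsubst_add)
  next
    case (var j F)
    then show ?case using unit_family_nonzero[OF assms]
      by (simp add: assms mult.left_commute[of "lconst c"])
  qed
next
  case (add F G)
  then show ?case by (simp add: distrib_right lsubst_add)
next
  case (var j F)
  then show ?case using unit_family_nonzero[OF assms]
    by (simp add: assms mult.assoc)
qed

lemma lsubst_lconst_mult: "lsubst G (lconst c * F) = lconst c * lsubst G F"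
proof -
  have "keys (lconst c * F) \<subseteq> keys F"
    by (auto simp: in_keys_iff lookup_lconst_mult)
  then show ?thesis
    by (subst (1 2) lsubst_superset[of "keys F"])
      (auto simp: lookup_lconst_mult lconst_mult sum_distrib_left mult.assoc)
qed

lemma lsubst_uminus: "lsubst G (- F) = - lsubst G F"
  using lsubst_lconst_mult[of G "-1" F] by (simp add: lconst_uminus)

lemma lsubst_diff: "lsubst G (F - H) = lsubst G F - lsubst G H"
  using lsubst_add[of G F "- H"] by (simp add: lsubst_uminus)

lemma lsubst_sum: "lsubst G (sum f A) = (\<Sum>x\<in>A. lsubst G (f x))"
  by (induction A rule: infinite_finite_induct) (simp_all add: lsubst_add)

lemma lsubst_unit_comp:
  assumes "unit_family G" "unit_family H"
  shows "lsubst G (lsubst H F) = lsubst (\<lambda>j. lsubst G (H j)) F"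
proof -
  have u: "unit_family (\<lambda>j. lsubst G (H j))"
    using assms lsubst_unit_mult[OF assms(1)] unfolding unit_family_def by (metis lsubst_1)
  show ?thesis
    by (induction F rule: laurent_induct)
      (use assms u in \<open>simp_all add: lsubst_add lsubst_unit_mult unit_family_nonzero[OF u]\<close>)
qed

lemma lsubst_id: "lsubst lvar F = F"
proof -
  have "unit_family lvar" unfolding unit_family_def using lvar_linv(1) by blast
  then show ?thesis
    by (induction F rule: laurent_induct) (simp_all add: lsubst_add)
qed

section \<open>Demazure--Lusztig operators\<close>

lemma tt_nonzero [simp]: "tt \<noteq> 0"
  by (simp add: tt_def Zero_fract_def eq_fract)

lemma qq_nonzero [simp]: "qq \<noteq> 0"
  by (simp add: qq_def Zero_fract_def eq_fract)

definition tvar :: laurent where "tvar = lconst tt"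
definition tvar_inv :: laurent where "tvar_inv = lconst (inverse tt)"

lemma tl_tli [simp]: "tvar * tvar_inv = 1" "tvar_inv * tvar = 1" "tvar * (tvar_inv * F) = F" "tvar_inv * (tvar * F) = F"
  by (simp_all add: tvar_def tvar_inv_def lconst_mult[symmetric] mult.assoc[symmetric])

lemma tl_nonzero [simp]: "tvar \<noteq> 0"
  by (simp add: tvar_def)

definition swp :: "nat \<Rightarrow> nat \<Rightarrow> laurent \<Rightarrow> laurent" where
  "swp a b F = lsubst (\<lambda>j. lvar (transpose a b j)) F"

lemma unit_family_lvar: "unit_family (\<lambda>j. lvar (p j))"
  unfolding unit_family_def using lvar_linv(1) by blast

lemma swp_simps [simp]:
  "swp a b (F + G) = swp a b F + swp a b G"
  "swp a b (F - G) = swp a b F - swp a b G"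
  "swp a b (F * G) = swp a b F * swp a b G"
  "swp a b (lconst c) = lconst c"
  "swp a b 0 = 0" "swp a b 1 = 1" "swp a b tvar = tvar" "swp a b tvar_inv = tvar_inv"
  "swp a b (lvar j) = lvar (transpose a b j)"
  by (simp_all add: swp_def lsubst_add lsubst_diff lsubst_unit_mult unit_family_lvar tvar_def tvar_inv_def)

lemma swp_commute: "swp a b F = swp b a F"
  by (simp add: swp_def transpose_commute)

definition DD :: "nat \<Rightarrow> nat \<Rightarrow> laurent \<Rightarrow> laurent" where
  "DD a b F = (THE H. H * (lvar b - lvar a) = F - swp a b F)"

text \<open>The quotient in the Hecke action is \<open>X_b (F - s F) / (X_b - X_a)\<close>, which no
  longer mentions an inverse variable. The pair is ordered: \<open>dl i (Suc i)\<close> is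
  \<open>T_i\<close>, and \<open>dl (Suc c) c\<close> is the operator \<open>T'_c\<close> on the
  side of the colorings.\<close>

definition dl :: "nat \<Rightarrow> nat \<Rightarrow> laurent \<Rightarrow> laurent" where
  "dl a b F = tvar * swp a b F + (tvar - 1) * (lvar b * DD a b F)"

text \<open>By the quadratic relation this is \<open>t\<close> times the inverse of
  \<open>dl a b\<close>; the factor \<open>t\<close> keeps inverse scalars out of the
  computations.\<close>

definition dlt :: "nat \<Rightarrow> nat \<Rightarrow> laurent \<Rightarrow> laurent" where
  "dlt a b F = dl a b F - (tvar - 1) * F"

context
  fixes a b :: nat
  assumes ab: "a \<noteq> b"
begin

lemma lvar_diff_nonzero [simp]: "lvar b - lvar a \<noteq> 0"
  using ab by simp

lemma DD_exists: "\<exists>H. H * (lvar b - lvar a) = F - swp a b F"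
proof (induction F rule: laurent_induct)
  case (const c)
  show ?case by (rule exI[of _ 0]) simp
next
  case (add F G)
  then obtain H K where "H * (lvar b - lvar a) = F - swp a b F" "K * (lvar b - lvar a) = G - swp a b G" by blast
  then show ?case by (intro exI[of _ "H + K"]) (simp add: algebra_simps)
next
  case (var j F)
  \<comment> \<open>Twisted Leibniz rule: the difference for \<open>lvar j * F\<close> is
    \<open>X_j (F - s F)\<close> plus \<open>(X_j - s X_j) s F\<close>, and
    \<open>X_j - s X_j\<close> is \<open>0\<close> or, up to sign, \<open>X_b - X_a\<close>.\<close>
  obtain c where c: "c * (lvar b - lvar a) = lvar j - lvar (transpose a b j)"
  proof (cases "j = a \<or> j = b")
    case True
    then show ?thesis using that[of 1] that[of "-1"] by auto
  next
    case False
    then show ?thesis using that[of 0] by simp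
  qed
  have s: "lvar j * F - swp a b (lvar j * F) = lvar j * (F - swp a b F) + c * (lvar b - lvar a) * swp a b F"
    unfolding c by (simp add: algebra_simps)
  have ring: "(x * H + c * y) * z = x * (H * z) + c * z * y" for x y z H :: laurent
    by (simp add: algebra_simps)
  show ?case
  proof
    assume "\<exists>H. H * (lvar b - lvar a) = lvar j * F - swp a b (lvar j * F)"
    then obtain H where "H * (lvar b - lvar a) = lvar j * F - swp a b (lvar j * F)" by blast
    then have "lvar j * (F - swp a b F) = (H - c * swp a b F) * (lvar b - lvar a)"
      unfolding s by (simp add: algebra_simps)
    then have "linv j * (lvar j * (F - swp a b F)) = linv j * (H - c * swp a b F) * (lvar b - lvar a)"
      by (simp add: mult.assoc)
    then show "\<exists>H. H * (lvar b - lvar a) = F - swp a b F" by (metis lvar_linv_mult(2))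
  next
    assume "\<exists>H. H * (lvar b - lvar a) = F - swp a b F"
    then obtain H where "H * (lvar b - lvar a) = F - swp a b F" by blast
    then have "(lvar j * H + c * swp a b F) * (lvar b - lvar a) = lvar j * F - swp a b (lvar j * F)"
      unfolding s ring by simp
    then show "\<exists>H. H * (lvar b - lvar a) = lvar j * F - swp a b (lvar j * F)" by blast
  qed
qed

lemma DD_mult: "DD a b F * (lvar b - lvar a) = F - swp a b F"
proof -
  obtain H where H: "H * (lvar b - lvar a) = F - swp a b F" using DD_exists by blast
  have "DD a b F = H" unfolding DD_def
    using H lvar_diff_nonzero by (intro the_equality) (metis mult_right_cancel)+
  then show ?thesis using H by simp
qed

lemma DD_eqI: "H * (lvar b - lvar a) = F - swp a b F \<Longrightarrow> DD a b F = H"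
  using DD_mult[of F] lvar_diff_nonzero by (metis mult_right_cancel)

lemma DD_add: "DD a b (F + G) = DD a b F + DD a b G"
  by (rule DD_eqI) (simp add: distrib_right DD_mult)

lemma DD_smult: "swp a b c = c \<Longrightarrow> DD a b (c * F) = c * DD a b F"
  by (rule DD_eqI) (simp add: mult.assoc DD_mult, simp add: right_diff_distrib)

lemma DD_const: "swp a b F = F \<Longrightarrow> DD a b F = 0"
  by (rule DD_eqI) simp

lemma DD_a: "DD a b (lvar a * F) = lvar a * DD a b F - swp a b F"
  by (rule DD_eqI) (simp add: left_diff_distrib mult.assoc DD_mult, simp add: algebra_simps)

lemma DD_b: "DD a b (lvar b * F) = lvar b * DD a b F + swp a b F"
  by (rule DD_eqI) (simp add: distrib_right mult.assoc DD_mult, simp add: algebra_simps)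

lemma dl_add [simp]: "dl a b (F + G) = dl a b F + dl a b G"
  by (simp add: dl_def DD_add algebra_simps)

lemma dl_smult: "swp a b c = c \<Longrightarrow> dl a b (c * F) = c * dl a b F"
  by (simp add: dl_def DD_smult, simp add: algebra_simps)

lemma dl_lconst_mult [simp]: "dl a b (lconst c * F) = lconst c * dl a b F"
  by (simp add: dl_smult)

lemma dl_tl_mult [simp]: "dl a b (tvar * F) = tvar * dl a b F" "dl a b (tvar_inv * F) = tvar_inv * dl a b F"
  by (simp_all add: tvar_def tvar_inv_def)

lemma dl_sum: "dl a b (sum f A) = (\<Sum>x\<in>A. dl a b (f x))"
proof (induction A rule: infinite_finite_induct)
  case (infinite A)
  then show ?case using dl_lconst_mult[of 0] by simp
next
  case empty
  then show ?case using dl_lconst_mult[of 0] by simp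
qed simp

lemma dl_const: "swp a b F = F \<Longrightarrow> dl a b F = tvar * F"
  by (simp add: dl_def DD_const)

lemma dl_lconst [simp]: "dl a b (lconst c) = tvar * lconst c"
  by (simp add: dl_const)

lemma dl_0 [simp]: "dl a b 0 = 0"
  by (simp add: dl_const)

lemma dl_diff [simp]: "dl a b (F - G) = dl a b F - dl a b G"
  using dl_add[of "F - G" G] by simp

lemma dl_other [simp]: "j \<noteq> a \<Longrightarrow> j \<noteq> b \<Longrightarrow> dl a b (lvar j * F) = lvar j * dl a b F"
  by (simp add: dl_smult)

lemma swp_DD: "swp a b F = F - DD a b F * (lvar b - lvar a)"
  by (simp add: DD_mult)

text \<open>Together with \<open>dl_a\<close>, \<open>dl_other\<close> and the value on constants
  this determines \<open>dl\<close>; operator identities are derived from these rules by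
  \<open>laurent_induct\<close>, without returning to the quotient.\<close>

lemma dl_b: "dl a b (lvar b * F) = lvar a * dl a b F + (tvar - 1) * (lvar b * F)"
  by (simp add: dl_def DD_b, simp add: swp_DD algebra_simps)

lemma dl_a: "dl a b (lvar a * F) = lvar b * dlt a b F"
  by (simp add: dl_def dlt_def DD_a, simp add: swp_DD algebra_simps)

lemma dlt_add [simp]: "dlt a b (F + G) = dlt a b F + dlt a b G"
  by (simp add: dlt_def algebra_simps)

lemma dlt_smult: "swp a b c = c \<Longrightarrow> dlt a b (c * F) = c * dlt a b F"
  by (simp add: dlt_def dl_smult, simp add: algebra_simps)

lemma dlt_lconst_mult [simp]: "dlt a b (lconst c * F) = lconst c * dlt a b F"
  by (simp add: dlt_smult)

lemma dlt_tl_mult [simp]: "dlt a b (tvar * F) = tvar * dlt a b F" "dlt a b (tvar_inv * F) = tvar_inv * dlt a b F"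
  by (simp_all add: dlt_smult)

lemma dlt_lconst [simp]: "dlt a b (lconst c) = lconst c"
  by (simp add: dlt_def algebra_simps)

lemma dlt_0 [simp]: "dlt a b 0 = 0"
  by (simp add: dlt_def)

lemma dlt_1 [simp]: "dlt a b 1 = 1"
  using dlt_lconst[of 1] by simp

lemma dlt_sum: "dlt a b (sum f A) = (\<Sum>x\<in>A. dlt a b (f x))"
  by (simp add: dlt_def dl_sum sum_subtractf sum_distrib_left)

lemma dlt_other [simp]: "j \<noteq> a \<Longrightarrow> j \<noteq> b \<Longrightarrow> dlt a b (lvar j * F) = lvar j * dlt a b F"
  by (simp add: dlt_smult)

lemma dlt_b: "dlt a b (lvar b * F) = lvar a * dl a b F"
  by (simp add: dlt_def dl_b)

lemma dlt_a: "dlt a b (lvar a * F) = lvar b * dlt a b F - (tvar - 1) * (lvar a * F)"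
  by (simp add: dlt_def[of a b "lvar a * F"] dl_a)

lemma dl_tl1 [simp]: "dl a b ((tvar - 1) * F) = (tvar - 1) * dl a b F"
  "dlt a b ((tvar - 1) * F) = (tvar - 1) * dlt a b F"
  by (simp_all add: dlt_smult dl_smult)

text \<open>This is \<open>(T - t)(T + 1) = 0\<close> in the form
  \<open>T (T - (t - 1)) = t\<close>. Passing \<open>X_a\<close> or \<open>X_b\<close> through both
  factors returns the same variable in front, since \<open>dl_a\<close> and \<open>dlt_b\<close>
  exchange the two operators.\<close>

lemma dl_dlt [simp]: "dl a b (dlt a b F) = tvar * F"
proof (induction F rule: laurent_induct)
  case (var j F)
  consider "j = a" | "j = b" | "j \<noteq> a" "j \<noteq> b" by blast
  then show ?case
  proof cases
    case 1
    have "dl a b (dlt a b (lvar a * F)) = lvar a * dl a b (dlt a b F)"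
      by (simp add: dlt_a dl_b dl_a)
    then show ?thesis using 1 by (simp add: mult.left_commute[of tvar])
  next
    case 2
    have "dl a b (dlt a b (lvar b * F)) = lvar b * dlt a b (dl a b F)"
      by (simp add: dlt_b dl_a)
    also have "dlt a b (dl a b F) = dl a b (dlt a b F)"
      by (simp add: dlt_def)
    finally show ?thesis using 2 by (simp add: mult.left_commute[of tvar])
  qed (simp add: mult.left_commute[of tvar])
qed (simp_all add: algebra_simps)

lemma dlt_dl [simp]: "dlt a b (dl a b F) = tvar * F"
proof -
  have "dlt a b (dl a b F) = dl a b (dlt a b F)"
    by (simp add: dlt_def)
  then show ?thesis by simp
qed

lemma dl_dl: "dl a b (dl a b F) = (tvar - 1) * dl a b F + tvar * F"
  using dl_dlt[of F] by (simp add: dlt_def del: dl_dlt, simp add: algebra_simps)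

lemma dl_eq_tl_iff: "dl a b F = tvar * F \<longleftrightarrow> dlt a b F = F"
  by (simp add: dlt_def algebra_simps)

text \<open>For an eigenvector to the eigenvalue \<open>t\<close> the definition gives
  \<open>(t X_a - X_b) DD a b F = 0\<close>; there are no zero divisors, so the divided difference
  vanishes. This is how Hecke invariance becomes symmetry.\<close>

lemma dl_symmetric_iff: "dl a b F = tvar * F \<longleftrightarrow> swp a b F = F"
proof
  assume "dl a b F = tvar * F"
  then have "(lvar b * (tvar - 1) - tvar * (lvar b - lvar a)) * DD a b F = 0"
    by (simp add: dl_def swp_DD algebra_simps)
  moreover have "lvar b * (tvar - 1) - tvar * (lvar b - lvar a) \<noteq> 0"
  proof
    assume "lvar b * (tvar - 1) - tvar * (lvar b - lvar a) = 0"
    then have "tvar * lvar a = lvar b" by (simp add: algebra_simps)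
    then have "lookup (tvar * lvar a) (Poly_Mapping.single b 1) = 1" by (simp add: lookup_lvar)
    then show False using ab by (simp add: tvar_def lookup_lconst_mult lookup_lvar when_def split: if_splits)
      (metis inj_single keys_single singleton_inject zero_neq_one)
  qed
  ultimately show "swp a b F = F" by (simp add: swp_DD)
qed (rule dl_const)

end

lemma dl_commute:
  assumes "a \<noteq> b" "c \<noteq> d" "a \<noteq> c" "a \<noteq> d" "b \<noteq> c" "b \<noteq> d"
  shows "dl a b (dl c d F) = dl c d (dl a b F)"
proof (induction F rule: laurent_induct)
  case (var j F)
  have 1: "dlt a b (dl c d F) = dl c d (dlt a b F) \<longleftrightarrow> dl a b (dl c d F) = dl c d (dl a b F)"
    "dl a b (dlt c d F) = dlt c d (dl a b F) \<longleftrightarrow> dl a b (dl c d F) = dl c d (dl a b F)"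
    using assms by (simp_all add: dlt_def)
  consider "j = a" | "j = b" | "j = c" | "j = d" | "j \<notin> {a,b,c,d}" by blast
  then show ?case
    by cases (use assms in \<open>simp_all add: dl_a dl_b 1\<close>)
qed (use assms in \<open>simp_all\<close>)

lemma dl_braid:
  assumes "a \<noteq> b" "b \<noteq> c" "a \<noteq> c"
  shows "dl a b (dl b c (dl a b F)) = dl b c (dl a b (dl b c F))"
proof (induction F rule: laurent_induct)
  case (var j F)
  \<comment> \<open>The defect of the braid relation passes the variables like the longest
    permutation of \<open>a\<close>, \<open>b\<close>, \<open>c\<close>, exchanging
    \<open>X_a\<close> and \<open>X_c\<close>. So it vanishes on \<open>F\<close> exactly if it
    vanishes on \<open>lvar j * F\<close>.\<close>
  define B where "B F = dl a b (dl b c (dl a b F)) - dl b c (dl a b (dl b c F))" for F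
  have iff: "(X = Y) = (X - Y = 0)" for X Y :: laurent by simp
  have 1: "B (lvar a * F) = lvar c * B F"
    using assms by (simp add: B_def dl_a dl_b dlt_a dlt_b) (simp add: dlt_def dl_dl, simp add: algebra_simps)
  have 2: "B (lvar b * F) = lvar b * B F"
    using assms by (simp add: B_def dl_a dl_b dlt_a dlt_b) (simp add: dlt_def dl_dl, simp add: algebra_simps)
  have 3: "B (lvar c * F) = lvar a * B F"
    using assms by (simp add: B_def dl_a dl_b dlt_a dlt_b) (simp add: dlt_def dl_dl, simp add: algebra_simps)
  consider "j = a" | "j = b" | "j = c" | "j \<notin> {a,b,c}" by blast
  then have "B (lvar j * F) = 0 \<longleftrightarrow> B F = 0"
    by cases (use 1 2 3 assms in \<open>simp_all, simp add: B_def\<close>)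
  then show ?case by (simp add: B_def)
qed (use assms in \<open>simp_all\<close>)

declare One_nat_def [simp del]

section \<open>The cyclic operator\<close>

text \<open>The parameter \<open>q\<close> is explicit because the same operator is needed for
  \<open>qq\<close> and for \<open>1\<close>. Variables outside \<open>1, ..., m\<close> stay fixed,
  which makes \<open>rho\<close> an automorphism of all Laurent polynomials when \<open>q\<close> is
  nonzero.\<close>

definition rho :: "qt \<Rightarrow> nat \<Rightarrow> laurent \<Rightarrow> laurent" where
  "rho q m = lsubst (\<lambda>j. if j = m then lconst (inverse q) * lvar 1
     else if 1 \<le> j \<and> j < m then lvar (Suc j) else lvar j)"

definition rhoi :: "qt \<Rightarrow> nat \<Rightarrow> laurent \<Rightarrow> laurent" where
  "rhoi q m = lsubst (\<lambda>j. if j = 1 then lconst q * lvar m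
     else if 1 < j \<and> j \<le> m then lvar (j - 1) else lvar j)"

definition PQ :: "qt \<Rightarrow> nat \<Rightarrow> laurent \<Rightarrow> laurent" where
  "PQ q m F = lvar 1 * rho q m F"

definition PQi :: "qt \<Rightarrow> nat \<Rightarrow> laurent \<Rightarrow> laurent" where
  "PQi q m F = rhoi q m (linv 1 * F)"

lemma unit_familyI:
  assumes "\<And>j. \<exists>c p. c \<noteq> 0 \<and> G j = lconst c * lvar p"
  shows "unit_family G"
  unfolding unit_family_def
proof
  fix j
  obtain c p where "c \<noteq> 0" "G j = lconst c * lvar p" using assms by blast
  then have "G j * (lconst (inverse c) * linv p) = (lconst c * lconst (inverse c)) * (lvar p * linv p)"
    by (simp only: ac_simps)
  also have "\<dots> = 1" using \<open>c \<noteq> 0\<close> by (simp add: lconst_mult[symmetric])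
  finally show "\<exists>H. G j * H = 1" by blast
qed

lemma unit_family_mono:
  assumes "\<And>j. c j \<noteq> 0" "\<And>j. G j = lconst (c j) * lvar (p j)"
  shows "unit_family G"
  using assms by (intro unit_familyI) blast

context
  fixes q :: qt and m :: nat
  assumes q: "q \<noteq> 0" and m: "1 \<le> m"
begin

lemma unit_family_rho: "unit_family (\<lambda>j. if j = m then lconst (inverse q) * lvar 1
     else if 1 \<le> j \<and> j < m then lvar (Suc j) else lvar j)"
  by (rule unit_family_mono[of "\<lambda>j. if j = m then inverse q else 1" _
        "\<lambda>j. if j = m then 1 else if 1 \<le> j \<and> j < m then Suc j else j"]) (use q in auto)

lemma unit_family_rhoi: "unit_family (\<lambda>j. if j = 1 then lconst q * lvar m
     else if 1 < j \<and> j \<le> m then lvar (j - 1) else lvar j)"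
  by (rule unit_family_mono[of "\<lambda>j. if j = 1 then q else 1" _
        "\<lambda>j. if j = 1 then m else if 1 < j \<and> j \<le> m then j - 1 else j"]) (use q in auto)

lemma rho_simps [simp]:
  "rho q m (F + G) = rho q m F + rho q m G"
  "rho q m (F - G) = rho q m F - rho q m G"
  "rho q m (F * G) = rho q m F * rho q m G"
  "rho q m (lconst c) = lconst c"
  "rho q m 0 = 0" "rho q m 1 = 1" "rho q m tvar = tvar" "rho q m tvar_inv = tvar_inv"
  using lsubst_unit_mult[OF unit_family_rho]
  by (simp_all add: rho_def lsubst_add lsubst_diff tvar_def tvar_inv_def)

lemma rho_lvar:
  "rho q m (lvar j) = (if j = m then lconst (inverse q) * lvar 1
     else if 1 \<le> j \<and> j < m then lvar (Suc j) else lvar j)"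
  unfolding rho_def using lsubst_lvar[OF unit_family_rho] .

lemma rhoi_simps [simp]:
  "rhoi q m (F + G) = rhoi q m F + rhoi q m G"
  "rhoi q m (F - G) = rhoi q m F - rhoi q m G"
  "rhoi q m (F * G) = rhoi q m F * rhoi q m G"
  "rhoi q m (lconst c) = lconst c"
  "rhoi q m 0 = 0" "rhoi q m 1 = 1"
  using lsubst_unit_mult[OF unit_family_rhoi]
  by (simp_all add: rhoi_def lsubst_add lsubst_diff)

lemma rhoi_lvar:
  "rhoi q m (lvar j) = (if j = 1 then lconst q * lvar m
     else if 1 < j \<and> j \<le> m then lvar (j - 1) else lvar j)"
  unfolding rhoi_def using lsubst_lvar[OF unit_family_rhoi] .

lemma lconst_q [simp]: "lconst q * (lconst (inverse q) * F) = F" "lconst (inverse q) * (lconst q * F) = F"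
  using q by (simp_all add: mult.assoc[symmetric] lconst_mult[symmetric])

lemma rho_rhoi [simp]: "rho q m (rhoi q m F) = F"
proof (induction F rule: laurent_induct)
  case (var j F)
  have "rho q m (rhoi q m (lvar j)) = lvar j"
    using m by (auto simp: rho_lvar rhoi_lvar)
  then show ?case by simp
qed simp_all

lemma rhoi_rho [simp]: "rhoi q m (rho q m F) = F"
proof (induction F rule: laurent_induct)
  case (var j F)
  have "rhoi q m (rho q m (lvar j)) = lvar j"
    using m by (auto simp: rho_lvar rhoi_lvar)
  then show ?case by simp
qed simp_all

lemma PQ_PQi [simp]: "PQ q m (PQi q m F) = F"
  by (simp add: PQ_def PQi_def del: rhoi_simps)

lemma PQi_PQ [simp]: "PQi q m (PQ q m F) = F"
  by (simp add: PQ_def PQi_def del: rhoi_simps)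

lemma PQ_add [simp]: "PQ q m (F + G) = PQ q m F + PQ q m G"
  by (simp add: PQ_def algebra_simps)

lemma PQ_diff [simp]: "PQ q m (F - G) = PQ q m F - PQ q m G"
  by (simp add: PQ_def algebra_simps)

lemma PQ_0 [simp]: "PQ q m 0 = 0"
  by (simp add: PQ_def)

lemma PQ_lconst_mult [simp]: "PQ q m (lconst c * F) = lconst c * PQ q m F"
  by (simp add: PQ_def algebra_simps)

lemma PQ_tl_mult [simp]: "PQ q m (tvar * F) = tvar * PQ q m F" "PQ q m (tvar_inv * F) = tvar_inv * PQ q m F"
  by (simp_all add: tvar_def tvar_inv_def)

lemma PQ_tl1_mult [simp]: "PQ q m ((tvar - 1) * F) = (tvar - 1) * PQ q m F"
  by (simp add: left_diff_distrib)

lemma PQi_add [simp]: "PQi q m (F + G) = PQi q m F + PQi q m G"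
  by (simp add: PQi_def distrib_left del: rhoi_simps(3))

lemma PQi_lconst_mult [simp]: "PQi q m (lconst c * F) = lconst c * PQi q m F"
  by (metis PQ_PQi PQi_PQ PQ_lconst_mult)

lemma rho_dl:
  assumes "1 \<le> i" "Suc i < m"
  shows "rho q m (dl i (Suc i) F) = dl (Suc i) (Suc (Suc i)) (rho q m F)"
proof (induction F rule: laurent_induct)
  case (var j F)
  have t: "rho q m (dlt i (Suc i) F) = dlt (Suc i) (Suc (Suc i)) (rho q m F) \<longleftrightarrow>
     rho q m (dl i (Suc i) F) = dl (Suc i) (Suc (Suc i)) (rho q m F)" for F
    by (simp add: dlt_def)
  consider "j = i" | "j = Suc i" | "j = m" "j \<noteq> i" "j \<noteq> Suc i" | "j \<notin> {i, Suc i, m}" by blast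
  then show ?case
    by cases (use assms q in \<open>auto simp: dl_a dl_b rho_lvar t mult.assoc\<close>)
qed simp_all

lemma PQ_dl:
  assumes "1 \<le> i" "Suc i < m"
  shows "PQ q m (dl i (Suc i) F) = dl (Suc i) (Suc (Suc i)) (PQ q m F)"
  using assms by (simp add: PQ_def rho_dl)

text \<open>Stands for \<open>\<Pi> T_{m-1} = T_0 \<Pi>\<close> followed by
  \<open>\<Pi> T_0 = T_1 \<Pi>\<close>, with \<open>T_0\<close> eliminated. The variables
  \<open>X_{m-1}\<close> and \<open>X_m\<close> arrive at \<open>X_1\<close> and \<open>X_2\<close>
  with the same factor \<open>inverse q\<close>, so the operator does not see it.\<close>

lemma rho_rho_dl:
  assumes "2 \<le> m"
  shows "rho q m (rho q m (dl (m - 1) m F)) = dl 1 2 (rho q m (rho q m F))"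
proof (induction F rule: laurent_induct)
  case (var j F)
  have mm: "m - 1 \<noteq> m" "Suc (m - 1) = m" using assms by auto
  have v: "rho q m (rho q m (lvar (m - 1))) = lconst (inverse q) * lvar 1"
    "rho q m (rho q m (lvar m)) = lconst (inverse q) * lvar 2"
    using assms by (auto simp: rho_lvar numeral_2_eq_2)
  have o: "rho q m (rho q m (lvar j)) = (if 1 \<le> j \<and> j < m then lvar (j + 2) else lvar j)" if "j \<noteq> m - 1" "j \<noteq> m"
    using assms that by (auto simp: rho_lvar)
  have t: "rho q m (rho q m (dlt (m - 1) m F)) = dlt 1 2 (rho q m (rho q m F)) \<longleftrightarrow>
     rho q m (rho q m (dl (m - 1) m F)) = dl 1 2 (rho q m (rho q m F))" for F
    using mm by (simp add: dlt_def)
  consider "j = m - 1" | "j = m" | "j = 0" | "j \<noteq> m - 1" "j \<noteq> m" "j \<noteq> 0" by blast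
  then show ?case
  proof cases
    case 1
    then show ?thesis using mm q by (simp add: dl_a v mult.assoc t)
  next
    case 2
    then show ?thesis using mm q by (simp add: dl_b v mult.assoc) (simp add: algebra_simps)
  next
    case 3
    then have "rho q m (rho q m (lvar j)) = lvar j" using assms by (simp add: rho_lvar)
    then show ?thesis using 3 mm assms by simp
  next
    case 4
    then have "rho q m (rho q m (lvar j)) = lvar (if j < m then j + 2 else j)" using o by simp
    moreover have "(if j < m then j + 2 else j) \<noteq> 1" "(if j < m then j + 2 else j) \<noteq> 2" using 4 assms by auto
    ultimately show ?thesis using 4 mm assms by simp
  qed
qed (use assms in \<open>simp_all\<close>)

lemma PQ_PQ_dl:
  assumes "2 \<le> m"
  shows "PQ q m (PQ q m (dl (m - 1) m F)) = dl 1 2 (PQ q m (PQ q m F))"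
proof -
  have "rho q m (lvar 1) = lvar 2" using assms by (simp add: rho_lvar numeral_2_eq_2)
  moreover have "dl 1 2 ((lvar 1 * lvar 2) * G) = (lvar 1 * lvar 2) * dl 1 2 G" for G
    by (rule dl_smult) (simp_all add: mult.commute)
  ultimately show ?thesis using assms by (simp add: PQ_def rho_rho_dl mult.assoc)
qed

end

lemma single_1_eq_iff: "Poly_Mapping.single i (1::int) = Poly_Mapping.single j 1 \<longleftrightarrow> i = j"
  by (metis lookup_single_eq lookup_single_not_eq zero_neq_one)

section \<open>Action of the generators on Laurent polynomials\<close>

text \<open>Setting the foreign variables to the unit \<open>1\<close> is a ring homomorphism whose
  fixed points form \<open>laurent_ring m\<close>; closure under an operator then follows from
  commuting with \<open>restrv m\<close>.\<close>

definition restrv :: "nat \<Rightarrow> laurent \<Rightarrow> laurent" where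
  "restrv m = lsubst (\<lambda>j. if 1 \<le> j \<and> j \<le> m then lvar j else 1)"

lemma unit_family_restrv: "unit_family (\<lambda>j. if 1 \<le> j \<and> j \<le> m then lvar j else 1)"
  unfolding unit_family_def
proof
  show "\<exists>H. (if 1 \<le> j \<and> j \<le> m then lvar j else 1) * H = 1" for j
    by (rule exI[of _ "if 1 \<le> j \<and> j \<le> m then linv j else 1"]) simp
qed

lemma restrv_simps [simp]:
  "restrv m (F + G) = restrv m F + restrv m G"
  "restrv m (F - G) = restrv m F - restrv m G"
  "restrv m (F * G) = restrv m F * restrv m G"
  "restrv m (lconst c) = lconst c"
  "restrv m 1 = 1"
  "restrv m (lvar j) = (if 1 \<le> j \<and> j \<le> m then lvar j else 1)"
  using lsubst_unit_mult[OF unit_family_restrv[of m]] lsubst_lvar[OF unit_family_restrv[of m]]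
  by (simp_all add: restrv_def lsubst_add lsubst_diff)

lemma restrv_tl [simp]: "restrv m tvar = tvar"
  by (simp add: tvar_def)

lemma laurent_ring_mult:
  assumes "F \<in> laurent_ring m" "G \<in> laurent_ring m"
  shows "F * G \<in> laurent_ring m"
  unfolding laurent_ring_def
proof (safe)
  fix \<mu> x
  assume "\<mu> \<in> keys (F * G)" and x: "x \<in> keys \<mu>"
  then obtain a b where "a \<in> keys F" "b \<in> keys G" "\<mu> = a + b" using keys_mult[of F G] by blast
  then show "x \<in> {1..m}" using x keys_add[of a b] assms unfolding laurent_ring_def by blast
qed

lemma laurent_ring_lvar: "1 \<le> j \<Longrightarrow> j \<le> m \<Longrightarrow> lvar j \<in> laurent_ring m"
  by (simp add: laurent_ring_def lvar_def)

lemma laurent_ring_linv: "1 \<le> j \<Longrightarrow> j \<le> m \<Longrightarrow> linv j \<in> laurent_ring m"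
  by (simp add: laurent_ring_def linv_def)

lemma restrv_in_laurent_ring: "restrv m F \<in> laurent_ring m"
proof (induction F rule: laurent_induct)
  case (const c)
  show ?case by (simp only: restrv_simps) (auto simp: laurent_ring_def lconst_def)
next
  case (add F G)
  then show ?case using keys_add[of "restrv m F" "restrv m G"] by (auto simp: laurent_ring_def)
next
  case (var j F)
  show ?case
  proof (cases "1 \<le> j \<and> j \<le> m")
    case True
    show ?thesis
    proof
      assume "restrv m (lvar j * F) \<in> laurent_ring m"
      then have "lvar j * restrv m F \<in> laurent_ring m" using True by simp
      then have "linv j * (lvar j * restrv m F) \<in> laurent_ring m"
        using True laurent_ring_mult[OF laurent_ring_linv] by blast
      then show "restrv m F \<in> laurent_ring m" by simp
    next
      assume "restrv m F \<in> laurent_ring m"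
      then have "lvar j * restrv m F \<in> laurent_ring m"
        using True laurent_ring_mult[OF laurent_ring_lvar] by blast
      then show "restrv m (lvar j * F) \<in> laurent_ring m" using True by simp
    qed
  qed auto
qed

lemma laurent_ring_iff: "F \<in> laurent_ring m \<longleftrightarrow> restrv m F = F"
proof
  assume F: "F \<in> laurent_ring m"
  have "restrv m F = lsubst lvar F" unfolding restrv_def
    by (rule lsubst_cong) (use F in \<open>force simp: laurent_ring_def\<close>)
  then show "restrv m F = F" by (simp add: lsubst_id)
next
  assume "restrv m F = F"
  then show "F \<in> laurent_ring m" using restrv_in_laurent_ring by metis
qed

lemma restrv_dl:
  assumes "1 \<le> i" "Suc i \<le> m"
  shows "restrv m (dl i (Suc i) F) = dl i (Suc i) (restrv m F)"
proof (induction F rule: laurent_induct)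
  case (var j F)
  have t: "restrv m (dlt i (Suc i) F) = dlt i (Suc i) (restrv m F) \<longleftrightarrow>
     restrv m (dl i (Suc i) F) = dl i (Suc i) (restrv m F)" for F
    by (simp add: dlt_def)
  consider "j = i" | "j = Suc i" | "j \<noteq> i" "j \<noteq> Suc i" by blast
  then show ?case
    by cases (use assms in \<open>auto simp: dl_a dl_b t\<close>)
qed simp_all

lemma dl_in_laurent_ring:
  "1 \<le> i \<Longrightarrow> Suc i \<le> m \<Longrightarrow> F \<in> laurent_ring m \<Longrightarrow> dl i (Suc i) F \<in> laurent_ring m"
  by (simp add: laurent_ring_iff restrv_dl)

lemma restrv_rho:
  assumes "q \<noteq> 0" "1 \<le> m"
  shows "restrv m (rho q m F) = rho q m (restrv m F)"
  by (induction F rule: laurent_induct) (use assms in \<open>auto simp: rho_lvar\<close>)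

lemma restrv_rhoi:
  assumes "q \<noteq> 0" "1 \<le> m"
  shows "restrv m (rhoi q m F) = rhoi q m (restrv m F)"
  by (induction F rule: laurent_induct) (use assms in \<open>auto simp: rhoi_lvar\<close>)

lemma PQ_in_laurent_ring:
  assumes "q \<noteq> 0" "1 \<le> m" "F \<in> laurent_ring m"
  shows "PQ q m F \<in> laurent_ring m"
  using assms by (simp add: PQ_def laurent_ring_iff restrv_rho)

lemma PQi_in_laurent_ring:
  assumes "q \<noteq> 0" "1 \<le> m" "F \<in> laurent_ring m"
  shows "PQi q m F \<in> laurent_ring m"
proof -
  have "linv 1 * F \<in> laurent_ring m" using assms laurent_ring_mult laurent_ring_linv by simp
  then show ?thesis using restrv_rhoi[OF assms(1,2), of "linv 1 * F"]
    unfolding PQi_def laurent_ring_iff by argo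
qed

lemma Xv_in_range: "1 \<le> j \<Longrightarrow> j \<le> m \<Longrightarrow> Xv m (int j) = lvar j"
  by (simp add: Xv_def nat_add_distrib)

lemma Xv_0: "1 \<le> m \<Longrightarrow> Xv m 0 = lconst qq * lvar m"
proof -
  assume m: "1 \<le> m"
  have "(0 - 1) div int m = -1" using m by (simp add: div_eq_minus1)
  moreover have "(0 - 1) mod int m = int m - 1" using m by (simp add: zmod_minus1)
  ultimately show ?thesis unfolding Xv_def by simp
qed

lemma Xv_Suc: "1 \<le> m \<Longrightarrow> Xv m (int m + 1) = lconst (inverse qq) * lvar 1"
  by (simp add: Xv_def power_int_minus)

lemma Pi_op_eq:
  assumes "1 \<le> m" "F \<in> laurent_ring m"
  shows "Pi_op m F = PQ qq m F"
proof -
  have "Xv m (int j + 1) = (if j = m then lconst (inverse qq) * lvar 1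
     else if 1 \<le> j \<and> j < m then lvar (Suc j) else lvar j)" if "1 \<le> j" "j \<le> m" for j
    using that Xv_in_range[of "Suc j" m] Xv_Suc[of m] by (auto simp: add.commute)
  then have "lsubst (\<lambda>j. Xv m (int j + 1)) F = rho qq m F"
    unfolding rho_def using assms by (intro lsubst_cong) (auto simp: laurent_ring_def subset_iff)
  then show ?thesis using Xv_in_range[of 1 m] assms by (simp add: Pi_op_def PQ_def)
qed

lemma Pi_inv_eq:
  assumes "1 \<le> m" "F \<in> laurent_ring m"
  shows "inv_into (laurent_ring m) (Pi_op m) F = PQi qq m F"
proof -
  have inj: "inj_on (Pi_op m) (laurent_ring m)"
    by (rule inj_onI) (metis Pi_op_eq PQi_PQ qq_nonzero assms(1))
  have "PQi qq m F \<in> laurent_ring m" using assms PQi_in_laurent_ring by simp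
  moreover have "Pi_op m (PQi qq m F) = F" using calculation assms by (simp add: Pi_op_eq)
  ultimately show ?thesis using inv_into_f_f[OF inj] by metis
qed

text \<open>\<open>T_0\<close> is taken as the conjugate of \<open>T_{m-1}\<close> by
  \<open>\<Pi>\<close>; its agreement with the explicit formula for \<open>s_0\<close> is
  \<open>T_op_0\<close>.\<close>

definition TT :: "nat \<Rightarrow> nat \<Rightarrow> laurent \<Rightarrow> laurent" where
  "TT m i F = (if i = 0 then PQ qq m (dl (m - 1) m (PQi qq m F)) else dl i (Suc i) F)"

lemma T_op_eq_dl:
  assumes "1 \<le> i" "i < m"
  shows "T_op m i F = dl i (Suc i) F"
proof -
  have s: "s_op m i F = swp i (Suc i) F" using assms by (simp add: s_op_def swp_def Suc_eq_plus1)
  have x: "Xv m (int i) = lvar i" "Xv m (int i + 1) = lvar (Suc i)"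
    using assms Xv_in_range[of i m] Xv_in_range[of "Suc i" m] by (auto simp: add.commute)
  have l: "lquot 1 (lvar (Suc i)) = linv (Suc i)" by (rule lquot_1) simp
  have d: "(lvar (Suc i) * DD i (Suc i) F) * (1 - lvar i * linv (Suc i)) = F - swp i (Suc i) F"
  proof -
    have "(lvar (Suc i) * DD i (Suc i) F) * (1 - lvar i * linv (Suc i))
       = DD i (Suc i) F * (lvar (Suc i) - (lvar (Suc i) * linv (Suc i)) * lvar i)"
      by (simp only: right_diff_distrib left_diff_distrib ac_simps mult_1_right mult_1_left)
    then show ?thesis using DD_mult[of i "Suc i" F] by simp
  qed
  have "1 - lvar i * linv (Suc i) \<noteq> 0"
  proof
    assume "1 - lvar i * linv (Suc i) = 0"
    then have "lvar (Suc i) * 1 = lvar (Suc i) * (lvar i * linv (Suc i))" by simp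
    then show False by (simp add: mult.left_commute del: mult_cancel_left)
  qed
  then have "lquot (F - swp i (Suc i) F) (1 - lvar i * linv (Suc i)) = lvar (Suc i) * DD i (Suc i) F"
    using d by (rule lquot_eq[rotated])
  then show ?thesis by (simp add: T_op_def s x l dl_def tvar_def lconst_diff)
qed

text \<open>Writing \<open>F = \<Pi> G\<close>, the substitution in \<open>s_0\<close> turns into
  \<open>s_{m-1}\<close> on \<open>G\<close>, while the prefactor \<open>X_1 X_0^{-1}\<close> undoes
  its effect on the leading \<open>X_1\<close> of \<open>\<Pi>\<close>.\<close>

lemma T_op_0:
  assumes m: "2 \<le> m"
  shows "T_op m 0 F = TT m 0 F"
proof -
  define G where "G = PQi qq m F"
  have F: "F = PQ qq m G" using assms by (simp add: G_def)
  have m1: "1 \<le> m" "m - 1 \<noteq> m" using assms by auto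
  let ?s = "lsubst (\<lambda>j. if j = 1 then Xv m 0 else if j = m then Xv m (int m + 1) else lvar j)"
  have u: "unit_family (\<lambda>j. if j = 1 then Xv m 0 else if j = m then Xv m (int m + 1) else lvar j)"
    by (rule unit_family_mono[of "\<lambda>j. if j = 1 then qq else if j = m then inverse qq else 1" _
          "\<lambda>j. if j = 1 then m else if j = m then 1 else j"])
      (use m1 in \<open>auto simp: Xv_0 Xv_Suc\<close>)
  have sv: "?s (lvar j) = (if j = 1 then lconst qq * lvar m else if j = m then lconst (inverse qq) * lvar 1 else lvar j)" for j
    using lsubst_lvar[OF u] m1 by (simp add: Xv_0 Xv_Suc)
  have q: "qq * inverse qq = 1" "inverse qq * qq = 1" by simp_all
  have sr: "?s (rho qq m F) = rho qq m (swp (m - 1) m F)" for F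
  proof (induction F rule: laurent_induct)
    case (var j F)
    have "?s (rho qq m (lvar j)) = rho qq m (lvar (transpose (m - 1) m j))"
      using m m1 sv lsubst_unit_mult[OF u]
      by (cases "j = m"; cases "j = m - 1")
        (auto simp: rho_lvar lconst_q)
    moreover have "rho qq m (lvar (transpose (m - 1) m j)) \<noteq> 0"
      using m1 by (simp add: rho_lvar)
    ultimately show ?case using m1 by (simp add: lsubst_unit_mult[OF u])
  qed (use m1 in \<open>simp_all add: lsubst_add\<close>)
  have l0: "lquot 1 (Xv m 0) = lconst (inverse qq) * linv m"
  proof (rule lquot_1)
    have "Xv m 0 * (lconst (inverse qq) * linv m) = (lconst qq * lconst (inverse qq)) * (lvar m * linv m)"
      using m1 by (simp only: Xv_0 ac_simps)
    then show "Xv m 0 * (lconst (inverse qq) * linv m) = 1" by (simp add: lconst_mult[symmetric])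
  qed
  have x1: "Xv m 1 = lvar 1" using Xv_in_range[of 1 m] m1 by simp
  have l1: "lquot 1 (Xv m 1) = linv 1"
    by (rule lquot_1) (simp add: x1)
  have "s_op m 0 F = (lvar 1 * (lconst (inverse qq) * linv m)) * ((lconst qq * lvar m) * ?s (rho qq m G))"
    using m1 by (simp add: s_op_def x1 l0 F PQ_def lsubst_unit_mult[OF u] sv)
  also have "\<dots> = lvar 1 * ((lconst (inverse qq) * lconst qq) * ((linv m * lvar m) * ?s (rho qq m G)))"
    by (simp only: ac_simps)
  also have "\<dots> = PQ qq m (swp (m - 1) m G)"
    by (simp add: sr PQ_def lconst_mult[symmetric])
  finally have s: "s_op m 0 F = PQ qq m (swp (m - 1) m G)" .
  let ?D = "rho qq m (DD (m - 1) m G)"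
  let ?den = "1 - Xv m 0 * lquot 1 (Xv m 1)"
  \<comment> \<open>The candidate for the quotient is \<open>\<Pi>\<close> applied to
    \<open>X_m DD (m - 1) m G\<close>; \<open>rho\<close> sends \<open>X_m\<close> to
    \<open>inverse qq\<close> times \<open>X_1\<close>.\<close>
  let ?H = "lvar 1 * ((lconst (inverse qq) * lvar 1) * ?D)"
  have D: "?D * (lconst (inverse qq) * lvar 1 - lvar m) = rho qq m G - rho qq m (swp (m - 1) m G)"
  proof -
    have "?D * rho qq m (lvar m - lvar (m - 1)) = rho qq m (G - swp (m - 1) m G)"
      using m1 by (metis DD_mult rho_simps(3) qq_nonzero)
    moreover have "rho qq m (lvar (m - 1)) = lvar m" "rho qq m (lvar m) = lconst (inverse qq) * lvar 1"
      using m by (auto simp: rho_lvar)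
    ultimately show ?thesis using m1 by simp
  qed
  have "?H * ?den = lvar 1 * (?D * (lconst (inverse qq) * lvar 1 - (lconst (inverse qq) * lconst qq) * ((lvar 1 * linv 1) * lvar m)))"
    unfolding l1 Xv_0[OF m1(1)]
    by (simp only: right_diff_distrib left_diff_distrib ac_simps mult_1_right mult_1_left)
  also have "lconst (inverse qq) * lconst qq = 1" by (simp add: lconst_mult[symmetric])
  also have "lvar 1 * linv 1 = 1" by simp
  also have "lvar 1 * (?D * (lconst (inverse qq) * lvar 1 - 1 * (1 * lvar m))) = F - s_op m 0 F"
    unfolding s using D by (simp add: F PQ_def right_diff_distrib)
  finally have H: "?H * ?den = F - s_op m 0 F" .
  have "?den \<noteq> 0"
  proof
    assume "?den = 0"
    then have e0: "lconst qq * lvar m * linv 1 = 1" using m1 by (simp add: l1 Xv_0)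
    have "lvar 1 = lvar 1 * (lconst qq * lvar m * linv 1)" unfolding e0 by simp
    also have "\<dots> = lconst qq * lvar m * (lvar 1 * linv 1)" by (simp only: ac_simps)
    finally have e: "lvar 1 = lconst qq * lvar m" by simp
    have "lookup (lvar 1) (Poly_Mapping.single 1 1) = (lookup (lconst qq * lvar m) (Poly_Mapping.single 1 1))"
      by (simp add: e)
    then show False using m
      by (simp add: lookup_lconst_mult lookup_lvar when_def single_1_eq_iff)
  qed
  then have "lquot (F - s_op m 0 F) ?den = ?H" using H by (rule lquot_eq[rotated])
  then have "T_op m 0 F = tvar * PQ qq m (swp (m - 1) m G) + (tvar - 1) * ?H"
    by (simp add: T_op_def s tvar_def lconst_diff)
  also have "\<dots> = PQ qq m (dl (m - 1) m G)"
    unfolding PQ_def dl_def using m1 by (simp add: rho_lvar) (simp add: algebra_simps)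
  finally show ?thesis by (simp add: TT_def G_def)
qed

lemma T_op_eq: "2 \<le> m \<Longrightarrow> i < m \<Longrightarrow> T_op m i F = TT m i F"
  using T_op_0 T_op_eq_dl by (cases "i = 0") (auto simp: TT_def)

lemma TT_in_laurent_ring:
  assumes "2 \<le> m" "i < m" "F \<in> laurent_ring m"
  shows "TT m i F \<in> laurent_ring m"
proof (cases "i = 0")
  case True
  then show ?thesis using assms dl_in_laurent_ring[of "m - 1" m] PQi_in_laurent_ring PQ_in_laurent_ring
    by (simp add: TT_def)
qed (use assms dl_in_laurent_ring in \<open>simp add: TT_def\<close>)

text \<open>The wrap around splits in two: \<open>i = m - 1\<close> is the definition of
  \<open>T_0\<close>, and \<open>i = 0\<close> is \<open>PQ_PQ_dl\<close>. The other indices are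
  \<open>PQ_dl\<close>.\<close>

lemma PQ_TT:
  assumes "2 \<le> m" "i < m"
  shows "PQ qq m (TT m i F) = TT m (Suc i mod m) (PQ qq m F)"
proof -
  have m1: "1 \<le> m" using assms by simp
  consider "i = 0" | "Suc i = m" "i \<noteq> 0" | "i \<noteq> 0" "Suc i < m" using assms by linarith
  then show ?thesis
  proof cases
    case 1
    then show ?thesis using assms m1 PQ_PQ_dl[of qq m "PQi qq m F"]
      by (simp add: TT_def numeral_2_eq_2)
  next
    case 2
    then show ?thesis using assms m1 by (auto simp: TT_def)
  next
    case 3
    then show ?thesis using assms m1 by (simp add: TT_def PQ_dl)
  qed
qed

lemma TT_add [simp]:
  assumes "1 \<le> m"
  shows "TT m i (F + G) = TT m i F + TT m i G"
  using assms by (simp add: TT_def)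

lemma TT_lconst_mult [simp]:
  assumes "1 \<le> m"
  shows "TT m i (lconst c * F) = lconst c * TT m i F"
  using assms by (simp add: TT_def)

lemma TT_quadratic:
  assumes "2 \<le> m"
  shows "TT m i (TT m i F) = (tvar - 1) * TT m i F + tvar * F"
  using assms by (simp add: TT_def dl_dl)

lemma PQ_pow_TT:
  assumes "2 \<le> m"
  shows "(PQ qq m ^^ k) (TT m (i mod m) F) = TT m ((i + k) mod m) ((PQ qq m ^^ k) F)"
proof (induction k)
  case (Suc k)
  have "(PQ qq m ^^ Suc k) (TT m (i mod m) F) = PQ qq m (TT m ((i + k) mod m) ((PQ qq m ^^ k) F))"
    using Suc by simp
  also have "\<dots> = TT m (Suc ((i + k) mod m) mod m) (PQ qq m ((PQ qq m ^^ k) F))"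
    using assms by (intro PQ_TT) auto
  finally show ?case by (simp add: mod_Suc_eq)
qed simp

lemma PQ_pow_surj:
  assumes "1 \<le> m" obtains G where "F = (PQ qq m ^^ k) G"
proof -
  have "(PQ qq m ^^ k) ((PQi qq m ^^ k) F) = F" for F
  proof (induction k arbitrary: F)
    case (Suc k)
    have "(PQ qq m ^^ Suc k) ((PQi qq m ^^ Suc k) F) = PQ qq m ((PQ qq m ^^ k) ((PQi qq m ^^ k) (PQi qq m F)))"
      by (simp add: funpow_swap1)
    then show ?case using Suc assms by simp
  qed simp
  then show ?thesis using that by metis
qed

text \<open>Conjugation by a power of \<open>\<Pi>\<close> moves the pair to the indices
  \<open>1\<close> and \<open>1 + l\<close>; the bounds on \<open>l\<close> give
  \<open>1 + l < m\<close>, so \<open>T_0\<close> does not occur there.\<close>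

lemma TT_commute:
  assumes m: "2 \<le> m" and "l \<noteq> 1" "l \<noteq> m - 1" "l < m"
  shows "TT m (i mod m) (TT m ((i + l) mod m) F) = TT m ((i + l) mod m) (TT m (i mod m) F)"
proof -
  \<comment> \<open>A natural number congruent to \<open>i - 1\<close> modulo \<open>m\<close>: the
    shift that carries index \<open>1\<close> to \<open>i\<close>.\<close>
  define k where "k = i + m - 1"
  have k: "i mod m = (1 + k) mod m" "(i + l) mod m = (1 + l + k) mod m"
    using m by (auto simp: k_def mod_simps) (metis add.assoc add.commute mod_add_self2)
  obtain G where F: "F = (PQ qq m ^^ k) G" using PQ_pow_surj[of m] m by (metis one_le_numeral order_trans)
  have "TT m (1 mod m) (TT m ((1 + l) mod m) G) = TT m ((1 + l) mod m) (TT m (1 mod m) G)"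
  proof (cases "l = 0")
    case False
    then show ?thesis using assms by (auto simp: TT_def intro: dl_commute)
  qed simp
  then show ?thesis unfolding k F using m
    by (simp only: PQ_pow_TT[symmetric])
qed

lemma TT_braid:
  assumes m: "3 \<le> m"
  shows "TT m (i mod m) (TT m (Suc i mod m) (TT m (i mod m) F))
    = TT m (Suc i mod m) (TT m (i mod m) (TT m (Suc i mod m) F))"
proof -
  have m2: "2 \<le> m" using m by simp
  define k where "k = i + m - 1"
  have k: "i mod m = (1 + k) mod m" "Suc i mod m = (2 + k) mod m"
    using m by (auto simp: k_def) (metis add_Suc mod_add_self2)
  obtain G where F: "F = (PQ qq m ^^ k) G" using PQ_pow_surj[of m] m by (metis one_le_numeral order_trans)
  have "TT m (1 mod m) (TT m (2 mod m) (TT m (1 mod m) G)) = TT m (2 mod m) (TT m (1 mod m) (TT m (2 mod m) G))"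
    using assms by (auto simp: TT_def numeral_2_eq_2 intro: dl_braid)
  then show ?thesis unfolding k F using m2
    by (simp only: PQ_pow_TT[symmetric])
qed

section \<open>Action of the affine Hecke algebra\<close>

lemma poly_mapping_single_induct [case_names single add]:
  fixes P :: "('a \<Rightarrow>\<^sub>0 'b::comm_monoid_add) \<Rightarrow> bool"
  assumes single: "\<And>w c. P (Poly_Mapping.single w c)" and add: "\<And>x y. P x \<Longrightarrow> P y \<Longrightarrow> P (x + y)"
  shows "P x"
proof -
  have "P (\<Sum>w\<in>S. Poly_Mapping.single w (lookup x w))" if "finite S" for S
    using that
  proof (induction S)
    case empty
    then show ?case using single[of undefined 0] by simp
  qed (use single add in auto)
  from this[OF finite_keys[of x]] show ?thesis unfolding poly_mapping_sum_singles[symmetric] .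
qed

text \<open>A total version of \<open>gen_act\<close>: linear and compatible with the relations on
  all Laurent polynomials, whereas \<open>gen_act\<close> is controlled on
  \<open>laurent_ring m\<close>. The two are compared in \<open>free_act_eq\<close>.\<close>

fun gact :: "nat \<Rightarrow> hecke_gen \<Rightarrow> laurent \<Rightarrow> laurent" where
  "gact m (GenT i) F = TT m i F"
| "gact m GenPi F = PQ qq m F"
| "gact m GenPi_inv F = PQi qq m F"

definition wact :: "nat \<Rightarrow> hecke_gen list \<Rightarrow> laurent \<Rightarrow> laurent" where
  "wact m w F = foldr (gact m) w F"

definition cact :: "nat \<Rightarrow> hecke_free \<Rightarrow> laurent \<Rightarrow> laurent" where
  "cact m x F = (\<Sum>w\<in>keys x. lconst (lookup x w) * wact m w F)"

lemma cact_superset: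
  assumes "finite S" "keys x \<subseteq> S"
  shows "cact m x F = (\<Sum>w\<in>S. lconst (lookup x w) * wact m w F)"
  unfolding cact_def using assms
  by (intro sum.mono_neutral_left) (auto simp: in_keys_iff)

lemma cact_add: "cact m (x + y) F = cact m x F + cact m y F"
proof -
  let ?S = "keys x \<union> keys y"
  have "keys (x + y) \<subseteq> ?S" by (rule keys_add)
  then show ?thesis
    by (simp add: cact_superset[of ?S] lookup_add lconst_add distrib_right sum.distrib)
qed

lemma cact_single: "cact m (Poly_Mapping.single w c) F = lconst c * wact m w F"
  by (subst cact_superset[of "{w}"]) auto

lemma cact_0 [simp]: "cact m 0 F = 0"
  by (simp add: cact_def)

lemma cact_uminus: "cact m (- x) F = - cact m x F"
  using cact_add[of m x "- x" F] by (simp add: eq_neg_iff_add_eq_0 add.commute)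

lemma cact_diff: "cact m (x - y) F = cact m x F - cact m y F"
  using cact_add[of m x "- y" F] by (simp add: cact_uminus)

lemma wact_append: "wact m (v @ w) F = wact m v (wact m w F)"
  by (simp add: wact_def)

lemma wact_Nil [simp]: "wact m [] F = F"
  by (simp add: wact_def)

lemma cact_1 [simp]: "cact m 1 F = F"
proof -
  have "(1 :: hecke_free) = Poly_Mapping.single [] 1" by (simp add: zero_list_def[symmetric])
  then show ?thesis using cact_single[of m "[]" 1 F] by (metis lconst_1 mult_1 wact_Nil)
qed

context
  fixes m :: nat
  assumes m: "1 \<le> m"
begin

lemma gact_add: "gact m g (F + G) = gact m g F + gact m g G"
  using m by (cases g) simp_all

lemma gact_lconst_mult: "gact m g (lconst c * F) = lconst c * gact m g F"
  using m by (cases g) simp_all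

lemma wact_add: "wact m w (F + G) = wact m w F + wact m w G"
  by (induction w) (simp_all add: wact_def gact_add)

lemma wact_lconst_mult: "wact m w (lconst c * F) = lconst c * wact m w F"
  by (induction w) (simp_all add: wact_def gact_lconst_mult)

lemma cact_mult: "cact m (x * y) F = cact m x (cact m y F)"
proof (induction x rule: poly_mapping_single_induct)
  case (single w c)
  show ?case
  proof (induction y rule: poly_mapping_single_induct)
    case (single v d)
    show ?case
      by (simp add: mult_single cact_single plus_list_def wact_append wact_lconst_mult lconst_mult mult.assoc)
  next
    case (add x y)
    then show ?case by (simp add: distrib_left cact_add cact_single wact_add)
  qed
next
  case (add x y)
  then show ?case by (simp add: distrib_right cact_add)
qed

lemma cact_fPi: "cact m fPi F = PQ qq m F"
  by (simp add: fPi_def cact_single) (simp add: wact_def)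

lemma cact_fPi_inv: "cact m fPi_inv F = PQi qq m F"
  by (simp add: fPi_inv_def cact_single) (simp add: wact_def)

lemma cact_fscal: "cact m (fscal c) F = lconst c * F"
  by (simp add: fscal_def cact_single)

lemma cact_fT: "cact m (fT m i) F = TT m (nat (i mod int m)) F"
  by (simp add: fT_def cact_single) (simp add: wact_def)

lemma free_ring: "ring (free_algebra m)"
proof (rule ringI)
  let ?R = "free_algebra m"
  show "abelian_group ?R"
  proof (rule abelian_groupI)
    fix x y assume "x \<in> carrier ?R" "y \<in> carrier ?R"
    then show "x \<oplus>\<^bsub>?R\<^esub> y \<in> carrier ?R"
      using keys_add[of x y] by (auto simp: free_algebra_def)
  next
    fix x assume x: "x \<in> carrier ?R"
    show "\<exists>y\<in>carrier ?R. y \<oplus>\<^bsub>?R\<^esub> x = \<zero>\<^bsub>?R\<^esub>"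
      by (rule bexI[of _ "- x"]) (use x in \<open>auto simp: free_algebra_def\<close>)
  qed (auto simp: free_algebra_def add.assoc add.commute)
  show "Group.monoid ?R"
  proof (rule monoidI)
    fix x y assume xy: "x \<in> carrier ?R" "y \<in> carrier ?R"
    have "set w \<subseteq> hecke_letters m" if w: "w \<in> keys (x * y)" for w
    proof -
      obtain a b where "a \<in> keys x" "b \<in> keys y" "w = a + b" using w keys_mult[of x y] by blast
      then show ?thesis using xy by (auto simp: free_algebra_def plus_list_def)
    qed
    then show "x \<otimes>\<^bsub>?R\<^esub> y \<in> carrier ?R" by (simp add: free_algebra_def)
  qed (auto simp: free_algebra_def mult.assoc zero_list_def)
qed (auto simp: free_algebra_def distrib_left distrib_right)

lemma free_carrier_single: "set w \<subseteq> hecke_letters m \<Longrightarrow> Poly_Mapping.single w c \<in> carrier (free_algebra m)"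
  by (auto simp: free_algebra_def)

lemma free_carrier_mult: "x \<in> carrier (free_algebra m) \<Longrightarrow> y \<in> carrier (free_algebra m) \<Longrightarrow> x * y \<in> carrier (free_algebra m)"
  using monoid.m_closed[OF ring.is_monoid[OF free_ring], of x y] by (simp add: free_algebra_def)

lemma free_carrier_add: "x \<in> carrier (free_algebra m) \<Longrightarrow> y \<in> carrier (free_algebra m) \<Longrightarrow> x + y \<in> carrier (free_algebra m)"
  using keys_add[of x y] by (auto simp: free_algebra_def)

lemma free_carrier_uminus: "x \<in> carrier (free_algebra m) \<Longrightarrow> - x \<in> carrier (free_algebra m)"
  by (auto simp: free_algebra_def in_keys_iff)

lemma free_carrier_diff: "x \<in> carrier (free_algebra m) \<Longrightarrow> y \<in> carrier (free_algebra m) \<Longrightarrow> x - y \<in> carrier (free_algebra m)"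
  using free_carrier_add[of x "- y"] free_carrier_uminus[of y] by simp

lemma free_carrier_1: "1 \<in> carrier (free_algebra m)"
  by (auto simp: free_algebra_def zero_list_def)

lemma free_carrier_gens:
  "fPi \<in> carrier (free_algebra m)" "fPi_inv \<in> carrier (free_algebra m)"
  "fscal c \<in> carrier (free_algebra m)"
  "2 \<le> m \<Longrightarrow> fT m i \<in> carrier (free_algebra m)"
  unfolding fPi_def fPi_inv_def fscal_def fT_def
  using m by (intro free_carrier_single, auto simp: hecke_letters_def nat_less_iff)+

lemmas free_carrier = free_carrier_mult free_carrier_add free_carrier_diff free_carrier_1 free_carrier_gens

lemma relators_cases:
  assumes "x \<in> hecke_relators m"
  obtains "x = fPi * fPi_inv - 1" | "x = fPi_inv * fPi - 1"
    | i where "2 \<le> m" "x = (fT m i - fscal tt) * (fT m i + 1)"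
    | i j where "2 \<le> m" "x = fT m i * fT m j - fT m j * fT m i" "j mod int m \<noteq> (i + 1) mod int m"
       "j mod int m \<noteq> (i - 1) mod int m"
    | i where "2 \<le> m" "x = fPi * fT m i - fT m (i + 1) * fPi"
    | i where "2 < m" "x = fT m i * fT m (i + 1) * fT m i - fT m (i + 1) * fT m i * fT m (i + 1)"
  using assms unfolding hecke_relators_def by (auto split: if_splits)

lemma relators_carrier: "hecke_relators m \<subseteq> carrier (free_algebra m)"
proof
  fix x assume "x \<in> hecke_relators m"
  then show "x \<in> carrier (free_algebra m)"
    by (cases rule: relators_cases) (simp_all add: free_carrier)
qed

text \<open>The annihilator of the representation. It is a two-sided ideal that contains the
  relators, hence contains \<open>hecke_ideal m\<close>, and this is why the action descends to the
  quotient.\<close>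

definition kill_ideal :: "hecke_free set" where
  "kill_ideal = {x \<in> carrier (free_algebra m). \<forall>F. cact m x F = 0}"

lemma cact_zero_arg: "cact m x 0 = 0"
proof (induction x rule: poly_mapping_single_induct)
  case (single w c)
  have "wact m w 0 = 0" using wact_lconst_mult[of w 0 0] by simp
  then show ?case by (simp add: cact_single)
qed (simp add: cact_add)

lemma kill_ideal: "ideal kill_ideal (free_algebra m)"
proof (rule idealI)
  let ?R = "free_algebra m"
  interpret ring ?R by (rule free_ring)
  show "ring ?R" by (rule free_ring)
  show "subgroup kill_ideal (add_monoid ?R)"
  proof (rule group.subgroupI)
    show "Group.group (add_monoid ?R)" using a_comm_group comm_group.axioms(2) by blast
    show "kill_ideal \<subseteq> carrier (add_monoid ?R)" by (auto simp: kill_ideal_def)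
    show "kill_ideal \<noteq> {}" using zero_closed by (auto simp: kill_ideal_def free_algebra_def intro!: exI[of _ 0])
    fix a assume a: "a \<in> kill_ideal"
    have "inv\<^bsub>add_monoid ?R\<^esub> a = - a"
    proof -
      have ac: "a \<in> carrier ?R" using a by (simp add: kill_ideal_def)
      have "\<ominus>\<^bsub>?R\<^esub> a = - a"
        by (rule minus_equality) (use ac free_carrier_uminus in \<open>auto simp: free_algebra_def\<close>)
      then show ?thesis by (simp add: a_inv_def)
    qed
    then show "inv\<^bsub>add_monoid ?R\<^esub> a \<in> kill_ideal"
      using a free_carrier_uminus by (auto simp: kill_ideal_def cact_uminus)
    fix b assume b: "b \<in> kill_ideal"
    show "a \<otimes>\<^bsub>add_monoid ?R\<^esub> b \<in> kill_ideal"
      using a b free_carrier_add[of a b] by (auto simp: kill_ideal_def cact_add free_algebra_def)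
  qed
  fix a x assume "a \<in> kill_ideal" "x \<in> carrier ?R"
  then show "x \<otimes>\<^bsub>?R\<^esub> a \<in> kill_ideal" "a \<otimes>\<^bsub>?R\<^esub> x \<in> kill_ideal"
    using free_carrier_mult[of x a] free_carrier_mult[of a x]
    by (auto simp: kill_ideal_def free_algebra_def cact_mult cact_zero_arg)
qed

lemma nat_mod_int: "nat (i mod int m) = (nat (i mod int m)) mod m"
  using m by (simp add: nat_less_iff)

lemma nat_mod_Suc: "nat ((i + 1) mod int m) = Suc (nat (i mod int m)) mod m"
proof -
  have "int (Suc (nat (i mod int m)) mod m) = (i + 1) mod int m"
    using m by (simp add: zmod_int mod_simps add.commute)
  then show ?thesis by (metis nat_int)
qed

lemma relators_kill: "hecke_relators m \<subseteq> kill_ideal"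
proof
  fix x assume x: "x \<in> hecke_relators m"
  have "cact m x F = 0" for F
  proof -
    from x show ?thesis
    proof (cases rule: relators_cases)
      case 1
      then show ?thesis using m by (simp add: cact_diff cact_mult cact_fPi cact_fPi_inv)
    next
      case 2
      then show ?thesis using m by (simp add: cact_diff cact_mult cact_fPi cact_fPi_inv)
    next
      case (3 i)
      then show ?thesis using m
        by (simp add: cact_diff cact_add cact_mult cact_fT cact_fscal TT_quadratic tvar_def)
          (simp add: algebra_simps)
    next
      case (4 i j)
      \<comment> \<open>The distance from \<open>i\<close> to \<open>j\<close> around the cycle; the
        excluded neighbours are the distances \<open>1\<close> and \<open>m - 1\<close>.\<close>
      define l where "l = nat ((j - i) mod int m)"
      have il: "int l = (j - i) mod int m" using m by (simp add: l_def)
      have "(i + int l) mod int m = j mod int m" unfolding il by (simp add: mod_simps)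
      have j: "nat (j mod int m) = (nat (i mod int m) + l) mod m"
      proof -
        have "int ((nat (i mod int m) + l) mod m) = j mod int m"
          using m by (simp add: zmod_int il mod_simps)
        then show ?thesis by (metis nat_int)
      qed
      have l1: "l \<noteq> 1"
      proof
        assume "l = 1"
        then have "(i + 1) mod int m = j mod int m" using \<open>(i + int l) mod int m = j mod int m\<close> by simp
        then show False using 4 by simp
      qed
      have l2: "l \<noteq> m - 1"
      proof
        assume "l = m - 1"
        then have "i + int l = (i - 1) + int m" using m by simp
        then have "(i + int l) mod int m = (i - 1) mod int m" by (metis mod_add_self2)
        then show False using \<open>(i + int l) mod int m = j mod int m\<close> 4 by simp
      qed
      have "l < m" unfolding l_def using m by (simp add: nat_less_iff)
      then have "TT m (nat (i mod int m) mod m) (TT m ((nat (i mod int m) + l) mod m) F)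
         = TT m ((nat (i mod int m) + l) mod m) (TT m (nat (i mod int m) mod m) F)"
        using 4(1) l1 l2 by (intro TT_commute) auto
      then show ?thesis using 4 m
        by (simp add: cact_diff cact_mult cact_fT j nat_mod_int[symmetric])
    next
      case (5 i)
      have "PQ qq m (TT m (nat (i mod int m)) F) = TT m (Suc (nat (i mod int m)) mod m) (PQ qq m F)"
        using 5 m by (intro PQ_TT) (auto simp: nat_less_iff)
      then show ?thesis using 5 m
        by (simp add: cact_diff cact_mult cact_fT cact_fPi nat_mod_Suc)
    next
      case (6 i)
      then show ?thesis using TT_braid[of m "nat (i mod int m)" F]
        by (simp add: cact_diff cact_mult cact_fT nat_mod_Suc nat_mod_int[symmetric])
    qed
  qed
  then show "x \<in> kill_ideal" using x relators_carrier by (auto simp: kill_ideal_def)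
qed

lemma hecke_ideal: "ideal (hecke_ideal m) (free_algebra m)"
  unfolding hecke_ideal_def by (rule ring.genideal_ideal[OF free_ring relators_carrier])

lemma hecke_ideal_kill: "hecke_ideal m \<subseteq> kill_ideal"
  unfolding hecke_ideal_def by (rule ring.genideal_minimal[OF free_ring kill_ideal relators_kill])

lemma hecke_ring: "ring (hecke m)"
  unfolding hecke_def by (rule ideal.quotient_is_ring[OF hecke_ideal])

text \<open>One representative suffices, because any two differ by an element that annihilates
  everything. Working with this relation postpones \<open>the_elem\<close> to the single lemma
  \<open>hecke_act_eq\<close>.\<close>

definition acts :: "hecke_free set \<Rightarrow> (laurent \<Rightarrow> laurent) \<Rightarrow> bool" where
  "acts h f \<longleftrightarrow> (\<exists>x\<in>carrier (free_algebra m). h = hecke_ideal m +>\<^bsub>free_algebra m\<^esub> x \<and> (\<forall>F. cact m x F = f F))"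

lemma acts_carrier: "acts h f \<Longrightarrow> h \<in> carrier (hecke m)"
  unfolding acts_def hecke_def FactRing_def A_RCOSETS_defs a_r_coset_def by auto

lemma acts_coset: "x \<in> carrier (free_algebra m) \<Longrightarrow> acts (hecke_ideal m +>\<^bsub>free_algebra m\<^esub> x) (cact m x)"
  unfolding acts_def by blast

lemma acts_cong: "acts h f \<Longrightarrow> (\<And>F. f F = g F) \<Longrightarrow> acts h g"
  unfolding acts_def by simp

lemma acts_mult:
  assumes "acts h f" "acts k g"
  shows "acts (h \<otimes>\<^bsub>hecke m\<^esub> k) (\<lambda>F. f (g F))"
proof -
  obtain x y where x: "x \<in> carrier (free_algebra m)" "h = hecke_ideal m +>\<^bsub>free_algebra m\<^esub> x" "\<And>F. cact m x F = f F"
    and y: "y \<in> carrier (free_algebra m)" "k = hecke_ideal m +>\<^bsub>free_algebra m\<^esub> y" "\<And>F. cact m y F = g F"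
    using assms unfolding acts_def by blast
  have "h \<otimes>\<^bsub>hecke m\<^esub> k = hecke_ideal m +>\<^bsub>free_algebra m\<^esub> (x \<otimes>\<^bsub>free_algebra m\<^esub> y)"
    using ideal.rcoset_mult_add[OF hecke_ideal x(1) y(1)] x y by (simp add: hecke_def FactRing_def)
  then show ?thesis
    unfolding acts_def using x y free_carrier_mult[OF x(1) y(1)]
    by (intro bexI[of _ "x * y"]) (auto simp: cact_mult free_algebra_def)
qed

lemma acts_add:
  assumes "acts h f" "acts k g"
  shows "acts (h \<oplus>\<^bsub>hecke m\<^esub> k) (\<lambda>F. f F + g F)"
proof -
  obtain x y where x: "x \<in> carrier (free_algebra m)" "h = hecke_ideal m +>\<^bsub>free_algebra m\<^esub> x" "\<And>F. cact m x F = f F"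
    and y: "y \<in> carrier (free_algebra m)" "k = hecke_ideal m +>\<^bsub>free_algebra m\<^esub> y" "\<And>F. cact m y F = g F"
    using assms unfolding acts_def by blast
  have "h \<oplus>\<^bsub>hecke m\<^esub> k = hecke_ideal m +>\<^bsub>free_algebra m\<^esub> (x \<oplus>\<^bsub>free_algebra m\<^esub> y)"
    using abelian_subgroup.a_rcos_sum[OF abelian_subgroupI3[OF ideal.axioms(1)[OF hecke_ideal]
        ring.is_abelian_group[OF free_ring]] x(1) y(1)] x y by (simp add: hecke_def FactRing_def)
  then show ?thesis
    unfolding acts_def using x y free_carrier_add[OF x(1) y(1)]
    by (intro bexI[of _ "x + y"]) (auto simp: cact_add free_algebra_def)
qed

lemma acts_one: "acts \<one>\<^bsub>hecke m\<^esub> (\<lambda>F. F)"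
  unfolding acts_def
  by (rule bexI[of _ 1]) (use free_carrier_1 in \<open>auto simp: hecke_def FactRing_def free_algebra_def\<close>)

lemma acts_zero: "acts \<zero>\<^bsub>hecke m\<^esub> (\<lambda>F. 0)"
proof -
  interpret ideal "hecke_ideal m" "free_algebra m" by (rule hecke_ideal)
  have "hecke_ideal m +>\<^bsub>free_algebra m\<^esub> \<zero>\<^bsub>free_algebra m\<^esub> = hecke_ideal m"
    using a_coset_add_zero a_subset by simp
  moreover have "\<zero>\<^bsub>free_algebra m\<^esub> = 0" by (simp add: free_algebra_def)
  ultimately show ?thesis
    unfolding acts_def using zero_closed by (intro bexI[of _ 0]) (auto simp: hecke_def FactRing_def)
qed

lemma acts_finsum:
  assumes "finite A" "\<And>a. a \<in> A \<Longrightarrow> acts (h a) (f a)"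
  shows "acts (finsum (hecke m) h A) (\<lambda>F. \<Sum>a\<in>A. f a F)"
proof -
  interpret ring "hecke m" by (rule hecke_ring)
  show ?thesis using assms
  proof (induction A)
    case empty
    then show ?case using acts_zero by simp
  next
    case (insert a A)
    then have "h \<in> A \<rightarrow> carrier (hecke m)" "h a \<in> carrier (hecke m)" using acts_carrier by auto
    then show ?case using insert acts_add by simp
  qed
qed

lemma acts_T:
  assumes "2 \<le> m"
  shows "acts (hecke_T m i) (TT m (nat (i mod int m)))"
  unfolding hecke_T_def
  by (rule acts_cong[OF acts_coset]) (use assms free_carrier cact_fT in auto)

text \<open>In the free algebra \<open>inverse tt\<close> times the quadratic relator is
  \<open>y T - 1\<close> for \<open>y = t^{-1} (T - (t - 1))\<close>, and \<open>y\<close> commutes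
  with \<open>T\<close>; so the class of \<open>y\<close> is the inverse.\<close>

lemma acts_T_inv:
  assumes m2: "2 \<le> m"
  shows "acts (inv\<^bsub>hecke m\<^esub> (hecke_T m i)) (\<lambda>F. tvar_inv * (TT m (nat (i mod int m)) F - (tvar - 1) * F))"
proof -
  interpret R: ring "free_algebra m" by (rule free_ring)
  interpret H: ring "hecke m" by (rule hecke_ring)
  interpret I: ideal "hecke_ideal m" "free_algebra m" by (rule hecke_ideal)
  let ?I = "hecke_ideal m" and ?T = "fT m i"
  define y where "y = fscal (inverse tt) * (?T - fscal (tt - 1))"
  have yc: "y \<in> carrier (free_algebra m)" unfolding y_def using m2 by (intro free_carrier)
  have Tc: "?T \<in> carrier (free_algebra m)" using m2 by (intro free_carrier)
  have comm: "?T * fscal c = fscal c * ?T" for c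
    by (simp add: fT_def fscal_def mult_single plus_list_def)
  have fs: "fscal c * fscal d = fscal (c * d)" "fscal c - fscal d = fscal (c - d)" for c d
    by (simp_all add: fscal_def mult_single plus_list_def single_diff)
  have f1: "fscal 1 = 1"
    by (simp add: fscal_def zero_list_def[symmetric])
  let ?r = "(?T - fscal tt) * (?T + 1)"
  have r: "?r \<in> ?I" using R.genideal_self[OF relators_carrier] m2
    unfolding hecke_ideal_def hecke_relators_def by auto
  have rr: "?r = ?T * ?T - fscal (tt - 1) * ?T - fscal tt"
    by (simp add: algebra_simps fs(2)[symmetric] f1)
  have "fscal (inverse tt) * ?r \<in> ?I"
    using I.I_l_closed[OF r, of "fscal (inverse tt)"] free_carrier_gens(3) by (simp add: free_algebra_def)
  moreover have "fscal (inverse tt) * ?r = y * ?T - 1"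
  proof -
    have "fscal (inverse tt) * (fscal (tt - 1) * ?T) = fscal (1 - inverse tt) * ?T"
      unfolding mult.assoc[symmetric] fs by (simp add: right_diff_distrib)
    then show ?thesis
      unfolding rr y_def by (simp add: right_diff_distrib left_diff_distrib mult.assoc fs f1)
  qed
  moreover have "y * ?T = ?T * y"
    unfolding y_def by (simp add: right_diff_distrib left_diff_distrib mult.assoc[symmetric] comm)
      (simp add: mult.assoc comm)
  ultimately have yI: "y * ?T - 1 \<in> ?I" and Iy: "?T * y - 1 \<in> ?I" by simp_all
  have one: "?I +>\<^bsub>free_algebra m\<^esub> z = \<one>\<^bsub>hecke m\<^esub>" if "z - 1 \<in> ?I" "z \<in> carrier (free_algebra m)" for z
  proof -
    have "z = (z - 1) \<oplus>\<^bsub>free_algebra m\<^esub> 1" by (simp add: free_algebra_def)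
    then have "z \<in> ?I +>\<^bsub>free_algebra m\<^esub> 1" using that unfolding a_r_coset_def' by blast
    then have "?I +>\<^bsub>free_algebra m\<^esub> z = ?I +>\<^bsub>free_algebra m\<^esub> 1"
      using R.a_repr_independence[OF _ free_carrier_1 I.a_subgroup] by blast
    then show ?thesis by (simp add: hecke_def FactRing_def free_algebra_def)
  qed
  let ?hy = "?I +>\<^bsub>free_algebra m\<^esub> y"
  have mult: "?hy \<otimes>\<^bsub>hecke m\<^esub> hecke_T m i = ?I +>\<^bsub>free_algebra m\<^esub> (y * ?T)"
    "hecke_T m i \<otimes>\<^bsub>hecke m\<^esub> ?hy = ?I +>\<^bsub>free_algebra m\<^esub> (?T * y)"
    using I.rcoset_mult_add[OF yc Tc] I.rcoset_mult_add[OF Tc yc]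
    by (simp_all add: hecke_T_def hecke_def FactRing_def free_algebra_def)
  have "?hy = inv\<^bsub>hecke m\<^esub> (hecke_T m i)"
  proof (rule H.inv_unique')
    show "hecke_T m i \<in> carrier (hecke m)" using acts_T[OF m2] acts_carrier by blast
    show "?hy \<in> carrier (hecke m)" using acts_coset[OF yc] acts_carrier by blast
    show "hecke_T m i \<otimes>\<^bsub>hecke m\<^esub> ?hy = \<one>\<^bsub>hecke m\<^esub>" "?hy \<otimes>\<^bsub>hecke m\<^esub> hecke_T m i = \<one>\<^bsub>hecke m\<^esub>"
      unfolding mult using one yI Iy free_carrier_mult[OF yc Tc] free_carrier_mult[OF Tc yc] by blast+
  qed
  moreover have "acts ?hy (\<lambda>F. tvar_inv * (TT m (nat (i mod int m)) F - (tvar - 1) * F))"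
    by (rule acts_cong[OF acts_coset[OF yc]])
      (simp add: y_def cact_mult cact_fscal cact_diff cact_fT tvar_inv_def tvar_def lconst_diff)
  ultimately show ?thesis by simp
qed

text \<open>Membership in \<open>laurent_ring m\<close> is carried along each word, since the
  comparison of a generator with its operator is made there.\<close>

lemma free_act_eq:
  assumes "x \<in> carrier (free_algebra m)" "F \<in> laurent_ring m"
  shows "free_act m x F = cact m x F"
proof -
  have "foldr (gen_act m) w F = wact m w F \<and> wact m w F \<in> laurent_ring m" if "set w \<subseteq> hecke_letters m" for w
    using that
  proof (induction w)
    case (Cons g w)
    then have IH: "foldr (gen_act m) w F = wact m w F" "wact m w F \<in> laurent_ring m" by auto
    have g: "g \<in> hecke_letters m" using Cons by simp
    have s: "foldr (gen_act m) (g # w) F = gen_act m g (wact m w F)" "wact m (g # w) F = gact m g (wact m w F)"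
      using IH by (simp_all add: wact_def)
    show ?case unfolding s
    proof (cases g)
      case (GenT i)
      then have "2 \<le> m" "i < m" using g by (auto simp: hecke_letters_def split: if_splits)
      then show "gen_act m g (wact m w F) = gact m g (wact m w F) \<and> gact m g (wact m w F) \<in> laurent_ring m"
        using IH GenT T_op_eq TT_in_laurent_ring by simp
    next
      case GenPi
      then show "gen_act m g (wact m w F) = gact m g (wact m w F) \<and> gact m g (wact m w F) \<in> laurent_ring m"
        using IH m Pi_op_eq PQ_in_laurent_ring by simp
    next
      case GenPi_inv
      then show "gen_act m g (wact m w F) = gact m g (wact m w F) \<and> gact m g (wact m w F) \<in> laurent_ring m"
        using IH m Pi_inv_eq PQi_in_laurent_ring by simp
    qed
  qed (simp add: assms)
  then show ?thesis using assms(1) unfolding free_act_def cact_def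
    by (intro sum.cong) (auto simp: free_algebra_def)
qed

lemma hecke_act_eq:
  assumes "acts h f" "F \<in> laurent_ring m"
  shows "hecke_act m h F = f F"
proof -
  obtain x where x: "x \<in> carrier (free_algebra m)" "h = hecke_ideal m +>\<^bsub>free_algebra m\<^esub> x" "\<And>F. cact m x F = f F"
    using assms unfolding acts_def by blast
  have "free_act m z F = f F" if "z \<in> h" for z
  proof -
    obtain i where i: "i \<in> hecke_ideal m" "z = i + x"
      using \<open>z \<in> h\<close> unfolding x(2) a_r_coset_def' by (auto simp: free_algebra_def)
    then have ik: "i \<in> kill_ideal" using hecke_ideal_kill by blast
    then have "z \<in> carrier (free_algebra m)" using i x free_carrier_add by (auto simp: kill_ideal_def)
    then show ?thesis using ik x i assms by (simp add: free_act_eq cact_add kill_ideal_def)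
  qed
  moreover have "h \<noteq> {}"
    using ideal.axioms(1)[OF hecke_ideal] additive_subgroup.zero_closed
    unfolding x(2) a_r_coset_def' by fastforce
  ultimately have "(\<lambda>x. free_act m x F) ` h = {f F}" by auto
  then show ?thesis by (simp add: hecke_act_def)
qed

end

section \<open>The polynomials as words in cyclic operators\<close>

text \<open>\<open>up k\<close> is \<open>t^k T_k^{-1} ... T_1^{-1}\<close>. In \<open>Aop\<close>
  the power \<open>t^{m-1-k}\<close> completes it to the share \<open>t^{m-1}\<close> of one
  vertex.\<close>

primrec up :: "nat \<Rightarrow> laurent \<Rightarrow> laurent" where
  "up 0 F = F"
| "up (Suc k) F = dlt (Suc k) (Suc (Suc k)) (up k F)"

definition Aop :: "qt \<Rightarrow> nat \<Rightarrow> nat \<Rightarrow> laurent \<Rightarrow> laurent" where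
  "Aop q m d F = (if d < m then \<Sum>k<m - d. tvar ^ (m - 1 - k) * up k (PQ q m F) else 0)"

definition Wop :: "qt \<Rightarrow> nat \<Rightarrow> nat list \<Rightarrow> laurent" where
  "Wop q m ds = foldr (Aop q m) ds 1"

text \<open>For an interval function, the number of edges that enter \<open>i\<close>, that is, of
  its earlier neighbours.\<close>

definition lneigh :: "(nat \<Rightarrow> int) \<Rightarrow> nat \<Rightarrow> nat" where
  "lneigh e i = nat (int i - 1 - e i)"

primrec opS :: "nat \<Rightarrow> nat \<Rightarrow> nat \<Rightarrow> laurent \<Rightarrow> laurent" where
  "opS m i 0 F = F"
| "opS m i (Suc k) F = tvar_inv * (TT m ((i + k) mod m) (opS m i k F) - (tvar - 1) * opS m i k F)"

text \<open>The condition \<open>d < m\<close> is \<open>e \<ge> i - m\<close> rewritten for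
  \<open>d = i - 1 - e\<close>, and \<open>m - d\<close> is the number of terms.\<close>

definition Sop :: "nat \<Rightarrow> nat \<Rightarrow> nat \<Rightarrow> laurent \<Rightarrow> laurent" where
  "Sop m i d F = (if d < m then \<Sum>k<m - d. opS m i k F else 0)"

lemma up_lconst_mult [simp]: "up k (lconst c * F) = lconst c * up k F"
  by (induction k) simp_all

lemma up_0 [simp]: "up k 0 = 0"
  by (induction k) simp_all

lemma Aop_lconst_mult: "q \<noteq> 0 \<Longrightarrow> 1 \<le> m \<Longrightarrow> Aop q m d (lconst c * F) = lconst c * Aop q m d F"
  by (simp add: Aop_def sum_distrib_left mult.left_commute)

context
  fixes m :: nat
  assumes m: "1 \<le> m"
begin

text \<open>For \<open>m = 1\<close> there are no generators \<open>T\<close>, and only the empty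
  product occurs; the disjunction keeps this case inside the statement.\<close>

lemma acts_T_inv_prod:
  assumes "2 \<le> m \<or> k = 0"
  shows "acts m (T_inv_prod m (int i) k) (opS m i k)"
  using assms
proof (induction k)
  case 0
  then show ?case using acts_cong[OF m acts_one[OF m]] by simp
next
  case (Suc k)
  then have m2: "2 \<le> m" by simp
  have n: "nat ((int i + int k) mod int m) = (i + k) mod m"
    by (metis nat_int of_nat_add zmod_int)
  have "acts m (T_inv_prod m (int i) (Suc k))
     (\<lambda>F. tvar_inv * (TT m (nat ((int i + int k) mod int m)) (opS m i k F) - (tvar - 1) * opS m i k F))"
    using acts_mult[OF m acts_T_inv[OF m m2] Suc.IH] m2 by simp
  then show ?case unfolding n by (rule acts_cong[OF m]) simp
qed

lemma acts_S_elem: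
  assumes "e i < int i"
  shows "acts m (S_elem m (int i) (e i)) (Sop m i (lneigh e i))"
proof (cases "lneigh e i < m")
  case True
  then have c: "int i - int m \<le> e i" "nat (int m + e i - int i) = m - 1 - lneigh e i"
    using assms by (auto simp: lneigh_def)
  have s: "{0..m - 1 - lneigh e i} = {..<m - lneigh e i}" using True by auto
  have "acts m (finsum (hecke m) (T_inv_prod m (int i)) {..<m - lneigh e i}) (\<lambda>F. \<Sum>k<m - lneigh e i. opS m i k F)"
  proof (rule acts_finsum[OF m])
    fix k assume "k \<in> {..<m - lneigh e i}"
    then have "2 \<le> m \<or> k = 0" by auto
    then show "acts m (T_inv_prod m (int i) k) (opS m i k)" by (rule acts_T_inv_prod)
  qed simp
  moreover have "S_elem m (int i) (e i) = finsum (hecke m) (T_inv_prod m (int i)) {..<m - lneigh e i}"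
    unfolding S_elem_def c(2) s using c(1) by simp
  ultimately show ?thesis using True acts_cong[OF m] by (simp add: Sop_def)
next
  case False
  then have "\<not> int i - int m \<le> e i" using m by (auto simp: lneigh_def)
  then show ?thesis using False acts_cong[OF m acts_zero[OF m]] by (simp add: S_elem_def Sop_def)
qed

lemma acts_word:
  assumes "\<And>i. i \<in> set is \<Longrightarrow> e i < int i"
  shows "acts m (foldr (\<lambda>i h. S_elem m (int i) (e i) \<otimes>\<^bsub>hecke m\<^esub> h) is \<one>\<^bsub>hecke m\<^esub>)
     (foldr (\<lambda>i. Sop m i (lneigh e i)) is)"
  using assms
proof (induction "is")
  case Nil
  then show ?case using acts_cong[OF m acts_one[OF m]] by simp
next
  case (Cons i "is")
  then show ?case
    using acts_cong[OF m acts_mult[OF m acts_S_elem[of e i] Cons.IH]] by simp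
qed

lemma PQ_opS:
  assumes "2 \<le> m \<or> k = 0"
  shows "PQ qq m (opS m i k F) = opS m (Suc i) k (PQ qq m F)"
  using assms
proof (induction k)
  case (Suc k)
  then have m2: "2 \<le> m" by simp
  show ?case using Suc m m2 PQ_TT[OF m2, of "(i + k) mod m"] by (simp add: mod_Suc_eq)
qed simp

lemma PQ_sum: "PQ qq m (sum f A) = (\<Sum>x\<in>A. PQ qq m (f x))"
  using m by (induction A rule: infinite_finite_induct) simp_all

lemma PQ_Sop: "PQ qq m (Sop m i d F) = Sop m (Suc i) d (PQ qq m F)"
proof (cases "d < m")
  case True
  have "PQ qq m (opS m i k F) = opS m (Suc i) k (PQ qq m F)" if "k < m - d" for k
    using that by (intro PQ_opS) auto
  then show ?thesis using True by (simp add: Sop_def PQ_sum)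
qed (use m in \<open>simp add: Sop_def\<close>)

lemma PQ_pow_Sop: "(PQ qq m ^^ k) (Sop m i d F) = Sop m (i + k) d ((PQ qq m ^^ k) F)"
  by (induction k) (simp_all add: PQ_Sop)

lemma opS_1: "k < m \<Longrightarrow> opS m 1 k F = tvar_inv ^ k * up k F"
proof (induction k)
  case (Suc k)
  then have "dlt (Suc k) (Suc (Suc k)) (tvar_inv ^ k * G) = tvar_inv ^ k * dlt (Suc k) (Suc (Suc k)) G" for G
    by (intro dlt_smult) (simp_all add: tvar_inv_def lconst_power[symmetric])
  moreover have "opS m 1 (Suc k) F = tvar_inv * dlt (Suc k) (Suc (Suc k)) (tvar_inv ^ k * up k F)"
    using Suc by (simp add: TT_def dlt_def plus_1_eq_Suc)
  ultimately show ?case by (simp add: mult.assoc)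
qed simp

lemma tl_tli_power: "k \<le> n \<Longrightarrow> tvar ^ n * tvar_inv ^ k = tvar ^ (n - k)"
proof -
  assume "k \<le> n"
  then have "tvar ^ n * tvar_inv ^ k = tvar ^ (n - k) * (tvar ^ k * tvar_inv ^ k)"
    by (simp add: power_add[symmetric] mult.assoc[symmetric])
  also have "tvar ^ k * tvar_inv ^ k = 1" by (simp add: power_mult_distrib[symmetric])
  finally show ?thesis by simp
qed

lemma Aop_Sop: "tvar ^ (m - 1) * Sop m 1 d (PQ qq m F) = Aop qq m d F"
proof (cases "d < m")
  case True
  have "tvar ^ (m - 1) * opS m 1 k G = tvar ^ (m - 1 - k) * up k G" if "k < m - d" for k G
  proof -
    have "tvar ^ (m - 1) * opS m 1 k G = (tvar ^ (m - 1) * tvar_inv ^ k) * up k G"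
      using that by (simp add: opS_1 mult.assoc)
    then show ?thesis using that by (simp add: tl_tli_power)
  qed
  then show ?thesis using True by (simp add: Sop_def Aop_def sum_distrib_left)
qed (simp add: Sop_def Aop_def)

text \<open>Each letter consumes one of the \<open>n\<close> factors \<open>\<Pi>\<close> and one
  power \<open>t^{m-1}\<close>. When the letters from \<open>j\<close> on have been rewritten,
  \<open>j - 1\<close> factors \<open>\<Pi>\<close> remain in front; moving the next letter through
  all but one of them resets its index to \<open>1\<close>.\<close>

lemma Sop_word:
  assumes "1 \<le> j" "j \<le> n + 1"
  shows "tvar ^ ((n + 1 - j) * (m - 1)) * foldr (\<lambda>i. Sop m i (lneigh e i)) [j..<n + 1] ((PQ qq m ^^ n) 1)
    = (PQ qq m ^^ (j - 1)) (Wop qq m (map (lneigh e) [j..<n + 1]))"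
  using assms(2,1)
proof (induction j rule: inc_induct)
  case base
  then show ?case by (simp add: Wop_def)
next
  case (step j)
  have l: "[j..<n + 1] = j # [Suc j..<n + 1]" using step upt_conv_Cons by simp
  define R where "R = foldr (\<lambda>i. Sop m i (lneigh e i)) [Suc j..<n + 1] ((PQ qq m ^^ n) 1)"
  define W where "W = Wop qq m (map (lneigh e) [Suc j..<n + 1])"
  have IH: "tvar ^ ((n + 1 - Suc j) * (m - 1)) * R = (PQ qq m ^^ j) W"
    using step unfolding R_def W_def by simp
  have lin: "Sop m j d (tvar ^ a * G) = tvar ^ a * Sop m j d G" for d a G
  proof -
    have tlc: "tvar ^ a = lconst (tt ^ a)" by (simp add: tvar_def lconst_power)
    have "opS m j k (tvar ^ a * G) = tvar ^ a * opS m j k G" for k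
      unfolding tlc using m by (induction k) (simp_all add: algebra_simps)
    then show ?thesis by (simp add: Sop_def sum_distrib_left)
  qed
  have pow: "(PQ qq m ^^ k) (tvar ^ a * G) = tvar ^ a * (PQ qq m ^^ k) G" for k a G
    using m by (induction k) (simp_all add: tvar_def lconst_power[symmetric])
  have e: "(n + 1 - j) * (m - 1) = (m - 1) + (n + 1 - Suc j) * (m - 1)"
  proof -
    have "n + 1 - j = Suc (n + 1 - Suc j)" using step by simp
    then show ?thesis by simp
  qed
  have j: "j = Suc (j - 1)" using step by simp
  have "tvar ^ ((n + 1 - j) * (m - 1)) * Sop m j (lneigh e j) R
     = tvar ^ (m - 1) * Sop m j (lneigh e j) (tvar ^ ((n + 1 - Suc j) * (m - 1)) * R)"
    by (simp add: lin e power_add mult.assoc)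
  also have "\<dots> = tvar ^ (m - 1) * Sop m j (lneigh e j) ((PQ qq m ^^ j) W)" by (simp only: IH)
  also have "(PQ qq m ^^ j) W = (PQ qq m ^^ (j - 1)) (PQ qq m W)"
    by (subst j) (simp add: funpow_swap1)
  also have "Sop m j (lneigh e j) \<dots> = (PQ qq m ^^ (j - 1)) (Sop m 1 (lneigh e j) (PQ qq m W))"
    using PQ_pow_Sop[of "j - 1" 1] step by simp
  also have "tvar ^ (m - 1) * \<dots> = (PQ qq m ^^ (j - 1)) (Aop qq m (lneigh e j) W)"
    by (simp only: pow[symmetric] Aop_Sop)
  finally show ?case
    unfolding l R_def W_def by (simp add: Wop_def)
qed

lemma rho_Xv:
  assumes "1 \<le> j"
  shows "rho qq m (Xv m j) = Xv m (j + 1)"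
proof -
  define a where "a = (j - 1) div int m"
  define r where "r = nat ((j - 1) mod int m)"
  have jr: "j - 1 = int m * a + int r" "r < m"
    using m by (auto simp: a_def r_def nat_less_iff)
  have X: "Xv m j = lconst (qq powi (- a)) * lvar (Suc r)"
    using m by (simp add: Xv_def a_def r_def nat_add_distrib)
  show ?thesis
  proof (cases "Suc r = m")
    case True
    then have "j = int m * (a + 1)" using jr by (simp add: algebra_simps)
    then have "j div int m = a + 1" "j mod int m = 0" using m by auto
    then have X1: "Xv m (j + 1) = lconst (qq powi (- (a + 1))) * lvar 1" by (simp add: Xv_def)
    have "qq powi (- (a + 1)) = qq powi (- a) * inverse qq"
      using power_int_add[of qq "- a" "- 1"] by (simp add: power_int_minus)
    then have "lconst (qq powi (- (a + 1))) = lconst (qq powi (- a)) * lconst (inverse qq)"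
      by (simp add: lconst_mult)
    then show ?thesis using True m unfolding X X1 by (simp add: rho_lvar mult.assoc)
  next
    case False
    then have "j = int m * a + int (Suc r)" "Suc r < m" using jr by auto
    then have "j div int m = a" "j mod int m = int (Suc r)" by auto
    then have X1: "Xv m (j + 1) = lconst (qq powi (- a)) * lvar (Suc (Suc r))"
      by (simp add: Xv_def nat_add_distrib)
    show ?thesis using \<open>Suc r < m\<close> m unfolding X X1 by (simp add: rho_lvar)
  qed
qed

text \<open>The periodic convention is made for this: \<open>rho\<close> raises the index of
  \<open>Xv m j\<close> by one, also across a multiple of \<open>m\<close>, so \<open>n\<close> may
  exceed \<open>m\<close>.\<close>

lemma PQ_pow_1: "(PQ qq m ^^ n) 1 = (\<Prod>i = 1..n. Xv m (int i))"
proof (induction n)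
  case (Suc n)
  have pr: "rho qq m (prod f A) = (\<Prod>x\<in>A. rho qq m (f x))" for f :: "nat \<Rightarrow> laurent" and A
    using m by (induction A rule: infinite_finite_induct) simp_all
  have "(PQ qq m ^^ Suc n) 1 = lvar 1 * (\<Prod>i = 1..n. Xv m (int (Suc i)))"
    using Suc rho_Xv by (simp add: PQ_def[of _ _ "prod _ _"] pr add.commute)
  also have "lvar 1 = Xv m (int 1)" using Xv_in_range[of 1 m] m by simp
  also have "Xv m (int 1) * (\<Prod>i = 1..n. Xv m (int (Suc i))) = (\<Prod>i = 1..Suc n. Xv m (int i))"
    by (induction n) (simp_all add: mult.assoc[symmetric] del: of_nat_Suc, simp)
  finally show ?case .
qed simp

lemma XG_qt_eq_Wop:
  assumes "\<And>i. 1 \<le> i \<Longrightarrow> i \<le> n \<Longrightarrow> e i < int i"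
  shows "XG_qt m n e = Wop qq m (map (lneigh e) [1..<n + 1])"
proof -
  have L: "(PQ qq m ^^ n) 1 \<in> laurent_ring m"
  proof (induction n)
    case 0
    then show ?case by (simp add: laurent_ring_iff)
  qed (use m PQ_in_laurent_ring in simp)
  have "acts m (foldr (\<lambda>i h. S_elem m (int i) (e i) \<otimes>\<^bsub>hecke m\<^esub> h) [1..<n + 1] \<one>\<^bsub>hecke m\<^esub>)
     (foldr (\<lambda>i. Sop m i (lneigh e i)) [1..<n + 1])"
    using assms by (intro acts_word) auto
  then have "XG_qt m n e = lconst (tt ^ (n * (m - 1))) * foldr (\<lambda>i. Sop m i (lneigh e i)) [1..<n + 1] ((PQ qq m ^^ n) 1)"
    unfolding XG_qt_def using hecke_act_eq[OF m _ L] by (simp only: PQ_pow_1)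
  also have "\<dots> = Wop qq m (map (lneigh e) [1..<n + 1])"
    using Sop_word[of 1 n e] by (simp add: tvar_def lconst_power)
  finally show ?thesis .
qed

end

section \<open>Polynomiality\<close>

text \<open>Closure under the scalars that occur in the operators and their inverses;
  \<open>qt_integral\<close> and \<open>reg1\<close> both qualify.\<close>

definition coeff_module :: "qt \<Rightarrow> qt set \<Rightarrow> bool" where
  "coeff_module q C \<longleftrightarrow> 0 \<in> C \<and> (\<forall>a\<in>C. \<forall>b\<in>C. a + b \<in> C) \<and> (\<forall>a\<in>C. - a \<in> C) \<and>
     (\<forall>a\<in>C. tt * a \<in> C) \<and> (\<forall>a\<in>C. inverse tt * a \<in> C) \<and> (\<forall>a\<in>C. inverse q * a \<in> C)"

lemma coeff_module_UNIV: "coeff_module q UNIV"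
  by (simp add: coeff_module_def)

lemma hpoly_lvar_mult:
  assumes "F \<in> hpoly C m d" "1 \<le> j" "j \<le> m"
  shows "lvar j * F \<in> hpoly C m (Suc d)"
  unfolding hpoly_iff
proof (intro conjI allI ballI)
  show "lookup (lvar j * F) \<mu> \<in> C" for \<mu> using assms by (simp add: lookup_lvar_mult hpoly_iff)
  fix \<mu> assume "\<mu> \<in> keys (lvar j * F)"
  then have "\<mu> - Poly_Mapping.single j 1 \<in> keys F" by (simp add: in_keys_iff lookup_lvar_mult)
  then obtain \<nu> where \<nu>: "\<nu> \<in> keys F" "\<mu> = Poly_Mapping.single j 1 + \<nu>"
    using that by (metis add.commute diff_add_cancel)
  then have p: "pexp m \<nu>" "mdeg \<nu> = int d" using assms by (auto simp: hpoly_iff)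
  have "keys \<mu> \<subseteq> {j} \<union> keys \<nu>" unfolding \<nu>(2) using keys_add[of "Poly_Mapping.single j (1::int)" \<nu>] by simp
  then show "pexp m \<mu>" using p assms by (auto simp: pexp_def \<nu>(2) lookup_add lookup_single when_def)
  show "mdeg \<mu> = int (Suc d)" using p by (simp add: \<nu>(2) mdeg_add)
qed

lemma hpoly_lconst: "c \<in> C \<Longrightarrow> 0 \<in> C \<Longrightarrow> lconst c \<in> hpoly C m 0"
  by (auto simp: hpoly_iff lconst_def lookup_single when_def pexp_def)

lemma hpoly_lconst_mult:
  assumes "F \<in> hpoly C m d" "\<And>a. a \<in> C \<Longrightarrow> c * a \<in> C"
  shows "lconst c * F \<in> hpoly C m d"
  using assms by (auto simp: hpoly_iff lookup_lconst_mult in_keys_iff)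

context
  fixes q :: qt and C :: "qt set"
  assumes q: "q \<noteq> 0" and C: "coeff_module q C"
begin

lemma C_closed: "0 \<in> C" "a \<in> C \<Longrightarrow> b \<in> C \<Longrightarrow> a + b \<in> C" "a \<in> C \<Longrightarrow> - a \<in> C"
  "a \<in> C \<Longrightarrow> tt * a \<in> C" "a \<in> C \<Longrightarrow> inverse tt * a \<in> C" "a \<in> C \<Longrightarrow> inverse q * a \<in> C"
  using C by (auto simp: coeff_module_def)

lemma hpoly_0: "0 \<in> hpoly C m d"
  using C_closed by (simp add: hpoly_iff)

lemma hpoly_add: "F \<in> hpoly C m d \<Longrightarrow> G \<in> hpoly C m d \<Longrightarrow> F + G \<in> hpoly C m d"
  by (rule hpoly_add') (auto intro: C_closed)

lemma hpoly_uminus: "F \<in> hpoly C m d \<Longrightarrow> - F \<in> hpoly C m d"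
  using C_closed by (simp add: hpoly_iff)

lemma hpoly_diff: "F \<in> hpoly C m d \<Longrightarrow> G \<in> hpoly C m d \<Longrightarrow> F - G \<in> hpoly C m d"
  using hpoly_add[of F m d "- G"] hpoly_uminus by simp

lemma hpoly_tl: "F \<in> hpoly C m d \<Longrightarrow> tvar * F \<in> hpoly C m d"
  unfolding tvar_def by (rule hpoly_lconst_mult) (auto intro: C_closed)

lemma hpoly_tl_power: "F \<in> hpoly C m d \<Longrightarrow> tvar ^ k * F \<in> hpoly C m d"
  by (induction k) (simp_all add: hpoly_tl mult.assoc)

lemma hpoly_tl1: "F \<in> hpoly C m d \<Longrightarrow> (tvar - 1) * F \<in> hpoly C m d"
  using hpoly_diff[OF hpoly_tl, of F m d F] by (simp add: left_diff_distrib)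

lemma hpoly_sum: "(\<And>x. x \<in> A \<Longrightarrow> f x \<in> hpoly C m d) \<Longrightarrow> sum f A \<in> hpoly C m d"
  by (induction A rule: infinite_finite_induct) (auto intro: hpoly_0 hpoly_add)

lemma hpoly_dl:
  assumes "F \<in> hpoly C m d" "a \<noteq> b" "1 \<le> a" "a \<le> m" "1 \<le> b" "b \<le> m"
  shows "dl a b F \<in> hpoly C m d"
  using assms(1)
proof (induction d F rule: hpoly_induct)
  case (zero d)
  then show ?case using assms by (simp add: hpoly_0)
next
  case (const c)
  then show ?case using assms by (simp add: hpoly_tl hpoly_lconst C_closed)
next
  case (add d F G)
  then show ?case using assms by (simp add: hpoly_add)
next
  case (var d j F)
  consider "j = a" | "j = b" | "j \<noteq> a" "j \<noteq> b" by blast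
  then show ?case
  proof cases
    case 1
    then show ?thesis using assms var
      by (simp add: dl_a dlt_def hpoly_lvar_mult hpoly_diff hpoly_tl1)
  next
    case 2
    then show ?thesis using assms var
      by (simp add: dl_b hpoly_lvar_mult hpoly_add hpoly_tl1)
  next
    case 3
    then show ?thesis using assms var by (simp add: hpoly_lvar_mult)
  qed
qed (use C_closed in auto)

lemma hpoly_dlt:
  assumes "F \<in> hpoly C m d" "a \<noteq> b" "1 \<le> a" "a \<le> m" "1 \<le> b" "b \<le> m"
  shows "dlt a b F \<in> hpoly C m d"
  using assms hpoly_dl by (simp add: dlt_def hpoly_diff hpoly_tl1)

lemma hpoly_up: "F \<in> hpoly C m d \<Longrightarrow> k < m \<Longrightarrow> up k F \<in> hpoly C m d"
  by (induction k) (auto intro!: hpoly_dlt)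

lemma hpoly_rho:
  assumes "F \<in> hpoly C m d" "1 \<le> m"
  shows "rho q m F \<in> hpoly C m d"
  using assms(1)
proof (induction d F rule: hpoly_induct)
  case (var d j F)
  have "lconst (inverse q) * (lvar 1 * rho q m F) \<in> hpoly C m (Suc d)"
    using var assms by (intro hpoly_lconst_mult hpoly_lvar_mult) (auto intro: C_closed)
  then show ?case using var q assms by (auto simp: rho_lvar hpoly_lvar_mult mult.assoc)
qed (use q assms C_closed in \<open>auto simp: hpoly_0 hpoly_lconst hpoly_add\<close>)

lemma hpoly_PQ: "F \<in> hpoly C m d \<Longrightarrow> 1 \<le> m \<Longrightarrow> PQ q m F \<in> hpoly C m (Suc d)"
  by (simp add: PQ_def hpoly_lvar_mult hpoly_rho)

lemma hpoly_Aop: "F \<in> hpoly C m d \<Longrightarrow> 1 \<le> m \<Longrightarrow> Aop q m k F \<in> hpoly C m (Suc d)"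
  unfolding Aop_def by (auto intro!: hpoly_0 hpoly_sum hpoly_tl_power hpoly_up hpoly_PQ)

lemma hpoly_Wop: "1 \<in> C \<Longrightarrow> 1 \<le> m \<Longrightarrow> Wop q m ds \<in> hpoly C m (length ds)"
proof (induction ds)
  case Nil
  then show ?case using hpoly_lconst[of 1 C m] C_closed by (simp add: Wop_def)
next
  case (Cons d ds)
  then show ?case using hpoly_Aop by (simp add: Wop_def)
qed

end

section \<open>Symmetry\<close>

lemma dlt_dlt: "a \<noteq> b \<Longrightarrow> dlt a b (dlt a b F) = (1 - tvar) * dlt a b F + tvar * F"
  by (simp add: dlt_def dl_dl) (simp add: algebra_simps)

lemma dlt_commute:
  assumes "a \<noteq> b" "c \<noteq> d" "a \<noteq> c" "a \<noteq> d" "b \<noteq> c" "b \<noteq> d"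
  shows "dlt a b (dlt c d F) = dlt c d (dlt a b F)"
  using dl_commute[OF assms, of F] assms by (simp add: dlt_def) (simp add: algebra_simps)

lemma dlt_braid:
  assumes "a \<noteq> b" "b \<noteq> c" "a \<noteq> c"
  shows "dlt a b (dlt b c (dlt a b F)) = dlt b c (dlt a b (dlt b c F))"
  using dl_braid[OF assms, of F] assms by (simp add: dlt_def dl_dl) (simp add: algebra_simps)

lemma up_commute: "k + 2 \<le> i \<Longrightarrow> dlt i (Suc i) (up k F) = up k (dlt i (Suc i) F)"
proof (induction k)
  case (Suc k)
  then have "dlt i (Suc i) (up (Suc k) F) = dlt (Suc k) (Suc (Suc k)) (dlt i (Suc i) (up k F))"
    by (simp add: dlt_commute[of i "Suc i" "Suc k"])
  then show ?case using Suc by simp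
qed simp

text \<open>\<open>T_i^{-1}\<close> moves through \<open>T_k^{-1} ... T_{i+2}^{-1}\<close> by
  commutation, turns into \<open>T_{i+1}^{-1}\<close> at \<open>T_{i+1}^{-1} T_i^{-1}\<close> by the
  braid relation, and passes the remaining factors.\<close>

lemma up_shift: "1 \<le> i \<Longrightarrow> i < k \<Longrightarrow> dlt i (Suc i) (up k F) = up k (dlt (Suc i) (Suc (Suc i)) F)"
proof (induction k)
  case (Suc k)
  show ?case
  proof (cases "i = k")
    case True
    then obtain l where k: "k = Suc l" using Suc by (cases k) auto
    have "dlt i (Suc i) (up (Suc k) F)
       = dlt (Suc i) (Suc (Suc i)) (dlt i (Suc i) (dlt (Suc i) (Suc (Suc i)) (up l F)))"
    proof -
      have "dlt i (Suc i) (up (Suc k) F)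
         = dlt i (Suc i) (dlt (Suc i) (Suc (Suc i)) (dlt i (Suc i) (up l F)))" using True k by simp
      then show ?thesis using dlt_braid[of i "Suc i" "Suc (Suc i)"] by simp
    qed
    then show ?thesis using True k up_commute[of l "Suc i"] by simp
  next
    case False
    then have "dlt i (Suc i) (up (Suc k) F) = dlt (Suc k) (Suc (Suc k)) (dlt i (Suc i) (up k F))"
      using Suc by (simp add: dlt_commute[of i "Suc i" "Suc k"])
    then show ?thesis using Suc False by simp
  qed
qed simp

text \<open>The words \<open>T_k^{-1} ... T_1^{-1}\<close> belong to the minimal coset
  representatives of the group generated by \<open>s_2, ..., s_K\<close> in the one generated by
  \<open>s_1, ..., s_K\<close>. A term with \<open>k\<close> other than \<open>i - 1\<close> and
  \<open>i\<close> is fixed, by \<open>up_commute\<close> or \<open>up_shift\<close> and the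
  invariance of \<open>F\<close>; the other two are fixed as a pair.\<close>

lemma coset_symmetrizer:
  assumes inv: "\<And>i. 2 \<le> i \<Longrightarrow> i \<le> K \<Longrightarrow> dlt i (Suc i) F = F" and i: "1 \<le> i" "i \<le> K" and "K \<le> M"
  shows "dlt i (Suc i) (\<Sum>k<Suc K. tvar ^ (M - k) * up k F) = (\<Sum>k<Suc K. tvar ^ (M - k) * up k F)"
proof -
  let ?f = "\<lambda>k. tvar ^ (M - k) * up k F"
  have tp: "dlt i (Suc i) (tvar ^ a * G) = tvar ^ a * dlt i (Suc i) G" for a G
    by (rule dlt_smult) (simp_all add: tvar_def lconst_power[symmetric])
  have fixk: "dlt i (Suc i) (?f k) = ?f k" if "k < Suc K" "k \<noteq> i" "k \<noteq> i - 1" for k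
  proof (cases "k < i")
    case True
    then show ?thesis using that up_commute[of k i F] inv[of i] i by (simp add: tp)
  next
    case False
    then show ?thesis using that up_shift[of i k F] inv[of "Suc i"] i by (simp add: tp)
  qed
  obtain j where j: "i = Suc j" using i by (cases i) auto
  \<comment> \<open>Here the quadratic relation enters: with weights in the ratio \<open>t\<close>
    to \<open>1\<close> the pair is an eigenvector of \<open>dlt\<close> to the eigenvalue
    \<open>1\<close>.\<close>
  have pair: "dlt i (Suc i) (?f (i - 1) + ?f i) = ?f (i - 1) + ?f i"
  proof -
    have e: "tvar ^ (M - j) = tvar ^ (M - i) * tvar"
      using j i assms(4) by (metis Suc_diff_Suc Suc_le_lessD le_trans power_Suc2)
    have "dlt i (Suc i) (?f (i - 1) + ?f i) = tvar ^ (M - j) * up i F + tvar ^ (M - i) * ((1 - tvar) * up i F + tvar * up j F)"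
    proof -
      have "up i F = dlt i (Suc i) (up j F)" "i - 1 = j" using j by simp_all
      then show ?thesis by (simp add: tp dlt_dlt)
    qed
    also have "\<dots> = ?f (i - 1) + ?f i" unfolding e using j e by (simp add: algebra_simps)
    finally show ?thesis .
  qed
  have split: "(\<Sum>k<Suc K. g k) = (\<Sum>k\<in>{..<Suc K} - {i, i - 1}. g k) + (g (i - 1) + g i)" for g :: "nat \<Rightarrow> laurent"
  proof -
    have "(\<Sum>k<Suc K. g k) = (\<Sum>k\<in>{..<Suc K} - {i, i - 1}. g k) + (\<Sum>k\<in>{i, i - 1}. g k)"
      using i by (intro sum.subset_diff) auto
    then show ?thesis using j by (simp add: add.commute)
  qed
  have "(\<Sum>k\<in>{..<Suc K} - {i, i - 1}. dlt i (Suc i) (?f k)) = (\<Sum>k\<in>{..<Suc K} - {i, i - 1}. ?f k)"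
    by (rule sum.cong) (use fixk in auto)
  then show ?thesis unfolding split[of ?f] using pair
    by (simp only: dlt_add[OF n_not_Suc_n] dlt_sum[OF n_not_Suc_n])
qed

text \<open>The argument \<open>b\<close> bounds the first entry, and each entry exceeds its
  predecessor by at most one. With \<open>b = 0\<close> these are the area sequences of Dyck paths,
  which is what a monotone \<open>e\<close> yields for \<open>lneigh e\<close>.\<close>

fun dyck :: "nat \<Rightarrow> nat list \<Rightarrow> bool" where
  "dyck b [] = True"
| "dyck b (d # ds) = (d \<le> b \<and> dyck (Suc d) ds)"

text \<open>The bounds fit together: the tail starts with at most \<open>d + 1\<close>, hence is
  invariant under \<open>T_1, ..., T_{m-2-d}\<close>; \<open>\<Pi>\<close> shifts these to
  \<open>T_2, ..., T_{m-1-d}\<close>, as \<open>coset_symmetrizer\<close> requires for a sum of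
  \<open>m - d\<close> terms.\<close>

lemma Wop_invariant:
  assumes "q \<noteq> 0" "1 \<le> m" "dyck b ds" "1 \<le> i" "i + b < m"
  shows "dlt i (Suc i) (Wop q m ds) = Wop q m ds"
  using assms(3-5)
proof (induction ds arbitrary: b i)
  case Nil
  then show ?case by (simp add: Wop_def)
next
  case (Cons d ds)
  let ?G = "Wop q m ds"
  have d: "d < m" "m - d = Suc (m - 1 - d)" using Cons by auto
  have W: "Wop q m (d # ds) = (\<Sum>k<Suc (m - 1 - d). tvar ^ (m - 1 - k) * up k (PQ q m ?G))"
    using d by (simp add: Wop_def Aop_def)
  show ?case unfolding W
  proof (rule coset_symmetrizer)
    fix j assume j: "2 \<le> j" "j \<le> m - 1 - d"
    then obtain l where l: "j = Suc l" "1 \<le> l" by (cases j) auto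
    have "dlt l (Suc l) ?G = ?G" using Cons.IH[of "Suc d" l] Cons.prems l j by simp
    then have "PQ q m (dlt l (Suc l) ?G) = PQ q m ?G" by simp
    moreover have "PQ q m (dlt l (Suc l) ?G) = dlt j (Suc j) (PQ q m ?G)"
      using assms l j PQ_dl[of q m l ?G] by (simp add: dlt_def)
    ultimately show "dlt j (Suc j) (PQ q m ?G) = PQ q m ?G" by simp
  qed (use Cons in auto)
qed

lemma swp_invariant_imp_symmetric:
  assumes inv: "\<And>i. 1 \<le> i \<Longrightarrow> i < m \<Longrightarrow> swp i (Suc i) F = F" and "\<sigma> permutes {1..m}"
  shows "lsubst (\<lambda>i. lvar (\<sigma> i)) F = F"
proof -
  have comp: "lsubst (\<lambda>i. lvar ((\<sigma> \<circ> \<tau>) i)) F = F"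
    if "lsubst (\<lambda>i. lvar (\<sigma> i)) F = F" "lsubst (\<lambda>i. lvar (\<tau> i)) F = F" for \<sigma> \<tau>
    using lsubst_unit_comp[OF unit_family_lvar[of \<sigma>] unit_family_lvar[of \<tau>], of F] that
    by (simp add: unit_family_lvar)
  have tr: "lsubst (\<lambda>i. lvar (transpose a (a + k) i)) F = F" if "1 \<le> a" "a + k \<le> m" for a k
    using that
  proof (induction k)
    case 0
    then show ?case by (simp add: lsubst_id)
  next
    case (Suc k)
    show ?case
    proof (cases "k = 0")
      case True
      then show ?thesis using inv[of a] Suc by (simp add: swp_def)
    next
      case False
      have 1: "lsubst (\<lambda>i. lvar (transpose (a + k) (Suc (a + k)) i)) F = F"
        using inv[of "a + k"] Suc by (simp add: swp_def)
      have 2: "lsubst (\<lambda>i. lvar (transpose a (a + k) i)) F = F" using Suc by simp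
      have "transpose (a + k) (Suc (a + k)) \<circ> (transpose a (a + k) \<circ> transpose (a + k) (Suc (a + k))) = transpose a (a + Suc k)"
        using False by (auto simp: fun_eq_iff transpose_def)
      then show ?thesis using comp[OF 1 comp[OF 2 1]] by metis
    qed
  qed
  have tr': "lsubst (\<lambda>i. lvar (transpose a b i)) F = F" if "a \<in> {1..m}" "b \<in> {1..m}" for a b
    using tr[of a "b - a"] tr[of b "a - b"] that by (cases "a \<le> b") (auto simp: transpose_commute)
  show ?thesis
    using assms(2) finite_atLeastAtMost[of 1 m]
  proof (induction rule: permutes_induct)
    case id
    then show ?case by (simp add: lsubst_id)
  next
    case (swap a b p)
    then show ?case using comp[OF tr'] by blast
  qed
qed

lemma Wop_symmetric:
  assumes "q \<noteq> 0" "1 \<le> m" "dyck 0 ds" "\<sigma> permutes {1..m}"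
  shows "lsubst (\<lambda>i. lvar (\<sigma> i)) (Wop q m ds) = Wop q m ds"
proof (rule swp_invariant_imp_symmetric[OF _ assms(4)])
  fix i assume "1 \<le> i" "i < m"
  then have "dlt i (Suc i) (Wop q m ds) = Wop q m ds" using assms by (intro Wop_invariant[of _ _ 0]) auto
  then show "swp i (Suc i) (Wop q m ds) = Wop q m ds"
    using dl_eq_tl_iff dl_symmetric_iff by (metis n_not_Suc_n)
qed

lemma hpoly_symmetric_in_ring:
  assumes "F \<in> hpoly C m d" "\<And>\<sigma>. \<sigma> permutes {1..m} \<Longrightarrow> lsubst (\<lambda>i. lvar (\<sigma> i)) F = F"
  shows "F \<in> sym_poly_ring m"
  using assms by (simp add: sym_poly_ring_def hpoly_def)

section \<open>Stability\<close>

lemma lookup_proj: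
  assumes "F \<in> hpoly UNIV m d"
  shows "lookup (proj m' F) \<mu> = (if keys \<mu> \<subseteq> {..m'} then lookup F \<mu> else 0)"
  using assms
proof (induction d F arbitrary: \<mu> rule: hpoly_induct)
  case (const c)
  show ?case by (simp only: proj_def lsubst_lconst) (auto simp: lconst_def lookup_single when_def) 
next
  case (add d F G)
  then show ?case by (simp add: proj_def lsubst_add lookup_add)
next
  case (var d j F)
  let ?\<nu> = "\<mu> - Poly_Mapping.single j 1"
  have nn: "\<forall>\<mu>\<in>keys F. 0 \<le> lookup \<mu> j" using var by (auto simp: hpoly_iff pexp_def)
  have p: "proj m' (lvar j * F) = (if j \<le> m' then lvar j else 0) * proj m' F"
    unfolding proj_def by (rule lsubst_lvar_mult) (use nn in blast)
  show ?case
  proof (cases "j \<le> m'")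
    case True
    have "keys ?\<nu> \<subseteq> {..m'} \<longleftrightarrow> keys \<mu> \<subseteq> {..m'}"
    proof -
      have "keys \<mu> \<subseteq> keys ?\<nu> \<union> {j}" "keys ?\<nu> \<subseteq> keys \<mu> \<union> {j}"
        by (auto simp: in_keys_iff lookup_minus lookup_single when_def split: if_splits)
      then show ?thesis using True by auto
    qed
    then show ?thesis using True var by (simp add: p lookup_lvar_mult)
  next
    case False
    have "lookup F ?\<nu> = 0" if "keys \<mu> \<subseteq> {..m'}"
    proof (rule ccontr)
      assume "lookup F ?\<nu> \<noteq> 0"
      then have "0 \<le> lookup ?\<nu> j" using nn by (simp add: in_keys_iff)
      moreover have "lookup \<mu> j = 0" using that False by (auto simp: in_keys_iff subset_iff)
      ultimately show False by (simp add: lookup_minus)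
    qed
    then show ?thesis using False by (simp add: p lookup_lvar_mult)
  qed
qed (simp_all add: proj_def)

text \<open>Killing \<open>X_1\<close> instead of \<open>X_m\<close> suits the operators, because
  \<open>\<Pi>\<close> produces a factor \<open>X_1\<close>. On symmetric polynomials the result is
  that of \<open>proj (m - 1)\<close>, see \<open>proj_symmetric_eq_eps\<close>.\<close>

definition eps :: "laurent \<Rightarrow> laurent" where
  "eps = lsubst (\<lambda>j. if j = 1 then 0 else lvar (j - 1))"

lemma eps_simps [simp]: "eps 0 = 0" "eps 1 = 1" "eps (lconst c) = lconst c" "eps (F + G) = eps F + eps G"
  "eps (F - G) = eps F - eps G" "eps (lconst c * F) = lconst c * eps F" "eps (tvar * F) = tvar * eps F"
  "eps ((tvar - 1) * F) = (tvar - 1) * eps F"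
  by (simp_all add: eps_def lsubst_add lsubst_diff lsubst_lconst_mult tvar_def left_diff_distrib)

lemma eps_sum: "eps (sum f A) = (\<Sum>x\<in>A. eps (f x))"
  by (simp add: eps_def lsubst_sum)

lemma eps_lvar_mult:
  assumes "F \<in> hpoly UNIV m d"
  shows "eps (lvar j * F) = (if j = 1 then 0 else lvar (j - 1) * eps F)"
proof -
  have "\<forall>\<mu>\<in>keys F. 0 \<le> lookup \<mu> j" using assms by (auto simp: hpoly_iff pexp_def)
  then have "eps (lvar j * F) = (if j = 1 then 0 else lvar (j - 1)) * eps F"
    unfolding eps_def by (intro lsubst_lvar_mult) blast
  then show ?thesis by simp
qed

lemmas hpU = hpoly_dl[OF one_neq_zero coeff_module_UNIV] hpoly_dlt[OF one_neq_zero coeff_module_UNIV]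
  hpoly_lvar_mult

lemma eps_dlt:
  assumes "F \<in> hpoly UNIV m d" "2 \<le> i" "i < m"
  shows "eps (dlt i (Suc i) F) = dlt (i - 1) i (eps F)"
  using assms(1)
proof (induction d F rule: hpoly_induct)
  case (var d j F)
  have n: "i \<noteq> i - 1" "i - 1 \<noteq> i" "i \<noteq> 1" using assms by auto
  have F': "dlt i (Suc i) F \<in> hpoly UNIV m d" "dl i (Suc i) F \<in> hpoly UNIV m d"
    using var assms by (auto intro!: hpU)
  have dl: "eps (dl i (Suc i) F) = dl (i - 1) i (eps F)"
    using var.IH unfolding dlt_def by simp
  consider "j = i" | "j = Suc i" | "j = 1" | "j \<noteq> i" "j \<noteq> Suc i" "j \<noteq> 1" by blast
  then show ?case
  proof cases
    case 1
    then show ?thesis using n var by (simp add: dlt_a eps_lvar_mult[OF F'(1)] eps_lvar_mult[OF var(3)])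
  next
    case 2
    then show ?thesis using n var by (simp add: dlt_b eps_lvar_mult[OF F'(2)] eps_lvar_mult[OF var(3)] dl)
  next
    case 3
    then show ?thesis using n var assms by (simp add: eps_lvar_mult[OF F'(1)] eps_lvar_mult[OF var(3)])
  next
    case 4
    then have "j - 1 \<noteq> i - 1" "j - 1 \<noteq> i" using var assms by auto
    then show ?thesis using 4 n var by (simp add: eps_lvar_mult[OF F'(1)] eps_lvar_mult[OF var(3)])
  qed
qed (use assms in auto)

lemma hpoly_swp:
  assumes "F \<in> hpoly UNIV m d" "1 \<le> a" "a \<le> m" "1 \<le> b" "b \<le> m"
  shows "swp a b F \<in> hpoly UNIV m d"
  using assms(1)
proof (induction d F rule: hpoly_induct)
  case (var d j F)
  then show ?case using assms by (auto simp: transpose_def intro!: hpoly_lvar_mult)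
qed (auto simp: hpoly_0[OF one_neq_zero coeff_module_UNIV] hpoly_lconst hpoly_add')

text \<open>At \<open>X_1 = 0\<close> the correction term \<open>(t - 1) X_1 F\<close> of
  \<open>dlt_a\<close> and the whole right side of \<open>dlt_b\<close> disappear; what is left is
  the rule of the swap, free of \<open>t\<close>.\<close>

lemma eps_dlt_1:
  assumes "F \<in> hpoly UNIV m d" "2 \<le> m"
  shows "eps (dlt 1 2 F) = eps (swp 1 2 F)"
  using assms(1)
proof (induction d F rule: hpoly_induct)
  case (var d j F)
  have F': "dlt 1 2 F \<in> hpoly UNIV m d" "dl 1 2 F \<in> hpoly UNIV m d" "swp 1 2 F \<in> hpoly UNIV m d"
    using var assms by (auto intro!: hpU hpoly_swp)
  note e = eps_lvar_mult[OF F'(1)] eps_lvar_mult[OF F'(2)] eps_lvar_mult[OF F'(3)] eps_lvar_mult[OF var(3)]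
  consider "j = 1" | "j = 2" | "j \<noteq> 1" "j \<noteq> 2" by blast
  then show ?case
    by cases (use var in \<open>simp_all add: dlt_a dlt_b e\<close>)
qed auto

text \<open>The swap saves the variable that wraps around: \<open>rho\<close> sends
  \<open>X_m\<close> to a multiple of \<open>X_1\<close>, which would be killed, and the swap moves
  it to \<open>X_2\<close>. In its place the image of \<open>X_1\<close> is killed.\<close>

lemma eps_swp_rho:
  assumes "F \<in> hpoly UNIV m d" "2 \<le> m" "q \<noteq> 0"
  shows "eps (swp 1 2 (rho q m F)) = rho q (m - 1) (eps F)"
  using assms(1)
proof (induction d F rule: hpoly_induct)
  case (var d j F)
  have F': "swp 1 2 (rho q m F) \<in> hpoly UNIV m d"
    using var assms by (auto intro!: hpoly_swp hpoly_rho coeff_module_UNIV)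
  note e = eps_lvar_mult[OF F'] eps_lvar_mult[OF var(3)]
  have m1: "1 \<le> m" "1 \<le> m - 1" using assms by auto
  consider "j = m" | "j = 1" "j \<noteq> m" | "j \<noteq> 1" "j \<noteq> m" by blast
  then show ?case
  proof cases
    case 1
    then show ?thesis using var assms m1 by (simp add: rho_lvar e mult.assoc)
  next
    case 2
    then have "rho q m (lvar 1) = lvar 2" using assms by (simp add: rho_lvar numeral_2_eq_2 One_nat_def)
    then show ?thesis using 2 var assms m1 by (simp add: e)
  next
    case 3
    then have "Suc j \<noteq> 1" "Suc j \<noteq> 2" "Suc j - 1 = j" "j - 1 \<noteq> m - 1" "1 \<le> j - 1" "j - 1 < m - 1" "Suc (j - 1) = j"
      using var by auto
    then show ?thesis using 3 var assms m1 by (simp add: rho_lvar e)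
  qed
qed (use assms in auto)

lemma eps_up_PQ:
  assumes F: "F \<in> hpoly UNIV m d" and "q \<noteq> 0" "Suc k < m"
  shows "eps (up (Suc k) (PQ q m F)) = up k (PQ q (m - 1) (eps F))"
  using assms(3)
proof (induction k)
  case 0
  have m1: "1 \<le> m" "1 \<le> m - 1" "2 \<le> m" using 0 by auto
  have R: "rho q m F \<in> hpoly UNIV m d" using F m1 assms by (auto intro!: hpoly_rho coeff_module_UNIV)
  have R': "dlt 1 2 (rho q m F) \<in> hpoly UNIV m d" using R m1 by (auto intro!: hpU)
  have "eps (dlt 1 2 (lvar 1 * rho q m F)) = lvar 1 * eps (dlt 1 2 (rho q m F))"
    by (simp add: dlt_a eps_lvar_mult[OF R] eps_lvar_mult[OF R'])
  moreover have "up (Suc 0) G = dlt 1 2 G" for G by (simp add: numeral_2_eq_2 One_nat_def)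
  ultimately show ?case using m1 assms(2)
    by (simp add: PQ_def eps_dlt_1[OF R] eps_swp_rho[OF F] del: up.simps(2))
next
  case (Suc k)
  have "up (Suc k) (PQ q m F) \<in> hpoly UNIV m (Suc d)"
    using Suc F assms by (intro hpoly_up[OF assms(2) coeff_module_UNIV] hpoly_PQ[OF assms(2) coeff_module_UNIV]) auto
  from eps_dlt[OF this, of "Suc (Suc k)"] show ?case using Suc by simp
qed

text \<open>The term \<open>k = 0\<close> is divisible by \<open>X_1\<close> and dies. In the others
  the innermost factor becomes the swap and is absorbed by \<open>rho\<close>, so that term
  \<open>k + 1\<close> for \<open>m\<close> is term \<open>k\<close> for \<open>m - 1\<close>, with
  the same power of \<open>t\<close>.\<close>

lemma eps_Aop:
  assumes F: "F \<in> hpoly UNIV m c" and q: "q \<noteq> 0" and m: "2 \<le> m"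
  shows "eps (Aop q m d F) = Aop q (m - 1) d (eps F)"
proof (cases "d < m")
  case True
  have tlp: "eps (tvar ^ a * G) = tvar ^ a * eps G" for a G
    by (simp add: tvar_def lconst_power[symmetric])
  have md: "m - d = Suc (m - 1 - d)" using True by simp
  have "rho q m F \<in> hpoly UNIV m c" using F m q by (auto intro!: hpoly_rho coeff_module_UNIV)
  then have 0: "eps (up 0 (PQ q m F)) = 0" by (simp add: PQ_def eps_lvar_mult)
  have "eps (Aop q m d F) = (\<Sum>k<Suc (m - 1 - d). tvar ^ (m - 1 - k) * eps (up k (PQ q m F)))"
    using True by (simp only: Aop_def if_True eps_sum tlp md)
  also have "\<dots> = (\<Sum>k<m - 1 - d. tvar ^ (m - 1 - Suc k) * eps (up (Suc k) (PQ q m F)))"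
    by (subst sum.lessThan_Suc_shift) (simp add: 0 del: up.simps)
  also have "\<dots> = (\<Sum>k<m - 1 - d. tvar ^ (m - 1 - 1 - k) * up k (PQ q (m - 1) (eps F)))"
    by (intro sum.cong) (auto simp: eps_up_PQ[OF F q] One_nat_def simp del: up.simps)
  also have "\<dots> = Aop q (m - 1) d (eps F)" using True by (auto simp: Aop_def)
  finally show ?thesis .
qed (simp add: Aop_def)

lemma eps_Wop:
  assumes "q \<noteq> 0" "2 \<le> m"
  shows "eps (Wop q m ds) = Wop q (m - 1) ds"
proof (induction ds)
  case (Cons d ds)
  have "Wop q m ds \<in> hpoly UNIV m (length ds)"
    using assms by (intro hpoly_Wop coeff_module_UNIV) auto
  then show ?case using Cons eps_Aop assms by (simp add: Wop_def)
qed (simp add: Wop_def)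

text \<open>The cycle \<open>\<sigma>\<close> that sends \<open>1\<close> to \<open>m\<close> and
  lowers the other indices turns the one substitution into the other.\<close>

lemma proj_symmetric_eq_eps:
  assumes F: "F \<in> hpoly UNIV m d" and m: "1 \<le> m"
    and sym: "\<And>\<sigma>. \<sigma> permutes {1..m} \<Longrightarrow> lsubst (\<lambda>i. lvar (\<sigma> i)) F = F"
  shows "proj (m - 1) F = eps F"
proof -
  define \<sigma> where "\<sigma> j = (if j = 1 then m else if 1 < j \<and> j \<le> m then j - 1 else j)" for j
  have "\<sigma> permutes {1..m}"
  proof (rule bij_imp_permutes)
    show "bij_betw \<sigma> {1..m} {1..m}"
      by (rule bij_betw_byWitness[of _ "\<lambda>j. if j = m then 1 else j + 1"])
        (use m in \<open>auto simp: \<sigma>_def\<close>)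
  qed (use m in \<open>auto simp: \<sigma>_def\<close>)
  then have s: "lsubst (\<lambda>i. lvar (\<sigma> i)) F = F" by (rule sym)
  have "proj (m - 1) (lsubst (\<lambda>i. lvar (\<sigma> i)) F) = eps F \<and> lsubst (\<lambda>i. lvar (\<sigma> i)) F \<in> hpoly UNIV m d"
    using F
  proof (induction d F rule: hpoly_induct)
    case (const c)
    then show ?case by (simp add: proj_def hpoly_lconst)
  next
    case (add d F G)
    then show ?case by (simp add: proj_def lsubst_add hpoly_add')
  next
    case (var d j F)
    let ?s = "lsubst (\<lambda>i. lvar (\<sigma> i))"
    have u: "?s (lvar j * F) = lvar (\<sigma> j) * ?s F" by (simp add: unit_family_lvar)
    have sj: "1 \<le> \<sigma> j" "\<sigma> j \<le> m" using var by (auto simp: \<sigma>_def)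
    have nn: "\<forall>\<mu>\<in>keys (?s F). 0 \<le> lookup \<mu> (\<sigma> j)" using var by (auto simp: hpoly_iff pexp_def)
    have "proj (m - 1) (lvar (\<sigma> j) * ?s F) = (if \<sigma> j \<le> m - 1 then lvar (\<sigma> j) else 0) * proj (m - 1) (?s F)"
      unfolding proj_def by (rule lsubst_lvar_mult) (use nn in blast)
    also have "\<dots> = eps (lvar j * F)"
      using var m by (auto simp: eps_lvar_mult[OF var(3)] \<sigma>_def)
    finally show ?case using u sj var hpoly_lvar_mult by simp
  qed (simp_all add: proj_def hpoly_0[OF one_neq_zero coeff_module_UNIV])
  then show ?thesis using s by simp
qed

lemma proj_proj:
  assumes "F \<in> hpoly UNIV m d" "proj k F \<in> hpoly UNIV k d" "l \<le> k"
  shows "proj l (proj k F) = proj l F"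
  by (rule poly_mapping_eqI) (use assms(3) in \<open>auto simp: lookup_proj[OF assms(1)] lookup_proj[OF assms(2)]\<close>)

lemma proj_Wop:
  assumes "q \<noteq> 0" "1 \<le> m'" "m' < m" "dyck 0 ds"
  shows "proj m' (Wop q m ds) = Wop q m' ds"
  using assms(3)
proof (induction m)
  case (Suc m)
  have m1: "1 \<le> m" using Suc assms by simp
  have H: "Wop q m ds \<in> hpoly UNIV m (length ds)" "Wop q (Suc m) ds \<in> hpoly UNIV (Suc m) (length ds)"
    using assms m1 by (auto intro!: hpoly_Wop coeff_module_UNIV)
  have "proj m (Wop q (Suc m) ds) = eps (Wop q (Suc m) ds)"
    using proj_symmetric_eq_eps[OF H(2)] Wop_symmetric[of q "Suc m" ds] assms by simp
  then have p: "proj m (Wop q (Suc m) ds) = Wop q m ds"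
    using eps_Wop[of q "Suc m" ds] assms m1 by simp
  show ?case
  proof (cases "m' = m")
    case False
    then have "proj m' (proj m (Wop q (Suc m) ds)) = Wop q m' ds" using Suc p by simp
    then show ?thesis using proj_proj[OF H(2), of m m'] H(1) p Suc by simp
  qed (use p in simp)
qed simp

section \<open>Chromatic polynomials with ghost vertices\<close>

definition nb :: "(nat \<Rightarrow> int) \<Rightarrow> nat \<Rightarrow> nat set" where
  "nb e i = {j. 1 \<le> j \<and> j < i \<and> e i < int j}"

text \<open>Every edge is charged to its later endpoint, so that the product over all vertices is
  the weight of a coloring if it is proper, and \<open>0\<close> otherwise.\<close>

definition loc :: "(nat \<Rightarrow> int) \<Rightarrow> (nat \<Rightarrow> nat) \<Rightarrow> nat \<Rightarrow> laurent" where
  "loc e \<kappa> i = (if \<kappa> i \<in> \<kappa> ` nb e i then 0 else tvar ^ card {j \<in> nb e i. \<kappa> j < \<kappa> i} * lvar (\<kappa> i))"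

text \<open>Colorings of the last \<open>k\<close> of the \<open>n\<close> vertices; the earlier vertices are ghosts with colors
  prescribed by \<open>\<kappa>\<close>, which restrict the colorings and contribute ascents but no variables.\<close>

primrec ghost :: "(nat \<Rightarrow> int) \<Rightarrow> nat \<Rightarrow> nat \<Rightarrow> nat \<Rightarrow> (nat \<Rightarrow> nat) \<Rightarrow> laurent" where
  "ghost e m n 0 \<kappa> = 1"
| "ghost e m n (Suc k) \<kappa> = (\<Sum>b = 1..m. loc e (\<kappa>(n - k := b)) (n - k) * ghost e m n k (\<kappa>(n - k := b)))"

text \<open>The ghosts that still matter when \<open>k\<close> vertices are left: as
  \<open>e\<close> is monotone, a ghost adjacent to any of those vertices is adjacent to the first.
  They are pairwise adjacent, which accounts for the injectivity assumption in
  \<open>ghost_exchange\<close>. For \<open>k = 0\<close> there is no next vertex, hence the empty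
  set.\<close>

definition nbn :: "(nat \<Rightarrow> int) \<Rightarrow> nat \<Rightarrow> nat \<Rightarrow> nat set" where
  "nbn e n k = (if k = 0 then {} else nb e (Suc (n - k)))"

definition chr :: "(nat \<Rightarrow> int) \<Rightarrow> nat \<Rightarrow> nat \<Rightarrow> laurent" where
  "chr e m n = (\<Sum>f\<in>{1..n} \<rightarrow>\<^sub>E {1..m}. \<Prod>i\<in>{1..n}. loc e f i)"

lemma nb_finite [simp]: "finite (nb e i)"
  by (rule finite_subset[of _ "{..<i}"]) (auto simp: nb_def)

lemma nb_not_self [simp]: "i \<notin> nb e i"
  by (simp add: nb_def)

lemma loc_cong: "(\<And>j. j \<in> insert i (nb e i) \<Longrightarrow> \<kappa> j = \<kappa>' j) \<Longrightarrow> loc e \<kappa> i = loc e \<kappa>' i"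
proof -
  assume a: "\<And>j. j \<in> insert i (nb e i) \<Longrightarrow> \<kappa> j = \<kappa>' j"
  have 1: "\<kappa> ` nb e i = \<kappa>' ` nb e i" using a by (intro image_cong) auto
  have 2: "{j \<in> nb e i. \<kappa> j < \<kappa> i} = {j \<in> nb e i. \<kappa>' j < \<kappa>' i}" using a by auto
  have 3: "\<kappa> i = \<kappa>' i" using a by simp
  show ?thesis unfolding loc_def 1 2 unfolding 3 by simp
qed

lemma sum_PiE_insert:
  assumes "finite S" "x \<notin> S"
  shows "(\<Sum>f\<in>insert x S \<rightarrow>\<^sub>E T. h f) = (\<Sum>b\<in>T. \<Sum>f\<in>S \<rightarrow>\<^sub>E T. h (f(x := b)))"
proof -
  have "(\<Sum>f\<in>insert x S \<rightarrow>\<^sub>E T. h f) = sum (h \<circ> (\<lambda>(y, g). g(x := y))) (T \<times> (S \<rightarrow>\<^sub>E T))"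
    unfolding PiE_insert_eq by (rule sum.reindex) (use inj_combinator[OF assms(2), of "\<lambda>_. T"] in simp)
  also have "\<dots> = (\<Sum>b\<in>T. \<Sum>f\<in>S \<rightarrow>\<^sub>E T. h (f(x := b)))"
    by (simp add: sum.cartesian_product case_prod_beta o_def)
  finally show ?thesis .
qed

lemma ghost_eq_sum:
  assumes "k \<le> n"
  shows "ghost e m n k \<kappa> = (\<Sum>f\<in>{n - k<..n} \<rightarrow>\<^sub>E {1..m}. \<Prod>i\<in>{n - k<..n}. loc e (\<lambda>j. if n - k < j then f j else \<kappa> j) i)"
  using assms
proof (induction k arbitrary: \<kappa>)
  case 0
  then show ?case by simp
next
  case (Suc k)
  define i where "i = n - k"
  have S: "{n - Suc k<..n} = insert i {i<..n}" "n - Suc k < j \<longleftrightarrow> i \<le> j" for j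
    using Suc by (auto simp: i_def)
  have "(\<Prod>v\<in>insert i {i<..n}. loc e (\<lambda>j. if i \<le> j then (f(i := b)) j else \<kappa> j) v)
     = loc e (\<kappa>(i := b)) i * (\<Prod>v\<in>{i<..n}. loc e (\<lambda>j. if i < j then f j else (\<kappa>(i := b)) j) v)" for f b
  proof -
    have 1: "loc e (\<lambda>j. if i \<le> j then (f(i := b)) j else \<kappa> j) i = loc e (\<kappa>(i := b)) i"
      by (rule loc_cong) (auto simp: nb_def)
    have 2: "(\<lambda>j. if i \<le> j then (f(i := b)) j else \<kappa> j) = (\<lambda>j. if i < j then f j else (\<kappa>(i := b)) j)"
      by (auto simp: fun_eq_iff)
    have "(\<Prod>v\<in>insert i {i<..n}. loc e (\<lambda>j. if i \<le> j then (f(i := b)) j else \<kappa> j) v)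
       = loc e (\<lambda>j. if i \<le> j then (f(i := b)) j else \<kappa> j) i * (\<Prod>v\<in>{i<..n}. loc e (\<lambda>j. if i \<le> j then (f(i := b)) j else \<kappa> j) v)"
      by (rule prod.insert) auto
    then show ?thesis unfolding 1 unfolding 2 .
  qed
  then have "(\<Sum>f\<in>insert i {i<..n} \<rightarrow>\<^sub>E {1..m}. \<Prod>v\<in>insert i {i<..n}. loc e (\<lambda>j. if i \<le> j then f j else \<kappa> j) v)
     = (\<Sum>b = 1..m. loc e (\<kappa>(i := b)) i * (\<Sum>f\<in>{i<..n} \<rightarrow>\<^sub>E {1..m}. \<Prod>v\<in>{i<..n}. loc e (\<lambda>j. if i < j then f j else (\<kappa>(i := b)) j) v))"
    by (subst sum_PiE_insert) (auto simp: sum_distrib_left)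
  also have "\<dots> = ghost e m n (Suc k) \<kappa>"
    using Suc unfolding i_def by simp
  finally show ?case unfolding S by simp
qed

lemma ghost_eq_chr: "ghost e m n n \<kappa> = chr e m n"
proof -
  have S: "{n - n<..n} = {1..n}" by auto
  have "(\<Prod>i\<in>{1..n}. loc e (\<lambda>j. if n - n < j then f j else \<kappa> j) i) = (\<Prod>i\<in>{1..n}. loc e f i)" for f
    by (intro prod.cong loc_cong refl) (auto simp: nb_def)
  then show ?thesis unfolding ghost_eq_sum[OF order_refl] S chr_def by simp
qed

context
  fixes e :: "nat \<Rightarrow> int" and n :: nat
  assumes e: "e \<in> unit_interval_fun n"
begin

lemma e_bounds: "1 \<le> i \<Longrightarrow> i \<le> n \<Longrightarrow> 0 \<le> e i \<and> e i < int i"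
  using e by (auto simp: unit_interval_fun_def)

lemma e_mono: "1 \<le> i \<Longrightarrow> i < n \<Longrightarrow> e i \<le> e (Suc i)"
  using e by (auto simp: unit_interval_fun_def Suc_eq_plus1)

lemma nbn_subset: "k < n \<Longrightarrow> nbn e n k \<subseteq> insert (n - k) (nb e (n - k))"
  using e_mono[of "n - k"] by (auto simp: nbn_def nb_def)

text \<open>Ghosts drop out from the oldest on. This settles the case of
  \<open>ghost_exchange\<close> in which the deciding ghost has just dropped out.\<close>

lemma nbn_upset: "k < n \<Longrightarrow> j \<in> insert (n - k) (nb e (n - k)) \<Longrightarrow> j \<notin> nbn e n k \<Longrightarrow> j' \<in> nbn e n k \<Longrightarrow> j < j'"
  by (auto simp: nbn_def nb_def split: if_splits)

lemma nbn_Suc: "k < n \<Longrightarrow> nbn e n (Suc k) = nb e (n - k)"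
  by (simp add: nbn_def Suc_diff_Suc)

lemma ghost_cong:
  assumes "k \<le> n" "\<And>j. j \<in> nbn e n k \<Longrightarrow> \<kappa> j = \<kappa>' j"
  shows "ghost e m n k \<kappa> = ghost e m n k \<kappa>'"
  using assms
proof (induction k arbitrary: \<kappa> \<kappa>')
  case (Suc k)
  have "ghost e m n k (\<kappa>(n - k := b)) = ghost e m n k (\<kappa>'(n - k := b))" for b
    using Suc.prems nbn_subset[of k] nbn_Suc[of k] by (intro Suc.IH) auto
  moreover have "loc e (\<kappa>(n - k := b)) (n - k) = loc e (\<kappa>'(n - k := b)) (n - k)" for b
    using Suc.prems nbn_Suc[of k] by (intro loc_cong) auto
  ultimately show ?case by simp
qed simp

text \<open>Only the latest ghost among those of color \<open>c\<close> or \<open>c + 1\<close> decides on the direction of the exchange.\<close>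

lemma ghost_exchange:
  assumes "k \<le> n" "inj_on \<kappa> (nbn e n k)" "1 \<le> c" "Suc c \<le> m"
  shows "((\<forall>j\<in>nbn e n k. \<kappa> j \<noteq> c \<and> \<kappa> j \<noteq> Suc c) \<longrightarrow>
      dlt (Suc c) c (ghost e m n k \<kappa>) = ghost e m n k \<kappa>) \<and>
    (\<forall>j\<in>nbn e n k. \<kappa> j = Suc c \<longrightarrow> (\<forall>j'\<in>nbn e n k. j < j' \<longrightarrow> \<kappa> j' \<noteq> c) \<longrightarrow>
      dlt (Suc c) c (ghost e m n k \<kappa>) = ghost e m n k (transpose c (Suc c) \<circ> \<kappa>))"
  using assms(1,2)
proof (induction k arbitrary: \<kappa>)
  case 0
  then show ?case by simp
next
  case (Suc k)
  define i where "i = n - k"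
  define N where "N = nb e i"
  define s where "s = transpose c (Suc c)"
  let ?G = "ghost e m n k"
  let ?T = "dlt (Suc c) c"
  have kn: "k < n" using Suc by simp
  have N': "nbn e n k \<subseteq> insert i N" using nbn_subset[OF kn] by (simp add: N_def i_def)
  have NS: "nbn e n (Suc k) = N" using nbn_Suc[OF kn] by (simp add: N_def i_def)
  have inj: "inj_on \<kappa> N" using Suc.prems NS by simp
  have iN: "i \<notin> N" "finite N" by (simp_all add: N_def)
  have lt: "j < i" if "j \<in> N" for j using that by (simp add: N_def nb_def)
  have ni: "\<not> i < j'" if "j' \<in> N" for j' using lt[OF that] by simp
  have ss: "s (s x) = x" "s c = Suc c" "s (Suc c) = c" "x \<noteq> c \<Longrightarrow> x \<noteq> Suc c \<Longrightarrow> s x = x" for x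
    by (simp_all add: s_def)
  have A: "?T (?G \<kappa>') = ?G \<kappa>'" if "inj_on \<kappa>' (insert i N)" "\<forall>j\<in>insert i N. \<kappa>' j \<noteq> c \<and> \<kappa>' j \<noteq> Suc c" for \<kappa>'
    using Suc.IH[of \<kappa>'] that N' inj_on_subset[OF that(1) N'] kn by auto
  have B: "?T (?G \<kappa>') = ?G (s \<circ> \<kappa>')"
    if inj': "inj_on \<kappa>' (insert i N)" and j: "j \<in> insert i N" "\<kappa>' j = Suc c" and
      new: "\<forall>j'\<in>insert i N. j < j' \<longrightarrow> \<kappa>' j' \<noteq> c" for \<kappa>' j
  proof (cases "j \<in> nbn e n k")
    case True
    moreover have "\<forall>j'\<in>nbn e n k. j < j' \<longrightarrow> \<kappa>' j' \<noteq> c" using N' new by blast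
    ultimately show ?thesis
      using Suc.IH[OF less_imp_le[OF kn] inj_on_subset[OF inj' N']] j(2) unfolding s_def by blast
  next
    case False
    \<comment> \<open>All ghosts that still matter are later than \<open>j\<close>: none has color
      \<open>c\<close> by assumption, none \<open>c + 1\<close> by injectivity. So the exchange of
      colors changes nothing, and the invariant case applies.\<close>
    have no: "\<kappa>' j' \<noteq> c \<and> \<kappa>' j' \<noteq> Suc c" if j': "j' \<in> nbn e n k" for j'
    proof -
      have "j < j'" using nbn_upset[OF kn _ False j'] j(1) by (simp add: N_def i_def)
      then show ?thesis using new N' j' j inj_onD[OF inj', of j j'] by auto
    qed
    then have "?T (?G \<kappa>') = ?G \<kappa>'" using Suc.IH[of \<kappa>'] inj_on_subset[OF inj' N'] kn by auto
    also have "\<dots> = ?G (s \<circ> \<kappa>')"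
      by (rule ghost_cong) (use kn no ss in auto)
    finally show ?thesis .
  qed
  have inj_upd: "inj_on (\<kappa>'(i := b)) (insert i N)" if "inj_on \<kappa>' N" "b \<notin> \<kappa>' ` N" for \<kappa>' b
    using that iN by (auto simp: inj_on_def)
  define p where "p \<kappa>' b = card {j \<in> N. \<kappa>' j < b}" for \<kappa>' :: "nat \<Rightarrow> nat" and b :: nat
  define tm where "tm \<kappa>' b = (if b \<in> \<kappa>' ` N then 0 else tvar ^ p \<kappa>' b * (lvar b * ?G (\<kappa>'(i := b))))"
    for \<kappa>' b
  have tm: "ghost e m n (Suc k) \<kappa>' = sum (tm \<kappa>') {1..m}" for \<kappa>'
  proof -
    have "loc e (\<kappa>'(i := b)) i * ?G (\<kappa>'(i := b)) = tm \<kappa>' b" for b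
    proof -
      have "(\<kappa>'(i := b)) ` N = \<kappa>' ` N" using iN by (intro image_cong) auto
      moreover have "{j \<in> N. (\<kappa>'(i := b)) j < b} = {j \<in> N. \<kappa>' j < b}" using iN by auto
      ultimately show ?thesis
        by (simp add: loc_def tm_def p_def N_def[symmetric] mult.assoc del: fun_upd_apply) simp
    qed
    then show ?thesis by (simp add: i_def)
  qed
  have cc: "c \<noteq> Suc c" "Suc c \<noteq> c" by auto
  have Tp: "?T (tvar ^ a * F) = tvar ^ a * ?T F" for a F
    by (rule dlt_smult) (simp_all add: tvar_def lconst_power[symmetric])
  have split: "sum f {1..m} = sum f ({1..m} - {c, Suc c}) + (f c + f (Suc c))" for f :: "nat \<Rightarrow> laurent"
  proof -
    have "sum f {1..m} = sum f ({1..m} - {c, Suc c}) + sum f {c, Suc c}"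
      using assms by (intro sum.subset_diff) auto
    then show ?thesis by simp
  qed
  have part1: "?T (ghost e m n (Suc k) \<kappa>) = ghost e m n (Suc k) \<kappa>"
    if no: "\<forall>j\<in>N. \<kappa> j \<noteq> c \<and> \<kappa> j \<noteq> Suc c"
  proof -
    have 1: "?T (tm \<kappa> b) = tm \<kappa> b" if "b \<in> {1..m} - {c, Suc c}" for b
    proof (cases "b \<in> \<kappa> ` N")
      case False
      have "?T (?G (\<kappa>(i := b))) = ?G (\<kappa>(i := b))"
        using that no iN by (intro A inj_upd[OF inj False]) auto
      then show ?thesis using that False by (simp add: tm_def Tp)
    qed (simp add: tm_def)
    define H where "H = ?G (\<kappa>(i := Suc c))"
    have nc: "c \<notin> \<kappa> ` N" "Suc c \<notin> \<kappa> ` N" using no by auto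
    have "?T H = ?G (s \<circ> \<kappa>(i := Suc c))"
      unfolding H_def using inj_upd[OF inj nc(2)] ni by (intro B[of _ i]) (simp_all)
    also have "\<dots> = ?G (\<kappa>(i := c))"
      using no ss N' by (intro ghost_cong) (use kn in auto)
    finally have TH: "?G (\<kappa>(i := c)) = ?T H" by simp
    have "{j \<in> N. \<kappa> j < Suc c} = {j \<in> N. \<kappa> j < c}" using no by (auto simp: less_Suc_eq)
    then have pc: "p \<kappa> (Suc c) = p \<kappa> c" by (simp add: p_def)
    \<comment> \<open>When \<open>i\<close> itself receives \<open>c\<close> or
      \<open>c + 1\<close>, it is the latest ghost. With \<open>?T\<close> as \<open>T\<close>, the
      rules give \<open>T (X_{c+1} H) = X_c T H - (t - 1) X_{c+1} H\<close> and
      \<open>T (X_c T H) = t X_{c+1} H\<close>, whose sum is the pair again.\<close>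
    have pair: "tm \<kappa> c + tm \<kappa> (Suc c) = tvar ^ p \<kappa> c * (lvar c * ?T H + lvar (Suc c) * H)"
      using nc by (simp add: tm_def pc TH H_def distrib_left)
    have 2: "?T (tm \<kappa> c + tm \<kappa> (Suc c)) = tm \<kappa> c + tm \<kappa> (Suc c)"
      unfolding pair by (simp add: Tp dlt_a dlt_b) (simp add: algebra_simps)
    have 3: "?T (sum (tm \<kappa>) ({1..m} - {c, Suc c})) = sum (tm \<kappa>) ({1..m} - {c, Suc c})"
      unfolding dlt_sum[OF cc(2)] by (rule sum.cong) (use 1 in auto)
    show ?thesis unfolding tm split[of "tm \<kappa>"] by (subst dlt_add[OF cc(2)]) (simp only: 2 3)
  qed
  have part2: "?T (ghost e m n (Suc k) \<kappa>) = ghost e m n (Suc k) (s \<circ> \<kappa>)"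
    if j: "j \<in> N" "\<kappa> j = Suc c" and new: "\<forall>j'\<in>N. j < j' \<longrightarrow> \<kappa> j' \<noteq> c" for j
  proof -
    let ?\<kappa> = "s \<circ> \<kappa>"
    have s_inj: "inj s" by (metis injI ss(1))
    have inj': "inj_on ?\<kappa> N" using inj s_inj by (simp add: comp_inj_on inj_on_subset)
    have 1: "?T (tm \<kappa> b) = tm ?\<kappa> b" if b: "b \<in> {1..m} - {c, Suc c}" for b
    proof -
      have sb: "s b = b" using b ss by auto
      have mem: "b \<in> ?\<kappa> ` N \<longleftrightarrow> b \<in> \<kappa> ` N"
        using sb s_inj by (auto simp: image_iff) (metis injD)+
      have "s x < b \<longleftrightarrow> x < b" for x
        using b ss(2,3) ss(4)[of x] by (cases "x = c"; cases "x = Suc c") auto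
      then have pb: "p ?\<kappa> b = p \<kappa> b" by (simp add: p_def)
      show ?thesis
      proof (cases "b \<in> \<kappa> ` N")
        case False
        have "?T (?G (\<kappa>(i := b))) = ?G (s \<circ> \<kappa>(i := b))"
          using j new b iN by (intro B[of _ j] inj_upd[OF inj False]) auto
        moreover have "s \<circ> \<kappa>(i := b) = ?\<kappa>(i := b)" using sb by (auto simp: fun_eq_iff)
        moreover have "tm ?\<kappa> b = tvar ^ p \<kappa> b * (lvar b * ?G (?\<kappa>(i := b)))"
          using False unfolding tm_def pb mem by (simp only: if_False)
        moreover have "tm \<kappa> b = tvar ^ p \<kappa> b * (lvar b * ?G (\<kappa>(i := b)))"
          using False by (simp add: tm_def)
        ultimately show ?thesis using b by (simp add: Tp del: fun_upd_comp)
      next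
        case True
        then show ?thesis unfolding tm_def mem by (simp only: if_True dlt_0[OF cc(2)])
      qed
    qed
    \<comment> \<open>Color \<open>c + 1\<close> is blocked by \<open>j\<close> before the exchange,
      color \<open>c\<close> after it; the choices \<open>c\<close> before and \<open>c + 1\<close>
      after correspond to each other.\<close>
    have z1: "tm \<kappa> (Suc c) = 0" using j by (simp add: tm_def image_iff) metis
    have z2: "tm ?\<kappa> c = 0" using j ss by (auto simp: tm_def image_iff)
    have 2: "?T (tm \<kappa> c) = tm ?\<kappa> (Suc c)"
    proof (cases "c \<in> \<kappa> ` N")
      case True
      then have "Suc c \<in> ?\<kappa> ` N" using ss by force
      then show ?thesis using True by (simp add: tm_def)
    next
      case False
      then have nc: "Suc c \<notin> ?\<kappa> ` N" using ss by (auto simp: image_iff)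
      define K where "K = ?G (?\<kappa>(i := Suc c))"
      have "?T K = ?G (s \<circ> ?\<kappa>(i := Suc c))"
        unfolding K_def using inj_upd[OF inj' nc] ni by (intro B[of _ i]) (simp_all)
      also have "s \<circ> ?\<kappa>(i := Suc c) = \<kappa>(i := c)" using ss by (auto simp: fun_eq_iff)
      finally have TK: "?T K = ?G (\<kappa>(i := c))" .
      have sx: "s x < Suc c \<longleftrightarrow> x < c \<or> x = Suc c" if "x \<noteq> c" for x
        using that ss(2,3) ss(4)[of x] by (cases "x = Suc c") auto
      have nk: "\<kappa> l \<noteq> c" if "l \<in> N" for l using False that by blast
      have jl: "\<kappa> l = Suc c \<longleftrightarrow> l = j" if "l \<in> N" for l
        using j inj_onD[OF inj, of l j] that by auto
      have "?\<kappa> l < Suc c \<longleftrightarrow> l = j \<or> \<kappa> l < c" if "l \<in> N" for l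
        using sx[OF nk[OF that]] jl[OF that] by auto
      then have "{l \<in> N. ?\<kappa> l < Suc c} = insert j {l \<in> N. \<kappa> l < c}"
        using j(1) by blast
      \<comment> \<open>After the exchange \<open>j\<close> has color \<open>c\<close>, below the
        color \<open>c + 1\<close> of \<open>i\<close>: one more ascent. Its factor \<open>t\<close>
        is the one in \<open>dl_dlt\<close>, since \<open>T (X_c G) = X_{c+1} dl G\<close> with
        \<open>G\<close> itself of the form \<open>T K\<close>.\<close>
      then have "p ?\<kappa> (Suc c) = Suc (p \<kappa> c)" using j iN by (simp add: p_def)
      then show ?thesis using False nc
        by (simp add: tm_def TK[symmetric] K_def[symmetric] Tp dlt_b mult.assoc mult.left_commute[of "lvar (Suc c)"] del: fun_upd_comp)
    qed
    have 3: "?T (sum (tm \<kappa>) ({1..m} - {c, Suc c})) = sum (tm ?\<kappa>) ({1..m} - {c, Suc c})"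
      unfolding dlt_sum[OF cc(2)] by (rule sum.cong) (use 1 in auto)
    show ?thesis
      unfolding tm split[of "tm \<kappa>"] split[of "tm ?\<kappa>"] z1 z2 add_0_right add_0_left
      by (subst dlt_add[OF cc(2)]) (simp only: 2 3)
  qed
  show ?case unfolding NS using part1 part2 unfolding s_def by blast
qed

end

section \<open>The chromatic polynomial as a word in operators\<close>

text \<open>\<open>tdn m k\<close> is \<open>T'_{m-k} ... T'_{m-1}\<close> with
  \<open>T'_c = dl (Suc c) c\<close>; \<open>dtn\<close> is the same word with each
  \<open>T'_c\<close> replaced by \<open>t\<close> times its inverse.\<close>

primrec tdn :: "nat \<Rightarrow> nat \<Rightarrow> laurent \<Rightarrow> laurent" where
  "tdn m 0 F = F"
| "tdn m (Suc k) F = dl (m - k) (m - Suc k) (tdn m k F)"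

primrec dtn :: "nat \<Rightarrow> nat \<Rightarrow> laurent \<Rightarrow> laurent" where
  "dtn m 0 F = F"
| "dtn m (Suc k) F = dlt (m - k) (m - Suc k) (dtn m k F)"

definition Bop :: "nat \<Rightarrow> nat \<Rightarrow> laurent \<Rightarrow> laurent" where
  "Bop m d F = (\<Sum>k\<in>{d..<m}. tdn m k (lvar m * F))"

text \<open>Repeated \<open>dl_a\<close>: pulling the variable through lowers its index and inverts
  each operator. Ghost exchanges produce the left side, \<open>Bop\<close> is built from the right
  side.\<close>

lemma lvar_dtn: "k < m \<Longrightarrow> lvar (m - k) * dtn m k F = tdn m k (lvar m * F)"
proof (induction k)
  case (Suc k)
  then have "m - k \<noteq> m - Suc k" by simp
  then show ?case using Suc by (simp add: dl_a[symmetric])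
qed simp

lemma lneigh_le: "1 \<le> i \<Longrightarrow> i < n \<Longrightarrow> e \<in> unit_interval_fun n \<Longrightarrow> lneigh e (Suc i) \<le> Suc (lneigh e i)"
  using e_mono[of e n i] by (simp add: lneigh_def)

lemma dyck_lneigh_aux:
  assumes "e \<in> unit_interval_fun n" "1 \<le> i" "i \<le> n + 1" "i \<le> n \<longrightarrow> lneigh e i \<le> b"
  shows "dyck b (map (lneigh e) [i..<n + 1])"
  using assms(3,2,4)
proof (induction i arbitrary: b rule: inc_induct)
  case (step i)
  have "[i..<n + 1] = i # [Suc i..<n + 1]" using step by (simp add: upt_conv_Cons)
  moreover have "dyck (Suc (lneigh e i)) (map (lneigh e) [Suc i..<n + 1])"
    using step lneigh_le[of i n e] assms(1) by (intro step.IH) auto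
  ultimately show ?case using step by simp
qed simp

lemma dyck_lneigh:
  assumes "e \<in> unit_interval_fun n"
  shows "dyck 0 (map (lneigh e) [1..<n + 1])"
  using assms e_bounds[OF assms, of 1] by (intro dyck_lneigh_aux) (auto simp: lneigh_def)

text \<open>In the standard position the latest ghost has color \<open>m\<close> and colors drop by
  one with age. The \<open>d\<close> neighbours of the next vertex occupy the \<open>d\<close>
  largest colors, so this vertex is left with \<open>b \<le> m - d\<close> and gains no ascent. The
  new position differs from the standard one by the exchanges \<open>m - 1, ..., b\<close>, one
  operator each; this gives the summand \<open>k = m - b\<close> of \<open>Bop\<close>.\<close>

lemma ghost_std:
  assumes e: "e \<in> unit_interval_fun n" and m: "1 \<le> m"
    and "k \<le> n" "0 < k \<longrightarrow> lneigh e (Suc (n - k)) \<le> m"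
  shows "ghost e m n k (\<lambda>j. m + j - (n - k)) = foldr (Bop m) (map (lneigh e) [Suc (n - k)..<n + 1]) 1"
  using assms(3,4)
proof (induction k)
  case 0
  then show ?case by simp
next
  case (Suc k)
  define i where "i = n - k"
  define d where "d = lneigh e i"
  define N where "N = nb e i"
  have kn: "k < n" using Suc by simp
  have i: "1 \<le> i" "i \<le> n" "Suc (n - Suc k) = i" "n - Suc k = i - 1" using kn by (auto simp: i_def)
  have dm: "d \<le> m" using Suc.prems i by (simp add: d_def)
  have ei: "0 \<le> e i" "e i < int i" using e_bounds[OF e i(1,2)] by auto
  have N: "N = {i - d..<i}" using ei by (auto simp: N_def nb_def d_def lneigh_def)
  have di: "d < i" using ei i by (auto simp: d_def lneigh_def)
  let ?W = "foldr (Bop m) (map (lneigh e) [Suc i..<n + 1]) 1"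
  have l: "[Suc (i - 1)..<n + 1] = i # [Suc i..<n + 1]" using i by (simp add: upt_conv_Cons)
  let ?std = "\<lambda>j. m + j - (i - 1)"
  have zero: "loc e (?std(i := b)) i = 0" if "m - d < b" "b \<le> m" for b
  proof -
    have "m - (m - b) = b" using that by simp
    \<comment> \<open>The neighbour of \<open>i\<close> whose standard color is
      \<open>b\<close>.\<close>
    define j where "j = i + b - 1 - m"
    have j: "j \<in> N" "j + m = i + b - 1" using that di dm by (auto simp: N j_def)
    then have "?std j = b" using i by auto
    then have "b \<in> ?std ` N" using j by blast
    moreover have "?std ` N = (?std(i := b)) ` N" using N by (intro image_cong) auto
    ultimately show ?thesis by (simp add: loc_def N_def[symmetric] del: fun_upd_apply) simp
  qed
  show ?case
  proof (cases "d < m")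
    case False
    \<comment> \<open>All \<open>m\<close> colors are taken. The bound in the induction hypothesis
      may fail here, but both sides vanish.\<close>
    then have "d = m" using dm by simp
    then have "ghost e m n (Suc k) ?std = 0"
      using zero by (simp add: i_def[symmetric] sum.neutral)
    moreover have "Bop m d F = 0" for F using \<open>d = m\<close> by (simp add: Bop_def)
    ultimately show ?thesis unfolding i(4) l by (simp add: d_def)
  next
    case True
    have IH: "ghost e m n k (\<lambda>j. m + j - i) = ?W"
    proof -
      have "lneigh e (Suc i) \<le> m" if "0 < k"
        using that lneigh_le[of i n e] e i True kn by (simp add: d_def i_def)
      then show ?thesis using Suc.IH kn by (simp add: i_def)
    qed
    have one: "loc e (?std(i := b)) i = lvar b" if "1 \<le> b" "b \<le> m - d" for b
    proof -
      have "b < (?std(i := b)) j" if "j \<in> N" for j using that \<open>b \<le> m - d\<close> True N di by auto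
      then have 1: "b \<notin> (?std(i := b)) ` N" and 2: "{j \<in> N. (?std(i := b)) j < b} = {}" by force+
      have 3: "(?std(i := b)) i = b" by simp
      show ?thesis unfolding loc_def N_def[symmetric] 3 2 using 1 by (simp del: fun_upd_apply)
    qed
    \<comment> \<open>The position with \<open>i\<close> of color \<open>b\<close> and the older
      ghosts filling the other colors downwards from \<open>m\<close>: standard for
      \<open>b = m\<close>, and one exchange of \<open>c\<close> and \<open>c + 1\<close> leads from
      \<open>ks (Suc c)\<close> to \<open>ks c\<close>, with \<open>i\<close> as the latest
      ghost.\<close>
    define ks where "ks b j = (if j = i then b else if m + j - i < b then m + j - i else Suc (m + j - i))" for b j
    have inj: "inj_on (ks b) (insert i N)" for b
    proof (rule inj_onI)
      fix x y assume "x \<in> insert i N" "y \<in> insert i N" "ks b x = ks b y"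
      then show "x = y" using N True di by (auto simp: ks_def split: if_splits)
    qed
    have sub: "nbn e n k \<subseteq> insert i N" using nbn_subset[OF e kn] by (simp add: N_def i_def)
    have ks: "ghost e m n k (ks (m - r)) = dtn m r ?W" if "r < m" for r
      using that
    proof (induction r)
      case 0
      have "ghost e m n k (ks m) = ghost e m n k (\<lambda>j. m + j - i)"
      proof (rule ghost_cong[OF e])
        fix j assume "j \<in> nbn e n k"
        then have "j \<in> insert i N" using sub by blast
        then show "ks m j = m + j - i" using N di True by (auto simp: ks_def)
      qed (use kn in simp)
      then show ?case using IH by simp
    next
      case (Suc r)
      define c where "c = m - Suc r"
      have c: "Suc c = m - r" "1 \<le> c" "Suc c \<le> m" using Suc by (auto simp: c_def)
      have eqs: "(transpose c (Suc c) \<circ> ks (Suc c)) j = ks c j" if "j \<in> nbn e n k" for j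
      proof -
        have "j \<in> insert i N" using that sub by blast
        then show ?thesis using N True di by (auto simp: ks_def transpose_def)
      qed
      have ex: "dlt (Suc c) c (ghost e m n k (ks (Suc c))) = ghost e m n k (transpose c (Suc c) \<circ> ks (Suc c))"
      proof (cases "i \<in> nbn e n k")
        case True
        have "\<forall>j'\<in>nbn e n k. i < j' \<longrightarrow> ks (Suc c) j' \<noteq> c" using sub N by auto
        moreover have "ks (Suc c) i = Suc c" by (simp add: ks_def)
        ultimately show ?thesis
          using ghost_exchange[OF e less_imp_le[OF kn] inj_on_subset[OF inj sub] c(2,3)] True by blast
      next
        case False
        then have "nbn e n k = {}" using nbn_upset[OF e kn, of i] sub N i by (auto simp: i_def) (force)
        then have "dlt (Suc c) c (ghost e m n k (ks (Suc c))) = ghost e m n k (ks (Suc c))"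
          using ghost_exchange[OF e less_imp_le[OF kn] inj_on_subset[OF inj sub] c(2,3)] by blast
        also have "\<dots> = ghost e m n k (transpose c (Suc c) \<circ> ks (Suc c))"
          by (rule ghost_cong[OF e]) (use kn \<open>nbn e n k = {}\<close> in auto)
        finally show ?thesis .
      qed
      also have "\<dots> = ghost e m n k (ks c)"
        by (rule ghost_cong[OF e]) (use kn eqs in auto)
      finally show ?case using Suc c by (simp add: c_def)
    qed
    have "loc e (?std(i := b)) i * ghost e m n k (?std(i := b)) = tdn m (m - b) (lvar m * ?W)"
      if b: "1 \<le> b" "b \<le> m - d" for b
    proof -
      have "ghost e m n k (?std(i := b)) = ghost e m n k (ks (m - (m - b)))"
      proof (rule ghost_cong[OF e])
        fix j assume "j \<in> nbn e n k"
        then have "j \<in> insert i N" using sub by blast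
        then show "(?std(i := b)) j = ks (m - (m - b)) j" using b N di True by (auto simp: ks_def)
      qed (use kn in simp)
      also have "\<dots> = dtn m (m - b) ?W" using b by (intro ks) auto
      finally show ?thesis using lvar_dtn[of "m - b" m ?W] b one[OF b] by simp
    qed
    then have "(\<Sum>b\<in>{1..m - d}. loc e (?std(i := b)) i * ghost e m n k (?std(i := b)))
       = (\<Sum>b\<in>{1..m - d}. tdn m (m - b) (lvar m * ?W))" by simp
    also have "\<dots> = Bop m d ?W" unfolding Bop_def
      by (rule sum.reindex_bij_witness[of _ "\<lambda>k. m - k" "\<lambda>b. m - b"]) (use True in auto)
    also have "(\<Sum>b\<in>{1..m - d}. loc e (?std(i := b)) i * ghost e m n k (?std(i := b)))
       = (\<Sum>b\<in>{1..m}. loc e (?std(i := b)) i * ghost e m n k (?std(i := b)))"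
      by (rule sum.mono_neutral_left) (use zero in auto)
    also have "\<dots> = ghost e m n (Suc k) ?std" by (simp add: i_def)
    finally show ?thesis unfolding i(4) l by (simp add: d_def)
  qed
qed

lemma chr_eq_Bop:
  assumes "e \<in> unit_interval_fun n" "1 \<le> m"
  shows "chr e m n = foldr (Bop m) (map (lneigh e) [1..<n + 1]) 1"
proof -
  have "0 < n \<longrightarrow> lneigh e (Suc (n - n)) \<le> m"
    using e_bounds[OF assms(1), of 1] by (auto simp: lneigh_def simp flip: One_nat_def)
  then show ?thesis using ghost_std[OF assms, of n] ghost_eq_chr[of e m n] by (simp flip: One_nat_def)
qed

text \<open>Before any vertex is colored there are no ghosts that matter, so the invariant half of
  \<open>ghost_exchange\<close> applies to the whole polynomial.\<close>

lemma chr_symmetric: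
  assumes e: "e \<in> unit_interval_fun n" and "1 \<le> m" "\<sigma> permutes {1..m}"
  shows "lsubst (\<lambda>i. lvar (\<sigma> i)) (chr e m n) = chr e m n"
proof (rule swp_invariant_imp_symmetric[OF _ assms(3)])
  fix i assume i: "1 \<le> i" "i < m"
  have "nbn e n n = {}" using e_bounds[OF e, of 1] by (auto simp: nbn_def nb_def)
  then have "dlt (Suc i) i (ghost e m n n id) = ghost e m n n id"
    using ghost_exchange[OF e order_refl, of id i m] i by auto
  then show "swp i (Suc i) (chr e m n) = chr e m n"
    unfolding ghost_eq_chr using dl_eq_tl_iff dl_symmetric_iff swp_commute by (metis n_not_Suc_n)
qed

section \<open>Bernstein operators at \<open>q = 1\<close>\<close>

primrec Tw :: "nat \<Rightarrow> nat \<Rightarrow> laurent \<Rightarrow> laurent" where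
  "Tw l 0 F = F"
| "Tw l (Suc k) F = dl (Suc (l + k)) (Suc (Suc (l + k))) (Tw l k F)"

text \<open>\<open>Yh m c\<close> is the Bernstein operator \<open>Y_{c+1}\<close>: as
  \<open>Tw l k\<close> is \<open>T_{l+k} ... T_{l+1}\<close>, one has
  \<open>Y_1 = \<Pi> T_{m-1} ... T_1\<close> and
  \<open>Y_{c+2} = t T_{c+1}^{-1} Y_{c+1} T_{c+1}^{-1}\<close>. The last relation is the one that
  \<open>X_{c+2}\<close> and \<open>X_{c+1}\<close> satisfy with respect to
  \<open>T'_{c+1}\<close>.\<close>

primrec Yh :: "nat \<Rightarrow> nat \<Rightarrow> laurent \<Rightarrow> laurent" where
  "Yh m 0 F = PQ 1 m (Tw 0 (m - 1) F)"
| "Yh m (Suc c) F = tvar_inv * dlt (Suc c) (Suc (Suc c)) (Yh m c (dlt (Suc c) (Suc (Suc c)) F))"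

lemma Tw_Suc: "Tw l (Suc k) F = Tw (Suc l) k (dl (Suc l) (Suc (Suc l)) F)"
  by (induction k) simp_all

lemma Tw_add: "Tw l k (F + G) = Tw l k F + Tw l k G"
  by (induction k) simp_all

lemma Tw_smult: "(\<And>i. 1 \<le> i \<Longrightarrow> i \<le> l + k \<Longrightarrow> swp i (Suc i) S = S) \<Longrightarrow> Tw l k (S * F) = S * Tw l k F"
  by (induction k) (simp_all add: dl_smult)

lemma Tw_commute: "l + k + 2 \<le> i \<Longrightarrow> dl i (Suc i) (Tw l k F) = Tw l k (dl i (Suc i) F)"
proof (induction k)
  case (Suc k)
  then have "dl i (Suc i) (Tw l (Suc k) F) = dl (Suc (l + k)) (Suc (Suc (l + k))) (dl i (Suc i) (Tw l k F))"
    by (simp add: dl_commute[of i "Suc i" "Suc (l + k)"])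
  then show ?case using Suc by simp
qed simp

lemma Tw_shift: "1 \<le> i \<Longrightarrow> i < k \<Longrightarrow> dl i (Suc i) (Tw 0 k F) = Tw 0 k (dl (Suc i) (Suc (Suc i)) F)"
proof (induction k)
  case (Suc k)
  show ?case
  proof (cases "i = k")
    case True
    then obtain l where k: "k = Suc l" using Suc by (cases k) auto
    have "dl i (Suc i) (Tw 0 (Suc k) F)
       = dl (Suc i) (Suc (Suc i)) (dl i (Suc i) (dl (Suc i) (Suc (Suc i)) (Tw 0 l F)))"
    proof -
      have "dl i (Suc i) (Tw 0 (Suc k) F)
         = dl i (Suc i) (dl (Suc i) (Suc (Suc i)) (dl i (Suc i) (Tw 0 l F)))" using True k by simp
      then show ?thesis using dl_braid[of i "Suc i" "Suc (Suc i)"] by simp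
    qed
    then show ?thesis using True k Tw_commute[of 0 l "Suc i"] by simp
  next
    case False
    then have "dl i (Suc i) (Tw 0 (Suc k) F) = dl (Suc k) (Suc (Suc k)) (dl i (Suc i) (Tw 0 k F))"
      using Suc by (simp add: dl_commute[of i "Suc i" "Suc k"])
    then show ?thesis using Suc False by simp
  qed
qed simp

context
  fixes m :: nat
  assumes m: "1 \<le> m"
begin

lemma Yh_add [simp]: "Yh m c (F + G) = Yh m c F + Yh m c G"
  by (induction c arbitrary: F G) (use m in \<open>simp_all add: Tw_add distrib_left\<close>)

text \<open>Here \<open>q = 1\<close> is essential: without the factor \<open>inverse q\<close> the
  operator \<open>rho\<close> permutes the variables cyclically.\<close>

lemma rho_1_symmetric:
  assumes "\<And>\<sigma>. \<sigma> permutes {1..m} \<Longrightarrow> lsubst (\<lambda>i. lvar (\<sigma> i)) S = S"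
  shows "rho 1 m S = S"
proof -
  define \<sigma> where "\<sigma> j = (if j = m then 1 else if 1 \<le> j \<and> j < m then Suc j else j)" for j
  have "\<sigma> permutes {1..m}"
  proof (rule bij_imp_permutes)
    show "bij_betw \<sigma> {1..m} {1..m}"
      by (rule bij_betw_byWitness[of _ "\<lambda>j. if j = 1 then m else j - 1"])
        (use m in \<open>auto simp: \<sigma>_def\<close>)
  qed (use m in \<open>auto simp: \<sigma>_def\<close>)
  moreover have "rho 1 m S = lsubst (\<lambda>i. lvar (\<sigma> i)) S"
    unfolding rho_def by (rule lsubst_cong) (auto simp: \<sigma>_def)
  ultimately show ?thesis using assms by simp
qed

definition central :: "laurent \<Rightarrow> bool" where
  "central S \<longleftrightarrow> (\<forall>i. 1 \<le> i \<and> i < m \<longrightarrow> swp i (Suc i) S = S) \<and> rho 1 m S = S"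

lemma central_lconst: "central (lconst c)"
  using m by (simp add: central_def)

lemma Yh_smult: "central S \<Longrightarrow> c < m \<Longrightarrow> Yh m c (S * F) = S * Yh m c F"
proof (induction c arbitrary: F)
  case 0
  then have "Tw 0 (m - 1) (S * F) = S * Tw 0 (m - 1) F"
    by (intro Tw_smult) (auto simp: central_def)
  then show ?case using 0 m by (simp add: PQ_def central_def mult.left_commute)
next
  case (Suc c)
  then have "dlt (Suc c) (Suc (Suc c)) (S * G) = S * dlt (Suc c) (Suc (Suc c)) G" for G
    by (intro dlt_smult) (auto simp: central_def)
  then show ?case using Suc by (simp add: mult.left_commute)
qed

lemma Yh_tl [simp]: "c < m \<Longrightarrow> Yh m c (tvar * F) = tvar * Yh m c F" "c < m \<Longrightarrow> Yh m c (tvar_inv * F) = tvar_inv * Yh m c F"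
  unfolding tvar_def tvar_inv_def using Yh_smult[OF central_lconst] by auto

lemma Yh_diff [simp]: "Yh m c (F - G) = Yh m c F - Yh m c G"
  using Yh_add[of c "F - G" G] by simp

lemma Yh_tl1 [simp]: "c < m \<Longrightarrow> Yh m c ((tvar - 1) * F) = (tvar - 1) * Yh m c F"
  by (simp add: left_diff_distrib)

lemma dlt_comm_iff:
  assumes "c < m" "a \<noteq> b"
  shows "dlt a b (Yh m c F) = Yh m c (dlt a b F) \<longleftrightarrow> dl a b (Yh m c F) = Yh m c (dl a b F)"
  using assms by (simp add: dlt_def)

text \<open>Moving \<open>T_c\<close> to the right, \<open>\<Pi>\<close> lowers its index by one and
  \<open>T_{m-1} ... T_1\<close> raises it again.\<close>

lemma Yh_0_comm:
  assumes "2 \<le> c" "c < m"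
  shows "dlt c (Suc c) (Yh m 0 F) = Yh m 0 (dlt c (Suc c) F)"
proof -
  obtain i where c: "c = Suc i" using assms by (cases c) auto
  have "dl c (Suc c) (Yh m 0 F) = PQ 1 m (dl i (Suc i) (Tw 0 (m - 1) F))"
    using assms m c PQ_dl[of 1 m i] by simp
  also have "\<dots> = Yh m 0 (dl c (Suc c) F)"
    using assms c Tw_shift[of i "m - 1" F] by simp
  finally show ?thesis using dlt_comm_iff[of 0] m by simp
qed

lemma Yh_comm:
  assumes "1 \<le> c" "c < m" "j < m" "c \<noteq> j" "c \<noteq> Suc j"
  shows "dlt c (Suc c) (Yh m j F) = Yh m j (dlt c (Suc c) F)"
  using assms
proof (induction j arbitrary: c F rule: less_induct)
  case (less j)
  show ?case
  proof (cases j)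
    case 0
    then show ?thesis using Yh_0_comm[of c F] less by simp
  next
    case (Suc i)
    let ?b = "dlt j (Suc j)" and ?a = "dlt c (Suc c)"
    have Y: "Yh m j F = tvar_inv * ?b (Yh m i (?b F))" for F using Suc by simp
    show ?thesis
    proof (cases "c = i")
      case False
      have "?a (?b G) = ?b (?a G)" for G using less False Suc by (intro dlt_commute) auto
      moreover have "?a (Yh m i G) = Yh m i (?a G)" for G using less False Suc by (intro less.IH) auto
      ultimately show ?thesis by (simp add: Y)
    next
      case True
      \<comment> \<open>The case \<open>c = j - 1\<close>: unfolding twice exposes
        \<open>Yh m h\<close>, and two braid moves carry \<open>?a\<close> across because
        \<open>T_j\<close> commutes with \<open>Yh m h\<close>.\<close>
      then obtain h where h: "i = Suc h" using less by (cases i) auto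
      have Yi: "Yh m i F = tvar_inv * ?a (Yh m h (?a F))" for F using h True by simp
      have br: "?a (?b (?a G)) = ?b (?a (?b G))" for G
        using dlt_braid[of c "Suc c" "Suc (Suc c)" G] Suc True by simp
      have hb: "?b (Yh m h G) = Yh m h (?b G)" for G
        using less Suc h by (intro less.IH) auto
      have hm: "h < m" "i < m" using less Suc h by auto
      have "?a (Yh m j F) = tvar_inv * (tvar_inv * ?a (?b (?a (Yh m h (?a (?b F))))))"
        using hm by (simp add: Y Yi del: Yh.simps)
      also have "\<dots> = tvar_inv * (tvar_inv * ?b (?a (Yh m h (?b (?a (?b F))))))"
        by (simp add: br hb)
      also have "\<dots> = tvar_inv * (tvar_inv * ?b (?a (Yh m h (?a (?b (?a F))))))"
        by (simp add: br)
      also have "\<dots> = Yh m j (?a F)"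
        using hm by (simp add: Y Yi del: Yh.simps)
      finally show ?thesis .
    qed
  qed
qed

lemma PQ_Tw: "k + 1 < m \<Longrightarrow> Tw 1 k (PQ 1 m F) = PQ 1 m (Tw 0 k F)"
  using m by (induction k) (simp_all add: PQ_dl plus_1_eq_Suc)

lemma Tw_Tw: "k + 1 < m \<Longrightarrow> Tw 0 (m - 1) (Tw 1 k F) = Tw 0 k (Tw 0 (m - 1) F)"
  by (induction k) (simp_all add: Tw_shift[symmetric] plus_1_eq_Suc)

text \<open>With \<open>W = T_{m-1} ... T_2\<close> one has \<open>Y_1 = \<Pi> W T_1\<close> and
  \<open>Y_2 = t T_1^{-1} \<Pi> W\<close>, so both products are \<open>t (\<Pi> W)^2\<close> once
  \<open>T_1\<close> commutes with \<open>(\<Pi> W)^2\<close>. That is \<open>key\<close>, which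
  rests on \<open>\<Pi>^2 T_{m-1} = T_1 \<Pi>^2\<close>.\<close>

lemma Yh_0_1_comm:
  assumes m2: "2 \<le> m"
  shows "Yh m 0 (Yh m 1 F) = Yh m 1 (Yh m 0 F)"
proof -
  obtain k where k: "m - 1 = Suc k" using assms by (cases "m - 1") auto
  then have km: "k + 1 < m" "Suc k = m - 1" "m - 1 = Suc k" by auto
  let ?T = "dl 1 2" and ?D = "dlt 1 2" and ?P = "PQ 1 m" and ?W = "Tw 1 k"
  have C: "Tw 0 (m - 1) F = ?W (?T F)" for F
    using Tw_Suc[of 0 k F] unfolding k by (simp only: One_nat_def[symmetric] Suc_1)
  have WS: "?W (tvar * F) = tvar * ?W F" for F by (rule Tw_smult) simp
  have Y0: "Yh m 0 F = ?P (?W (?T F))" for F by (simp add: C)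
  have Y1: "Yh m 1 F = ?D (?P (?W F))" for F
  proof -
    have "Yh m 1 F = tvar_inv * ?D (Yh m 0 (?D F))" by (simp add: One_nat_def numeral_2_eq_2)
    then show ?thesis using m by (simp add: C WS)
  qed
  have lhs: "Yh m 0 (Yh m 1 F) = tvar * ?P (?W (?P (?W F)))" for F
    using m by (simp only: Y0 Y1) (simp add: WS)
  have key: "?T (?P (?W (?P (?W F)))) = ?P (?W (?P (?W (?T F))))" for F
  proof -
    have PP: "?P (?W (?P G)) = ?P (?P (Tw 0 k G))" for G using PQ_Tw[OF km(1)] by simp
    have "?T (?P (?P (Tw 0 k (?W F)))) = ?P (?P (dl (m - 1) m (Tw 0 k (?W F))))"
      using PQ_PQ_dl[of 1 m] m2 m by simp
    also have "dl (m - 1) m (Tw 0 k (?W F)) = Tw 0 (m - 1) (?W F)"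
    proof -
      have "Suc (m - 1) = m" using m by simp
      then show ?thesis using k by simp
    qed
    also have "\<dots> = Tw 0 k (?W (?T F))" using Tw_Tw[OF km(1)] C by simp
    finally show ?thesis by (simp only: PP)
  qed
  have "Yh m 1 (Yh m 0 F) = ?D (?P (?W (?P (?W (?T F)))))" by (simp only: Y0 Y1)
  also have "\<dots> = ?D (?T (?P (?W (?P (?W F)))))" by (simp only: key)
  also have "\<dots> = Yh m 0 (Yh m 1 F)" unfolding lhs by simp
  finally show ?thesis by simp
qed

lemma Yh_Yh_lt:
  assumes "i < j" "j < m"
  shows "Yh m i (Yh m j F) = Yh m j (Yh m i F)"
  using assms
proof (induction i arbitrary: F j)
  case 0
  then show ?case
  proof (induction j arbitrary: F)
    case (Suc j)
    show ?case
    proof (cases "j = 0")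
      case True
      then show ?thesis using Yh_0_1_comm[of F] Suc by (simp add: One_nat_def del: Yh.simps)
    next
      case False
      have "Yh m 0 (dlt (Suc j) (Suc (Suc j)) G) = dlt (Suc j) (Suc (Suc j)) (Yh m 0 G)" for G
        using Suc False by (intro Yh_comm[symmetric]) auto
      then show ?thesis using Suc False by (simp add: Yh.simps(2) del: Yh.simps(1))
    qed
  qed simp
next
  case (Suc i)
  have "dlt (Suc i) (Suc (Suc i)) (Yh m j G) = Yh m j (dlt (Suc i) (Suc (Suc i)) G)" for G
    using Suc by (intro Yh_comm) auto
  then show ?case using Suc by simp
qed

lemma Yh_Yh: "i < m \<Longrightarrow> j < m \<Longrightarrow> Yh m i (Yh m j F) = Yh m j (Yh m i F)"
  using Yh_Yh_lt[of i j F] Yh_Yh_lt[of j i F] by (cases i j rule: linorder_cases) auto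

text \<open>The factors to the right of \<open>\<Pi>\<close> cancel one by one. For
  \<open>c = m - 1\<close> none is left, and \<open>Y_m\<close> is the last summand of
  \<open>Aop\<close> for \<open>d = 0\<close>.\<close>

lemma Yh_up: "c < m \<Longrightarrow> Yh m c F = up c (PQ 1 m (Tw c (m - 1 - c) F))"
proof (induction c arbitrary: F)
  case (Suc c)
  have e: "m - 1 - c = Suc (m - 1 - Suc c)" using Suc by simp
  have w: "Tw (Suc c) (m - 1 - Suc c) (tvar * G) = tvar * Tw (Suc c) (m - 1 - Suc c) G" for G
    by (rule Tw_smult) simp
  have u: "up c (tvar * G) = tvar * up c G" for G by (simp add: tvar_def)
  have "Yh m (Suc c) F = tvar_inv * dlt (Suc c) (Suc (Suc c)) (up c (PQ 1 m (Tw c (m - 1 - c) (dlt (Suc c) (Suc (Suc c)) F))))"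
    using Suc by simp
  also have "Tw c (m - 1 - c) (dlt (Suc c) (Suc (Suc c)) F) = tvar * Tw (Suc c) (m - 1 - Suc c) F"
    unfolding e Tw_Suc by (simp only: dl_dlt[OF n_not_Suc_n] w)
  finally show ?case using m by (simp add: u del: Yh.simps)
qed simp

section \<open>Evaluation at the Bernstein operators\<close>

text \<open>The monomial in the \<open>Y_j\<close> applied to \<open>1\<close>. Some order of the
  factors has to be fixed; \<open>Yh_Yh\<close> allows to change it in \<open>ymon_var\<close>.
  Since \<open>nat\<close> truncates negative exponents, \<open>phi\<close> is meant for
  polynomials.\<close>

definition ymon :: "(nat \<Rightarrow>\<^sub>0 int) \<Rightarrow> laurent" where
  "ymon \<mu> = foldr (\<lambda>j. Yh m (j - 1) ^^ nat (lookup \<mu> j)) [1..<m + 1] 1"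

definition phi :: "laurent \<Rightarrow> laurent" where
  "phi f = (\<Sum>\<mu>\<in>keys f. lconst (lookup f \<mu>) * ymon \<mu>)"

lemma phi_superset:
  assumes "finite S" "keys f \<subseteq> S"
  shows "phi f = (\<Sum>\<mu>\<in>S. lconst (lookup f \<mu>) * ymon \<mu>)"
  unfolding phi_def using assms
  by (intro sum.mono_neutral_left) (auto simp: in_keys_iff)

lemma phi_add [simp]: "phi (f + g) = phi f + phi g"
proof -
  let ?S = "keys f \<union> keys g"
  have "keys (f + g) \<subseteq> ?S" by (rule keys_add)
  then show ?thesis
    by (simp add: phi_superset[of ?S] lookup_add lconst_add distrib_right sum.distrib)
qed

lemma phi_lconst_mult [simp]: "phi (lconst c * f) = lconst c * phi f"
proof -
  have "keys (lconst c * f) \<subseteq> keys f"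
    by (auto simp: in_keys_iff lookup_lconst_mult)
  then show ?thesis
    by (subst (1 2) phi_superset[of "keys f"])
      (auto simp: lookup_lconst_mult lconst_mult sum_distrib_left mult.assoc)
qed

lemma phi_0 [simp]: "phi 0 = 0"
  by (simp add: phi_def)

lemma phi_tl [simp]: "phi (tvar * f) = tvar * phi f"
  by (simp add: tvar_def)

lemma phi_diff [simp]: "phi (f - g) = phi f - phi g"
  using phi_add[of "f - g" g] by simp

lemma phi_tl1 [simp]: "phi ((tvar - 1) * f) = (tvar - 1) * phi f"
  by (simp add: left_diff_distrib)

lemma phi_sum: "phi (sum f A) = (\<Sum>x\<in>A. phi (f x))"
  by (induction A rule: infinite_finite_induct) simp_all

lemma phi_single: "phi (Poly_Mapping.single \<mu> c) = lconst c * ymon \<mu>"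
  by (subst phi_superset[of "{\<mu>}"]) auto

lemma phi_1 [simp]: "phi 1 = 1"
proof -
  have "foldr (\<lambda>j. Yh m (j - 1) ^^ nat (lookup 0 j)) xs 1 = 1" for xs by (induction xs) auto
  then have "ymon 0 = 1" by (simp add: ymon_def)
  then show ?thesis using phi_single[of 0 1] by simp
qed

lemma phi_lconst [simp]: "phi (lconst c) = lconst c"
  using phi_lconst_mult[of c 1] by (simp del: phi_lconst_mult)

lemma ymon_var:
  assumes "pexp m \<mu>" "1 \<le> j" "j \<le> m"
  shows "ymon (Poly_Mapping.single j 1 + \<mu>) = Yh m (j - 1) (ymon \<mu>)"
proof -
  have comm: "(Yh m x ^^ k) (Yh m y F) = Yh m y ((Yh m x ^^ k) F)" if "x < m" "y < m" for x y k F
    using that by (induction k) (simp_all add: Yh_Yh)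
  let ?f = "\<lambda>\<mu>. foldr (\<lambda>j. Yh m (j - 1) ^^ nat (lookup \<mu> j))"
  have n: "nat (lookup (Poly_Mapping.single j 1 + \<mu>) x) = (if x = j then Suc (nat (lookup \<mu> x)) else nat (lookup \<mu> x))" for x
    using assms by (auto simp: lookup_add lookup_single when_def pexp_def nat_add_distrib)
  have pre: "?f (Poly_Mapping.single j 1 + \<mu>) xs 1 = (if j \<in> set xs then Yh m (j - 1) (?f \<mu> xs 1) else ?f \<mu> xs 1)"
    if "distinct xs" "set xs \<subseteq> {1..m}" for xs
    using that
  proof (induction xs)
    case (Cons x xs)
    have "x - 1 < m" "j - 1 < m" using Cons assms by auto
    then show ?case using Cons by (auto simp: n comm)
  qed simp
  have "set [1..<m + 1] \<subseteq> {1..m}" by auto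
  from pre[OF distinct_upt this] have "?f (Poly_Mapping.single j 1 + \<mu>) [1..<m + 1] 1 = Yh m (j - 1) (?f \<mu> [1..<m + 1] 1)"
    using assms by auto
  then show ?thesis unfolding ymon_def .
qed

lemma phi_var:
  assumes "f \<in> hpoly UNIV m d" "1 \<le> j" "j \<le> m"
  shows "phi (lvar j * f) = Yh m (j - 1) (phi f)"
proof -
  have jm: "j - 1 < m" using assms by simp
  have Y0: "Yh m (j - 1) 0 = 0" using Yh_smult[OF central_lconst[of 0] jm, of 0] by simp
  have "phi (lvar j * (\<Sum>\<mu>\<in>S. Poly_Mapping.single \<mu> (lookup f \<mu>)))
     = Yh m (j - 1) (phi (\<Sum>\<mu>\<in>S. Poly_Mapping.single \<mu> (lookup f \<mu>)))"
    if "finite S" "S \<subseteq> keys f" for S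
    using that
  proof (induction S)
    case (insert \<mu> S)
    have "pexp m \<mu>" using insert assms by (auto simp: hpoly_iff)
    then have "phi (lvar j * Poly_Mapping.single \<mu> c) = Yh m (j - 1) (phi (Poly_Mapping.single \<mu> c))" for c
      using ymon_var[of \<mu> j] assms Yh_smult[OF central_lconst jm]
      by (simp add: lvar_single phi_single)
    then show ?case using insert by (simp add: distrib_left)
  qed (simp add: Y0)
  from this[OF finite_keys[of f] order_refl] show ?thesis unfolding poly_mapping_sum_singles[symmetric] by simp
qed

text \<open>The indices of \<open>dl\<close> are reversed because
  \<open>Y_{c+1} = t T_c^{-1} Y_c T_c^{-1}\<close>, while the variables satisfy
  \<open>X_{c+1} = t^{-1} T_c X_c T_c\<close>: it is with respect to \<open>T'_c\<close> that they
  behave like the \<open>Y_j\<close>.\<close>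

lemma phi_dl:
  assumes "f \<in> hpoly UNIV m d" "1 \<le> c" "c < m"
  shows "phi (dl (Suc c) c f) = dl c (Suc c) (phi f)"
  using assms(1)
proof (induction d f rule: hpoly_induct)
  case (var d j F)
  obtain b where b: "Suc b = c" "b < m" "c - 1 = b" using assms by (cases c) auto
  have n: "Suc c \<noteq> c" "c \<noteq> Suc c" by auto
  have F': "dlt (Suc c) c F \<in> hpoly UNIV m d" "dl (Suc c) c F \<in> hpoly UNIV m d"
    using var assms by (auto intro!: hpU)
  have t: "phi (dlt (Suc c) c F) = dlt c (Suc c) (phi F)"
    using var.IH by (simp add: dlt_def)
  have Yc: "Yh m c G = tvar_inv * dlt c (Suc c) (Yh m b (dlt c (Suc c) G))" for G
    using Yh.simps(2)[of m b G] unfolding b(1) .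
  consider "j = Suc c" | "j = c" | "j \<noteq> c" "j \<noteq> Suc c" by blast
  then show ?case
  proof cases
    case 1
    have "phi (dl (Suc c) c (lvar (Suc c) * F)) = Yh m b (dlt c (Suc c) (phi F))"
      using assms b phi_var[OF F'(1), of c] by (simp add: dl_a t)
    also have "\<dots> = dl c (Suc c) (Yh m c (phi F))" unfolding Yc by simp
    also have "\<dots> = dl c (Suc c) (phi (lvar (Suc c) * F))" using phi_var[OF var(3), of "Suc c"] assms by simp
    finally show ?thesis using 1 by simp
  next
    case 2
    have "phi (dl (Suc c) c (lvar c * F)) = Yh m c (dl c (Suc c) (phi F)) + (tvar - 1) * Yh m b (phi F)"
      using assms b phi_var[OF F'(2), of "Suc c"] phi_var[OF var(3), of c] var.IH by (simp add: dl_b)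
    also have "Yh m c (dl c (Suc c) (phi F)) = dlt c (Suc c) (Yh m b (phi F))" unfolding Yc using b by simp
    also have "dlt c (Suc c) (Yh m b (phi F)) + (tvar - 1) * Yh m b (phi F) = dl c (Suc c) (Yh m b (phi F))"
      by (simp add: dlt_def)
    also have "\<dots> = dl c (Suc c) (phi (lvar c * F))" using phi_var[OF var(3), of c] assms b by simp
    finally show ?thesis using 2 by simp
  next
    case 3
    have jm: "j - 1 < m" "c \<noteq> j - 1" "c \<noteq> Suc (j - 1)" using var 3 by auto
    then have "dl c (Suc c) (Yh m (j - 1) (phi F)) = Yh m (j - 1) (dl c (Suc c) (phi F))"
      using Yh_comm[of c "j - 1" "phi F"] assms dlt_comm_iff[of "j - 1" c "Suc c" "phi F"] by simp
    then show ?thesis using 3 n var phi_var[OF F'(2), of j] phi_var[OF var(3), of j] by simp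
  qed
qed simp_all

primrec xdn :: "nat \<Rightarrow> laurent \<Rightarrow> laurent" where
  "xdn 0 F = F"
| "xdn (Suc k) F = dl (m - Suc k) (m - k) (xdn k F)"

lemma phi_tdn: "f \<in> hpoly UNIV m d \<Longrightarrow> k < m \<Longrightarrow> phi (tdn m k f) = xdn k (phi f) \<and> tdn m k f \<in> hpoly UNIV m d"
proof (induction k)
  case (Suc k)
  have e: "m - k = Suc (m - Suc k)" using Suc by simp
  have H: "tdn m k f \<in> hpoly UNIV m d" "phi (tdn m k f) = xdn k (phi f)" using Suc by auto
  have "phi (tdn m (Suc k) f) = xdn (Suc k) (phi f)"
    using phi_dl[OF H(1), of "m - Suc k"] Suc H by (simp add: e)
  moreover have "tdn m (Suc k) f \<in> hpoly UNIV m d"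
    using H(1) Suc by (auto intro!: hpU)
  ultimately show ?case by blast
qed simp

text \<open>Each \<open>T_j\<close> on the left meets \<open>t T_j^{-1}\<close> as the outermost
  factor of \<open>up\<close> and leaves a scalar \<open>t\<close>.\<close>

lemma xdn_up: "k < m \<Longrightarrow> xdn k (up (m - 1) F) = tvar ^ k * up (m - 1 - k) F"
proof (induction k)
  case (Suc k)
  let ?c = "m - Suc k"
  have e: "m - 1 - k = Suc (m - 1 - Suc k)" "m - k = Suc ?c" "Suc (m - 1 - Suc k) = ?c" using Suc by auto
  have u: "up (m - 1 - k) F = dlt ?c (Suc ?c) (up (m - 1 - Suc k) F)"
    by (subst e(1), subst up.simps(2), simp only: e(3))
  have p: "dl ?c (Suc ?c) (tvar ^ k * G) = tvar ^ k * dl ?c (Suc ?c) G" for G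
    by (rule dl_smult) (simp_all add: tvar_def lconst_power[symmetric])
  have IH: "xdn k (up (m - 1) F) = tvar ^ k * up (m - 1 - k) F" using Suc by simp
  show ?case unfolding xdn.simps IH e(2) p u by (simp add: mult.left_commute mult.assoc)
qed simp

text \<open>\<open>X_m\<close> becomes \<open>Y_m\<close>, and the operators in front cancel part of
  it; the powers of \<open>t\<close> that arise are the weights in \<open>Aop\<close>, after
  \<open>k\<close> is replaced by \<open>m - 1 - k\<close>.\<close>

lemma phi_Bop:
  assumes f: "f \<in> hpoly UNIV m d"
  shows "phi (Bop m c f) = Aop 1 m c (phi f) \<and> Bop m c f \<in> hpoly UNIV m (Suc d)"
proof
  have L: "lvar m * f \<in> hpoly UNIV m (Suc d)" using f m by (intro hpoly_lvar_mult) auto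
  have v: "phi (lvar m * f) = up (m - 1) (PQ 1 m (phi f))"
    using phi_var[OF f, of m] m Yh_up[of "m - 1"] by simp
  have "phi (Bop m c f) = (\<Sum>k\<in>{c..<m}. tvar ^ k * up (m - 1 - k) (PQ 1 m (phi f)))"
    unfolding Bop_def phi_sum using phi_tdn[OF L] xdn_up by (intro sum.cong) (auto simp: v)
  also have "\<dots> = Aop 1 m c (phi f)"
  proof (cases "c < m")
    case True
    have "(\<Sum>k\<in>{c..<m}. tvar ^ k * up (m - 1 - k) (PQ 1 m (phi f)))
       = (\<Sum>k<m - c. tvar ^ (m - 1 - k) * up k (PQ 1 m (phi f)))"
      by (rule sum.reindex_bij_witness[of _ "\<lambda>k. m - 1 - k" "\<lambda>k. m - 1 - k"]) auto
    then show ?thesis using True by (simp add: Aop_def)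
  qed (simp add: Aop_def)
  finally show "phi (Bop m c f) = Aop 1 m c (phi f)" .
  show "Bop m c f \<in> hpoly UNIV m (Suc d)"
    unfolding Bop_def using phi_tdn[OF L]
    by (intro hpoly_sum[OF one_neq_zero coeff_module_UNIV]) auto
qed

lemma phi_Bop_word: "phi (foldr (Bop m) ds 1) = Wop 1 m ds \<and> foldr (Bop m) ds 1 \<in> hpoly UNIV m (length ds)"
proof (induction ds)
  case Nil
  then show ?case using hpoly_lconst[of 1 UNIV m] by (simp add: Wop_def)
next
  case (Cons d ds)
  then show ?case using phi_Bop[of "foldr (Bop m) ds 1" "length ds" d] by (simp add: Wop_def)
qed

text \<open>\<open>f(Y) g(Y) 1\<close> is \<open>f(Y)\<close> applied to \<open>phi g\<close>, and
  the \<open>Y_j\<close> are linear over this central factor.\<close>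

lemma phi_mult:
  assumes "f \<in> hpoly UNIV m d" "g \<in> hpoly UNIV m d'" "central (phi g)"
  shows "phi (f * g) = phi f * phi g \<and> f * g \<in> hpoly UNIV m (d + d')"
  using assms(1)
proof (induction d f rule: hpoly_induct)
  case (zero d)
  then show ?case by (simp add: hpoly_0[OF one_neq_zero coeff_module_UNIV])
next
  case (const c)
  then show ?case using hpoly_lconst_mult[OF assms(2)] by simp
next
  case (add d F G)
  then show ?case by (simp add: distrib_right hpoly_add')
next
  case (var d j F)
  then have "phi (lvar j * (F * g)) = Yh m (j - 1) (phi g * phi F)"
    using phi_var[of "F * g" "d + d'" j] by (simp add: mult.commute)
  also have "\<dots> = phi g * Yh m (j - 1) (phi F)" using var assms by (intro Yh_smult) auto
  finally have c1: "phi (lvar j * (F * g)) = phi g * Yh m (j - 1) (phi F)" .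
  have pv: "phi (lvar j * F) = Yh m (j - 1) (phi F)" using var by (intro phi_var) auto
  have as: "lvar j * F * g = lvar j * (F * g)" by (simp add: mult.assoc)
  have "phi (lvar j * F * g) = phi (lvar j * F) * phi g" unfolding as c1 pv by (rule mult.commute)
  moreover have "lvar j * F * g \<in> hpoly UNIV m (Suc d + d')"
    unfolding as using var hpoly_lvar_mult[of "F * g" UNIV m "d + d'" j] by simp
  ultimately show ?case by blast
qed simp_all

end

section \<open>Symmetric polynomials\<close>

lemma lookup_single_mult: "lookup (Poly_Mapping.single \<nu> c * F) \<mu> = c * lookup F (\<mu> - \<nu>)" for F :: laurent
proof (induction F rule: poly_mapping_single_induct)
  case (single \<kappa> d)
  have "\<nu> + \<kappa> = \<mu> \<longleftrightarrow> \<kappa> = \<mu> - \<nu>" by (auto simp: algebra_simps)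
  then show ?case by (simp add: mult_single lookup_single when_def)
next
  case (add x y)
  then show ?case by (simp add: distrib_left lookup_add)
qed

definition symh :: "nat \<Rightarrow> nat \<Rightarrow> laurent set" where
  "symh m d = {F \<in> hpoly UNIV m d. \<forall>i. 1 \<le> i \<and> i < m \<longrightarrow> swp i (Suc i) F = F}"

abbreviation texp :: "nat \<Rightarrow> nat \<Rightarrow> (nat \<Rightarrow>\<^sub>0 int) \<Rightarrow> (nat \<Rightarrow>\<^sub>0 int)" where
  "texp a b \<equiv> Poly_Mapping.map_key (transpose a b)"

lemma lookup_texp: "lookup (texp a b \<mu>) i = lookup \<mu> (transpose a b i)"
  by (simp add: map_key.rep_eq)

lemma texp_texp [simp]: "texp a b (texp a b \<mu>) = \<mu>"
  by (rule poly_mapping_eqI) (simp add: lookup_texp)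

lemma lookup_swp: "lookup (swp a b F) (texp a b \<mu>) = lookup F \<mu>"
proof (induction F arbitrary: \<mu> rule: laurent_induct)
  case (const c)
  have z: "texp a b 0 = 0" by (rule poly_mapping_eqI) (simp add: lookup_texp)
  then have "0 = texp a b \<mu> \<longleftrightarrow> 0 = \<mu>" by (metis texp_texp)
  then have "lookup (lconst c) (texp a b \<mu>) = lookup (lconst c) \<mu>"
    by (simp add: lconst_def lookup_single when_def)
  then show ?case by simp
next
  case (add F G)
  then show ?case by (simp add: lookup_add)
next
  case (var j F)
  have "texp a b (\<mu> - Poly_Mapping.single j 1) = texp a b \<mu> - Poly_Mapping.single (transpose a b j) 1" for \<mu>
  proof (rule poly_mapping_eqI)
    fix i
    show "lookup (texp a b (\<mu> - Poly_Mapping.single j 1)) i = lookup (texp a b \<mu> - Poly_Mapping.single (transpose a b j) 1) i"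
      by (cases "transpose a b i = j") (auto simp: lookup_texp lookup_minus lookup_single when_def)
  qed
  then have s: "lookup (swp a b (lvar j * F)) (texp a b \<mu>) = lookup (swp a b F) (texp a b (\<mu> - Poly_Mapping.single j 1))" for \<mu>
    by (simp add: lookup_lvar_mult)
  show ?case unfolding s lookup_lvar_mult by (metis add_diff_cancel_right')
qed

lemma swp_eq_iff: "swp a b F = F \<longleftrightarrow> (\<forall>\<mu>. lookup F (texp a b \<mu>) = lookup F \<mu>)"
proof
  assume "swp a b F = F"
  then show "\<forall>\<mu>. lookup F (texp a b \<mu>) = lookup F \<mu>" using lookup_swp by metis
next
  assume a: "\<forall>\<mu>. lookup F (texp a b \<mu>) = lookup F \<mu>"
  show "swp a b F = F"
    by (rule poly_mapping_eqI) (use a lookup_swp[of a b F] in \<open>metis texp_texp\<close>)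
qed

lemmas hpU_basic = hpoly_0[OF one_neq_zero coeff_module_UNIV] hpoly_add[OF one_neq_zero coeff_module_UNIV]
  hpoly_diff[OF one_neq_zero coeff_module_UNIV] hpoly_sum[OF one_neq_zero coeff_module_UNIV]

lemma hpoly_mult:
  assumes "F \<in> hpoly UNIV m d" "G \<in> hpoly UNIV m d'"
  shows "F * G \<in> hpoly UNIV m (d + d')"
  using assms(1)
proof (induction d F rule: hpoly_induct)
  case (const c)
  then show ?case using hpoly_lconst_mult[OF assms(2)] by simp
next
  case (add d F H)
  then show ?case by (simp add: distrib_right hpU_basic)
next
  case (var d j F)
  then show ?case using hpoly_lvar_mult by (simp add: mult.assoc)
qed (simp_all add: hpU_basic)

lemma symh_hpoly: "F \<in> symh m d \<Longrightarrow> F \<in> hpoly UNIV m d"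
  by (simp add: symh_def)

lemma symh_0: "0 \<in> symh m d"
  by (simp add: symh_def hpU_basic)

lemma symh_1: "1 \<in> symh m 0"
  using hpoly_lconst[of 1 UNIV m] by (simp add: symh_def)

lemma symh_add: "F \<in> symh m d \<Longrightarrow> G \<in> symh m d \<Longrightarrow> F + G \<in> symh m d"
  by (simp add: symh_def hpU_basic)

lemma symh_diff: "F \<in> symh m d \<Longrightarrow> G \<in> symh m d \<Longrightarrow> F - G \<in> symh m d"
  by (simp add: symh_def hpU_basic)

lemma symh_mult: "F \<in> symh m d \<Longrightarrow> G \<in> symh m d' \<Longrightarrow> F * G \<in> symh m (d + d')"
  by (simp add: symh_def hpoly_mult)

lemma symh_lconst_mult: "F \<in> symh m d \<Longrightarrow> lconst c * F \<in> symh m d"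
  by (simp add: symh_def hpoly_lconst_mult)

lemma symh_iff_sym_poly_ring: "F \<in> symh m d \<longleftrightarrow> F \<in> sym_poly_ring m \<and> homogeneous d F"
proof
  assume F: "F \<in> symh m d"
  then show "F \<in> sym_poly_ring m \<and> homogeneous d F"
    using hpoly_symmetric_in_ring[OF symh_hpoly[OF F]] swp_invariant_imp_symmetric[of m F]
    by (auto simp: symh_def hpoly_def)
next
  assume F: "F \<in> sym_poly_ring m \<and> homogeneous d F"
  have "swp i (Suc i) F = F" if "1 \<le> i" "i < m" for i
  proof -
    have "transpose i (Suc i) permutes {1..m}" using that by (intro permutes_swap_id) auto
    then show ?thesis using F by (simp add: sym_poly_ring_def swp_def)
  qed
  then show "F \<in> symh m d" using F by (simp add: symh_def hpoly_def sym_poly_ring_def)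
qed

lemma proj_hpoly:
  assumes "F \<in> hpoly UNIV m d" "k \<le> m"
  shows "proj k F \<in> hpoly UNIV k d"
  unfolding hpoly_iff
proof (intro conjI ballI)
  fix \<mu> assume "\<mu> \<in> keys (proj k F)"
  then have "keys \<mu> \<subseteq> {..k}" "\<mu> \<in> keys F"
    using lookup_proj[OF assms(1), of k \<mu>] by (auto simp: in_keys_iff split: if_splits)
  then show "pexp k \<mu>" "mdeg \<mu> = int d" using assms(1) by (auto simp: hpoly_iff pexp_def subset_iff)
qed simp

lemma proj_symh:
  assumes "F \<in> symh m d" "k \<le> m"
  shows "proj k F \<in> symh k d"
proof -
  have "swp i (Suc i) (proj k F) = proj k F" if i: "1 \<le> i" "i < k" for i
    unfolding swp_eq_iff
  proof
    fix \<mu>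
    have a: "keys (texp i (Suc i) \<mu>) \<subseteq> {..k} \<Longrightarrow> keys \<mu> \<subseteq> {..k}" for \<mu>
    proof
      fix x assume "keys (texp i (Suc i) \<mu>) \<subseteq> {..k}" "x \<in> keys \<mu>"
      then have "transpose i (Suc i) x \<le> k" by (auto simp: in_keys_iff lookup_texp subset_iff)
      then show "x \<in> {..k}" using i by (auto simp: transpose_def split: if_splits)
    qed
    have "keys (texp i (Suc i) \<mu>) \<subseteq> {..k} \<longleftrightarrow> keys \<mu> \<subseteq> {..k}"
      using a[of \<mu>] a[of "texp i (Suc i) \<mu>"] by auto
    moreover have "lookup F (texp i (Suc i) \<mu>) = lookup F \<mu>"
      using assms i swp_eq_iff[of i "Suc i" F] by (simp add: symh_def)
    ultimately show "lookup (proj k F) (texp i (Suc i) \<mu>) = lookup (proj k F) \<mu>"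
      by (simp add: lookup_proj[OF symh_hpoly[OF assms(1)]])
  qed
  then show ?thesis using proj_hpoly[OF symh_hpoly[OF assms(1)] assms(2)] by (simp add: symh_def)
qed

lemma proj_add: "proj k (F + G) = proj k F + proj k G"
  by (simp add: proj_def lsubst_add)

lemma proj_diff: "proj k (F - G) = proj k F - proj k G"
  by (simp add: proj_def lsubst_diff)

lemma proj_lconst_mult: "proj k (lconst c * F) = lconst c * proj k F"
  by (simp add: proj_def lsubst_lconst_mult)

lemma proj_lvar_mult:
  assumes "F \<in> hpoly UNIV m d"
  shows "proj k (lvar j * F) = (if j \<le> k then lvar j else 0) * proj k F"
proof -
  have "\<forall>\<mu>\<in>keys F. 0 \<le> lookup \<mu> j" using assms by (auto simp: hpoly_iff pexp_def)
  then show ?thesis unfolding proj_def by (intro lsubst_lvar_mult) blast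
qed

lemma proj_mult:
  assumes "F \<in> hpoly UNIV m d" "G \<in> hpoly UNIV m d'"
  shows "proj k (F * G) = proj k F * proj k G"
  using assms(1)
proof (induction d F rule: hpoly_induct)
  case (const c)
  then show ?case by (simp add: proj_lconst_mult) (simp add: proj_def)
next
  case (add d F H)
  then show ?case by (simp add: distrib_right proj_add)
next
  case (var d j F)
  have "proj k (lvar j * (F * G)) = (if j \<le> k then lvar j else 0) * proj k (F * G)"
    by (rule proj_lvar_mult[OF hpoly_mult[OF var(3) assms(2)]])
  then show ?case using var proj_lvar_mult[OF var(3)] by (simp add: mult.assoc)
qed (simp_all add: proj_def)

text \<open>Vanishing at \<open>X_m = 0\<close> forces \<open>X_m\<close> into every monomial, and
  adjacent swaps pass this on to \<open>X_{m-1}\<close> and downwards.\<close>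

lemma symh_exponents_pos:
  assumes F: "F \<in> symh m d" and m: "1 \<le> m" and 0: "proj (m - 1) F = 0" and \<mu>: "\<mu> \<in> keys F"
    and i: "1 \<le> i" "i \<le> m"
  shows "1 \<le> lookup \<mu> i"
  using i(2,1) \<mu>
proof (induction i arbitrary: \<mu> rule: inc_induct)
  case base
  have p: "pexp m \<mu>" using base symh_hpoly[OF F] by (auto simp: hpoly_iff)
  have "\<not> keys \<mu> \<subseteq> {..m - 1}"
    using lookup_proj[OF symh_hpoly[OF F], of "m - 1" \<mu>] 0 base by (auto simp: in_keys_iff)
  then obtain x where "x \<in> keys \<mu>" "\<not> x \<le> m - 1" by auto
  then have "m \<in> keys \<mu>" using p m by (auto simp: pexp_def) (metis le_antisym not_less_eq_eq One_nat_def Suc_pred le_trans linorder_not_less atLeastAtMost_iff subsetD Suc_leI)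
  then have "lookup \<mu> m \<noteq> 0" "0 \<le> lookup \<mu> m" using p by (auto simp: in_keys_iff pexp_def)
  then show ?case by simp
next
  case (step i)
  have "lookup F (texp i (Suc i) \<mu>) = lookup F \<mu>"
    using step F swp_eq_iff[of i "Suc i" F] by (simp add: symh_def)
  then have "texp i (Suc i) \<mu> \<in> keys F" using step by (simp add: in_keys_iff)
  then have "1 \<le> lookup (texp i (Suc i) \<mu>) (Suc i)" using step by simp
  then show ?case by (simp add: lookup_texp)
qed

lemma symh_degree_ge:
  assumes F: "F \<in> symh m d" and m: "1 \<le> m" and 0: "proj (m - 1) F = 0" and "F \<noteq> 0"
  shows "m \<le> d"
proof -
  obtain \<mu> where \<mu>: "\<mu> \<in> keys F" using \<open>F \<noteq> 0\<close> by (metis equals0I keys_eq_empty)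
  then have p: "pexp m \<mu>" "mdeg \<mu> = int d" using symh_hpoly[OF F] by (auto simp: hpoly_iff)
  have "mdeg \<mu> = (\<Sum>i\<in>{1..m}. lookup \<mu> i)" using p by (intro mdeg_superset) (auto simp: pexp_def)
  moreover have "(\<Sum>i\<in>{1..m}. (1::int)) \<le> (\<Sum>i\<in>{1..m}. lookup \<mu> i)"
    using symh_exponents_pos[OF F m 0 \<mu>] by (intro sum_mono) auto
  ultimately show ?thesis using p by simp
qed

section \<open>Stable families and their determination by finitely many variables\<close>

definition stable :: "nat \<Rightarrow> (nat \<Rightarrow> laurent) \<Rightarrow> bool" where
  "stable d f \<longleftrightarrow> (\<forall>m\<ge>1. f m \<in> symh m d) \<and> (\<forall>m m'. 1 \<le> m' \<and> m' < m \<longrightarrow> proj m' (f m) = f m')"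

text \<open>Below \<open>d\<close> variables one projects. Above, the difference in
  \<open>m + 1\<close> variables vanishes at \<open>X_{m+1} = 0\<close>, so it would have degree at
  least \<open>m + 1 > d\<close> if it were nonzero.\<close>

lemma stable_eqI:
  assumes f: "stable d f" and g: "stable d g" and "1 \<le> d" "f d = g d" "1 \<le> m"
  shows "f m = g m"
proof (cases "m < d")
  case True
  then show ?thesis using f g assms unfolding stable_def by metis
next
  case False
  then have "d \<le> m" by simp
  then show ?thesis
  proof (induction m rule: dec_induct)
    case base
    show ?case by (rule assms(4))
  next
    case (step m)
    let ?F = "f (Suc m) - g (Suc m)"
    have s: "?F \<in> symh (Suc m) d" using f g by (intro symh_diff) (auto simp: stable_def)
    have "proj m (f (Suc m)) = f m" "proj m (g (Suc m)) = g m"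
      using f g step assms(3) by (auto simp: stable_def)
    then have 0: "proj (Suc m - 1) ?F = 0" using step by (simp add: proj_diff)
    have "?F = 0"
    proof (rule ccontr)
      assume "?F \<noteq> 0"
      then have "Suc m \<le> d" using symh_degree_ge[OF s _ 0] by simp
      then show False using step by simp
    qed
    then show ?case by simp
  qed
qed

section \<open>Elementary symmetric polynomials\<close>

definition Er :: "nat \<Rightarrow> nat \<Rightarrow> laurent" where
  "Er r m = (\<Sum>A | A \<subseteq> {1..m} \<and> card A = r. \<Prod>i\<in>A. lvar i)"

lemma finite_subsets_card [simp]: "finite {A. A \<subseteq> {1..m} \<and> card A = r}" for m r :: nat
  by (rule finite_subset[of _ "Pow {1..m}"]) auto

lemma prod_lvar_hpoly: "finite A \<Longrightarrow> A \<subseteq> {1..m} \<Longrightarrow> (\<Prod>i\<in>A. lvar i) \<in> hpoly UNIV m (card A)"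
proof (induction A rule: finite_induct)
  case empty
  then show ?case using hpoly_lconst[of 1 UNIV m] by simp
next
  case (insert x A)
  then show ?case by (auto intro!: hpoly_lvar_mult)
qed

lemma Er_symh: "Er r m \<in> symh m r"
proof -
  have fin: "A \<subseteq> {1..m} \<Longrightarrow> finite A" for A :: "nat set" using finite_subset by blast
  have H: "Er r m \<in> hpoly UNIV m r"
    unfolding Er_def using prod_lvar_hpoly fin by (intro hpU_basic) auto
  have "swp i (Suc i) (Er r m) = Er r m" if i: "1 \<le> i" "i < m" for i
  proof -
    let ?t = "transpose i (Suc i)"
    have sp: "swp i (Suc i) (prod f A) = (\<Prod>x\<in>A. swp i (Suc i) (f x))" for f :: "nat \<Rightarrow> laurent" and A
      by (induction A rule: infinite_finite_induct) simp_all
    have ss: "swp i (Suc i) (sum f A) = (\<Sum>x\<in>A. swp i (Suc i) (f x))" for f :: "nat set \<Rightarrow> laurent" and A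
      by (induction A rule: infinite_finite_induct) simp_all
    have inj: "inj_on ?t A" for A by (rule inj_on_inverseI[of _ ?t]) simp
    have "swp i (Suc i) (Er r m) = (\<Sum>A | A \<subseteq> {1..m} \<and> card A = r. \<Prod>x\<in>?t ` A. lvar x)"
      unfolding Er_def ss sp by (simp add: prod.reindex[OF inj])
    also have "\<dots> = Er r m" unfolding Er_def
    proof (rule sum.reindex_bij_witness[of _ "\<lambda>A. ?t ` A" "\<lambda>A. ?t ` A"])
      have t: "?t x \<in> {1..m}" if "x \<in> {1..m}" for x using that i by (auto simp: transpose_def)
      show "?t ` A \<in> {A. A \<subseteq> {1..m} \<and> card A = r}" if "A \<in> {A. A \<subseteq> {1..m} \<and> card A = r}" for A
        using that t by (auto simp: card_image[OF inj] simp del: atLeastAtMost_iff)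
      show "?t ` A \<in> {A. A \<subseteq> {1..m} \<and> card A = r}" if "A \<in> {A. A \<subseteq> {1..m} \<and> card A = r}" for A
        using that t by (auto simp: card_image[OF inj] simp del: atLeastAtMost_iff)
    qed (auto simp: image_image)
    finally show ?thesis .
  qed
  then show ?thesis using H by (simp add: symh_def)
qed

lemma proj_Er:
  assumes "k \<le> m"
  shows "proj k (Er r m) = Er r k"
proof -
  have pp: "proj k (\<Prod>i\<in>A. lvar i) = (if A \<subseteq> {..k} then \<Prod>i\<in>A. lvar i else 0)" if "finite A" "A \<subseteq> {1..m}" for A
    using that
  proof (induction A rule: finite_induct)
    case empty
    then show ?case by (simp add: proj_def)
  next
    case (insert x A)
    then show ?case using proj_lvar_mult[OF prod_lvar_hpoly[of A m], of k x] by auto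
  qed
  have fin: "A \<subseteq> {1..m} \<Longrightarrow> finite A" for A :: "nat set" using finite_subset by blast
  have "proj k (Er r m) = (\<Sum>A | A \<subseteq> {1..m} \<and> card A = r. if A \<subseteq> {..k} then \<Prod>i\<in>A. lvar i else 0)"
    unfolding Er_def proj_def lsubst_sum unfolding proj_def[symmetric]
    by (rule sum.cong) (use pp fin in auto)
  also have "\<dots> = (\<Sum>A | A \<subseteq> {1..k} \<and> card A = r. \<Prod>i\<in>A. lvar i)"
  proof (rule sum.mono_neutral_cong_right)
    show "{A. A \<subseteq> {1..k} \<and> card A = r} \<subseteq> {A. A \<subseteq> {1..m} \<and> card A = r}"
      using assms by force
    show "\<forall>A\<in>{A. A \<subseteq> {1..m} \<and> card A = r} - {A. A \<subseteq> {1..k} \<and> card A = r}.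
       (if A \<subseteq> {..k} then \<Prod>i\<in>A. lvar i else 0) = 0"
    proof
      fix A assume A: "A \<in> {A. A \<subseteq> {1..m} \<and> card A = r} - {A. A \<subseteq> {1..k} \<and> card A = r}"
      have "\<not> A \<subseteq> {..k}"
      proof
        assume "A \<subseteq> {..k}"
        have "A \<subseteq> {1..k}"
        proof
          fix x assume "x \<in> A"
          then have "x \<in> {..k}" "x \<in> {1..m}" using A \<open>A \<subseteq> {..k}\<close> by blast+
          then show "x \<in> {1..k}" by simp
        qed
        then show False using A by blast
      qed
      then show "(if A \<subseteq> {..k} then \<Prod>i\<in>A. lvar i else 0) = 0" by simp
    qed
    show "(if A \<subseteq> {..k} then \<Prod>i\<in>A. lvar i else 0) = (\<Prod>i\<in>A. lvar i)"
      if "A \<in> {A. A \<subseteq> {1..k} \<and> card A = r}" for A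
    proof -
      have "A \<subseteq> {..k}" using that by auto
      then show ?thesis by simp
    qed
  qed simp
  finally show ?thesis by (simp add: Er_def)
qed

lemma Er_stable: "stable r (Er r)"
  unfolding stable_def using Er_symh proj_Er by auto

lemma Er_top: "Er m m = (\<Prod>i\<in>{1..m}. lvar i)"
proof -
  have "{A. A \<subseteq> {1..m} \<and> card A = m} = {{1..m}}"
  proof (intro equalityI subsetI)
    fix A assume A: "A \<in> {A. A \<subseteq> {1..m} \<and> card A = m}"
    then have "A = {1..m}" by (intro card_subset_eq) auto
    then show "A \<in> {{1..m}}" by simp
  qed auto
  then show ?thesis by (simp add: Er_def)
qed

lemma Er_top_single: "Er m m = Poly_Mapping.single (\<Sum>i\<in>{1..m}. Poly_Mapping.single i 1) 1"
proof -
  have "(\<Prod>i\<in>A. lvar i) = Poly_Mapping.single (\<Sum>i\<in>A. Poly_Mapping.single i 1) 1" if "finite A" for A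
    using that by (induction A) (simp_all add: lvar_single)
  then show ?thesis by (simp add: Er_top)
qed

lemma symh_divide_Er:
  assumes F: "F \<in> symh m d" and m: "1 \<le> m" and 0: "proj (m - 1) F = 0" and "F \<noteq> 0"
  shows "\<exists>G\<in>symh m (d - m). F = Er m m * G"
proof -
  have md: "m \<le> d" by (rule symh_degree_ge[OF assms])
  define ones where "ones = (\<Sum>i\<in>{1..m}. Poly_Mapping.single i (1::int))"
  have lo: "lookup ones i = (if 1 \<le> i \<and> i \<le> m then 1 else 0)" for i
    by (simp add: ones_def lookup_sum lookup_single when_def)
  \<comment> \<open>Division by \<open>X_1 ... X_m\<close> shifts all exponents;
    \<open>symh_exponents_pos\<close> ensures that none becomes negative.\<close>
  define G where "G = Poly_Mapping.single (- ones) 1 * F"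
  have lG: "lookup G \<mu> = lookup F (\<mu> + ones)" for \<mu> by (simp add: G_def lookup_single_mult)
  have E: "Er m m = Poly_Mapping.single ones 1" by (simp add: Er_top_single ones_def)
  have FG: "F = Er m m * G"
    by (simp add: E G_def mult.assoc[symmetric] mult_single)
  have "pexp m \<mu> \<and> mdeg \<mu> = int (d - m)" if "\<mu> \<in> keys G" for \<mu>
  proof -
    have k: "\<mu> + ones \<in> keys F" using that lG by (simp add: in_keys_iff)
    then have p: "pexp m (\<mu> + ones)" "mdeg (\<mu> + ones) = int d" using symh_hpoly[OF F] by (auto simp: hpoly_iff)
    have pos: "1 \<le> lookup (\<mu> + ones) i" if "1 \<le> i" "i \<le> m" for i
      using symh_exponents_pos[OF F m 0 k that] .
    have z: "lookup \<mu> i = 0" if "i \<notin> {1..m}" for i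
    proof -
      have "i \<notin> keys (\<mu> + ones)" using p(1) that unfolding pexp_def by blast
      moreover have "lookup ones i = 0" using that lo[of i] by simp
      ultimately show ?thesis by (simp add: in_keys_iff lookup_add)
    qed
    have nn: "0 \<le> lookup \<mu> i" for i using pos[of i] z[of i] lo[of i] by (cases "i \<in> {1..m}") (auto simp: lookup_add)
    have "mdeg ones = (\<Sum>i\<in>{1..m}. lookup ones i)" by (intro mdeg_superset) (auto simp: in_keys_iff lo split: if_splits)
    then have "mdeg ones = int m" by (simp add: lo)
    then have "mdeg \<mu> = int (d - m)" using p(2) md by (simp add: mdeg_add)
    moreover have "keys \<mu> \<subseteq> {1..m}" using z by (auto simp: in_keys_iff simp del: atLeastAtMost_iff)
    ultimately show ?thesis using nn by (simp add: pexp_def)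
  qed
  then have H: "G \<in> hpoly UNIV m (d - m)" by (simp add: hpoly_iff)
  have E0: "Er m m \<noteq> 0" unfolding E by (metis lookup_single_eq lookup_zero zero_neq_one)
  have "swp i (Suc i) G = G" if "1 \<le> i" "i < m" for i
  proof -
    have "swp i (Suc i) F = F" "swp i (Suc i) (Er m m) = Er m m" using F Er_symh that by (auto simp: symh_def)
    then have "Er m m * swp i (Suc i) G = Er m m * G" unfolding FG by simp
    then show ?thesis using E0 by simp
  qed
  then have "G \<in> symh m (d - m)" using H by (simp add: symh_def)
  then show ?thesis using FG by blast
qed

text \<open>Homogeneous polynomials in the \<open>e_r\<close>, recorded in all numbers of variables
  at once: an expression found for one \<open>m\<close> then describes a whole family.\<close>

inductive espan :: "nat \<Rightarrow> (nat \<Rightarrow> laurent) \<Rightarrow> bool" where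
  zero: "espan d (\<lambda>m. 0)"
| one: "espan 0 (\<lambda>m. 1)"
| add: "espan d p \<Longrightarrow> espan d p' \<Longrightarrow> espan d (\<lambda>m. p m + p' m)"
| smult: "espan d p \<Longrightarrow> espan d (\<lambda>m. lconst c * p m)"
| mult: "1 \<le> r \<Longrightarrow> espan d p \<Longrightarrow> espan (r + d) (\<lambda>m. Er r m * p m)"

lemma espan_symh: "espan d p \<Longrightarrow> p m \<in> symh m d"
  by (induction rule: espan.induct) (auto intro: symh_0 symh_1 symh_add symh_lconst_mult symh_mult Er_symh)

lemma espan_proj: "espan d p \<Longrightarrow> k \<le> m \<Longrightarrow> proj k (p m) = p k"
proof (induction rule: espan.induct)
  case (mult r d p)
  then show ?case
    using proj_mult[OF symh_hpoly[OF Er_symh] symh_hpoly[OF espan_symh]] proj_Er by simp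
qed (simp_all add: proj_add proj_lconst_mult, simp_all add: proj_def)

lemma espan_stable: "espan d p \<Longrightarrow> stable d p"
  unfolding stable_def using espan_symh espan_proj by auto

text \<open>If a symmetric polynomial vanishes at \<open>X\<^sub>m = 0\<close>, it is divisible by \<open>e\<^sub>m = X\<^sub>1 \<dots> X\<^sub>m\<close>.\<close>

theorem fundamental_symmetric: "F \<in> symh m d \<Longrightarrow> \<exists>p. espan d p \<and> p m = F"
proof (induction m arbitrary: d F)
  case 0
  have k: "keys F \<subseteq> {0}"
    using symh_hpoly[OF 0] by (auto simp: hpoly_iff pexp_def)
  have F: "F = lconst (lookup F 0)"
    by (rule poly_mapping_eqI) (use k in \<open>auto simp: lconst_def lookup_single when_def in_keys_iff subset_iff\<close>)
  show ?case
  proof (cases "d = 0")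
    case True
    then show ?thesis using espan.smult[OF espan.one, of "lookup F 0"] F by auto
  next
    case False
    have "0 \<notin> keys F" using symh_hpoly[OF 0] False by (auto simp: hpoly_iff)
    then have "F = 0" using F by (simp add: in_keys_iff)
    then show ?thesis using espan.zero by auto
  qed
next
  case (Suc m)
  note outer = Suc.IH
  show ?case using Suc.prems
  proof (induction d arbitrary: F rule: less_induct)
    case (less d)
    obtain p where p: "espan d p" "p m = proj m F" using outer[OF proj_symh[OF less.prems]] by auto
    let ?H = "F - p (Suc m)"
    have H: "?H \<in> symh (Suc m) d" using less.prems espan_symh[OF p(1)] by (rule symh_diff)
    have 0: "proj (Suc m - 1) ?H = 0" using p espan_proj[OF p(1), of m "Suc m"] by (simp add: proj_diff)
    show ?case
    proof (cases "?H = 0")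
      case True
      then show ?thesis using p by auto
    next
      case False
      obtain G where G: "G \<in> symh (Suc m) (d - Suc m)" "?H = Er (Suc m) (Suc m) * G"
        using symh_divide_Er[OF H _ 0 False] by auto
      have md: "Suc m \<le> d" using symh_degree_ge[OF H _ 0 False] by simp
      then obtain p' where p': "espan (d - Suc m) p'" "p' (Suc m) = G" using less.IH[OF _ G(1)] by auto
      have "espan d (\<lambda>k. p k + Er (Suc m) k * p' k)"
        using espan.add[OF p(1)] espan.mult[OF _ p'(1), of "Suc m"] md by simp
      moreover have "p (Suc m) + Er (Suc m) (Suc m) * p' (Suc m) = F" using G p' by (simp add: algebra_simps)
      ultimately show ?thesis by blast
    qed
  qed
qed

lemma stable_espan:
  assumes "stable d f" "1 \<le> d"
  shows "\<exists>p. espan d p \<and> (\<forall>m\<ge>1. f m = p m)"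
proof -
  have "f d \<in> symh d d" using assms by (simp add: stable_def)
  then obtain p where p: "espan d p" "p d = f d" using fundamental_symmetric by blast
  then show ?thesis using stable_eqI[OF assms(1) espan_stable[OF p(1)] assms(2)] by auto
qed

section \<open>Complete graphs\<close>

definition Mprod :: "nat \<Rightarrow> laurent" where
  "Mprod k = (\<Prod>i\<in>{1..k}. lvar i)"

text \<open>The \<open>t\<close>-integer \<open>[k + 1]\<close>.\<close>

definition qnum :: "nat \<Rightarrow> qt" where
  "qnum k = (\<Sum>i<Suc k. tt ^ i)"

lemma Mprod_0 [simp]: "Mprod 0 = 1"
  by (simp add: Mprod_def)

lemma Mprod_Suc: "Mprod (Suc k) = lvar (Suc k) * Mprod k"
  by (simp add: Mprod_def mult.commute)

lemma Mprod_shift: "lvar 1 * (\<Prod>i\<in>{1..k}. lvar (Suc i)) = Mprod (Suc k)"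
  unfolding Mprod_def by (induction k) (simp_all add: mult.assoc[symmetric] flip: One_nat_def)

lemma dlt_const: "a \<noteq> b \<Longrightarrow> swp a b F = F \<Longrightarrow> dlt a b F = F"
  using dl_const[of a b F] dl_eq_tl_iff[of a b F] by simp

lemma swp_Mprod_above: "k < a \<Longrightarrow> k < b \<Longrightarrow> swp a b (Mprod k) = Mprod k"
  by (induction k) (simp_all add: Mprod_Suc)

lemma swp_Mprod_below: "1 \<le> c \<Longrightarrow> c < k \<Longrightarrow> swp c (Suc c) (Mprod k) = Mprod k"
  using Er_symh[of k k] by (simp add: Er_top Mprod_def symh_def)

lemma tdn_lconst_mult: "k < m \<Longrightarrow> tdn m k (lconst c * F) = lconst c * tdn m k F"
  by (induction k) simp_all

lemma Bop_lconst_mult: "Bop m d (lconst c * F) = lconst c * Bop m d F"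
  unfolding Bop_def sum_distrib_left
  by (rule sum.cong) (auto simp: tdn_lconst_mult mult.left_commute[of "lvar m"])

lemma tl_power: "tvar ^ k = lconst (tt ^ k)"
  by (simp add: tvar_def lconst_power)

text \<open>The first summand moves \<open>X_r\<close> down to \<open>X_{k+1}\<close> and completes
  the product; each further operator acts on this symmetric product by \<open>t\<close>, which
  yields the geometric sum.\<close>

lemma Bop_Mprod:
  assumes "d + k + 1 = r"
  shows "Bop r d (Mprod k) = lconst (qnum k) * Mprod (Suc k)"
proof -
  have dtn: "dtn r j (Mprod k) = Mprod k" if "j \<le> d" for j
    using that
  proof (induction j)
    case (Suc j)
    have "dlt (r - j) (r - Suc j) (Mprod k) = Mprod k"
      using Suc assms by (intro dlt_const swp_Mprod_above) auto
    then show ?case using Suc by simp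
  qed simp
  have tdn: "tdn r (d + i) (lvar r * Mprod k) = tvar ^ i * Mprod (Suc k)" if "i \<le> k" for i
    using that
  proof (induction i)
    case 0
    have "lvar (r - d) * dtn r d (Mprod k) = tdn r d (lvar r * Mprod k)"
      using assms by (intro lvar_dtn) auto
    moreover have "r - d = Suc k" using assms by simp
    ultimately show ?case by (simp add: dtn Mprod_Suc)
  next
    case (Suc i)
    let ?c = "r - Suc (d + i)"
    have e: "r - (d + i) = Suc ?c" using Suc assms by auto
    have "swp (Suc ?c) ?c (Mprod (Suc k)) = Mprod (Suc k)"
      using Suc assms swp_Mprod_below[of ?c "Suc k"] by (simp add: swp_commute)
    then have "dl (Suc ?c) ?c (Mprod (Suc k)) = tvar * Mprod (Suc k)" by (rule dl_const[rotated]) simp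
    moreover have "dl (Suc ?c) ?c (tvar ^ i * G) = tvar ^ i * dl (Suc ?c) ?c G" for G
      unfolding tl_power by (rule dl_lconst_mult) simp
    ultimately have "dl (Suc ?c) ?c (tvar ^ i * Mprod (Suc k)) = tvar ^ Suc i * Mprod (Suc k)"
      by (simp add: mult.left_commute mult.assoc)
    then show ?case using Suc by (simp add: e)
  qed
  have "Bop r d (Mprod k) = (\<Sum>i<Suc k. tdn r (d + i) (lvar r * Mprod k))"
    unfolding Bop_def
    by (rule sum.reindex_bij_witness[of _ "\<lambda>i. d + i" "\<lambda>j. j - d"]) (use assms in auto)
  also have "\<dots> = (\<Sum>i<Suc k. tvar ^ i * Mprod (Suc k))"
    by (rule sum.cong) (use tdn in auto)
  also have "\<dots> = lconst (qnum k) * Mprod (Suc k)"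
    unfolding qnum_def lconst_sum tl_power sum_distrib_right ..
  finally show ?thesis .
qed

lemma PQ_Mprod:
  assumes "k < r"
  shows "PQ 1 r (Mprod k) = Mprod (Suc k)"
proof -
  have r1: "1 \<le> r" using assms by simp
  have pr: "rho 1 r (prod f A) = (\<Prod>x\<in>A. rho 1 r (f x))" for f :: "nat \<Rightarrow> laurent" and A
    using r1 by (induction A rule: infinite_finite_induct) simp_all
  have "rho 1 r (Mprod k) = (\<Prod>i\<in>{1..k}. lvar (Suc i))"
    unfolding Mprod_def pr by (rule prod.cong) (use assms r1 in \<open>auto simp: rho_lvar\<close>)
  then show ?thesis by (simp only: PQ_def Mprod_shift)
qed

text \<open>\<open>\<Pi>\<close> completes the product, which the \<open>t T_l^{-1}\<close> with
  \<open>l \<le> k\<close> fix, so only the weights remain. Compared with \<open>Bop_Mprod\<close>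
  the letter has the additional factor \<open>t^{r-1-k}\<close>.\<close>

lemma Aop_Mprod:
  assumes "d + k + 1 = r"
  shows "Aop 1 r d (Mprod k) = lconst (tt ^ (r - 1 - k) * qnum k) * Mprod (Suc k)"
proof -
  have up: "up l (Mprod (Suc k)) = Mprod (Suc k)" if "l \<le> k" for l
    using that by (induction l) (simp_all add: dlt_const swp_Mprod_below)
  have "Aop 1 r d (Mprod k) = (\<Sum>l<Suc k. tvar ^ (r - 1 - l) * Mprod (Suc k))"
  proof -
    have "d < r" "r - d = Suc k" using assms by auto
    moreover have "PQ 1 r (Mprod k) = Mprod (Suc k)" using assms by (intro PQ_Mprod) auto
    ultimately show ?thesis unfolding Aop_def using up by (auto intro!: sum.cong)
  qed
  also have "\<dots> = (\<Sum>l<Suc k. tvar ^ (r - 1 - l)) * Mprod (Suc k)" by (simp only: sum_distrib_right)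
  also have "(\<Sum>l<Suc k. tvar ^ (r - 1 - l)) = (\<Sum>l<Suc k. tvar ^ (r - 1 - (Suc k - Suc l)))"
    by (rule sum.nat_diff_reindex[symmetric])
  also have "\<dots> = (\<Sum>l<Suc k. tvar ^ (r - 1 - k) * tvar ^ l)"
  proof (rule sum.cong)
    fix l assume "l \<in> {..<Suc k}"
    then have "r - 1 - (Suc k - Suc l) = (r - 1 - k) + l" using assms by auto
    then show "tvar ^ (r - 1 - (Suc k - Suc l)) = tvar ^ (r - 1 - k) * tvar ^ l" by (simp only: power_add)
  qed simp
  also have "\<dots> = lconst (tt ^ (r - 1 - k) * qnum k)"
    by (simp only: tl_power qnum_def lconst_mult lconst_sum sum_distrib_left)
  finally show ?thesis .
qed

lemma foldr_Bop_complete: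
  "k \<le> r \<Longrightarrow> foldr (Bop r) [r - k..<r] 1 = lconst (\<Prod>j<k. qnum j) * Mprod k"
proof (induction k)
  case (Suc k)
  have "[r - Suc k..<r] = (r - Suc k) # [r - k..<r]"
    using Suc by (simp add: upt_conv_Cons Suc_diff_Suc)
  then show ?case using Suc Bop_Mprod[of "r - Suc k" k r]
    by (simp add: Bop_lconst_mult lconst_mult mult.assoc)
qed simp

lemma foldr_Aop_complete:
  "k \<le> r \<Longrightarrow> foldr (Aop 1 r) [r - k..<r] 1 = lconst (tt ^ (\<Sum>j<k. r - 1 - j) * (\<Prod>j<k. qnum j)) * Mprod k"
proof (induction k)
  case (Suc k)
  have "[r - Suc k..<r] = (r - Suc k) # [r - k..<r]"
    using Suc by (simp add: upt_conv_Cons Suc_diff_Suc)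
  then have "foldr (Aop 1 r) [r - Suc k..<r] 1 =
     lconst (tt ^ (\<Sum>j<k. r - 1 - j) * (\<Prod>j<k. qnum j)) * (lconst (tt ^ (r - 1 - k) * qnum k) * Mprod (Suc k))"
    using Suc Aop_Mprod[of "r - Suc k" k r] by (simp add: Aop_lconst_mult)
  also have "\<dots> = lconst ((tt ^ (\<Sum>j<k. r - 1 - j) * (\<Prod>j<k. qnum j)) * (tt ^ (r - 1 - k) * qnum k)) * Mprod (Suc k)"
    by (simp only: lconst_mult mult.assoc)
  also have "(tt ^ (\<Sum>j<k. r - 1 - j) * (\<Prod>j<k. qnum j)) * (tt ^ (r - 1 - k) * qnum k)
     = tt ^ (\<Sum>j<Suc k. r - 1 - j) * (\<Prod>j<Suc k. qnum j)"
    by (simp add: power_add mult_ac)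
  finally show ?case .
qed simp

lemma tt_power: "tt ^ k = Fract [:[:0, 1:] ^ k:] 1"
  by (induction k) (simp_all add: tt_def One_fract_def one_pCons)

text \<open>At \<open>t = 1\<close> the sum takes the value \<open>k + 1\<close>. Nonvanishing
  serves to cancel the common factor in \<open>phi_Er\<close>.\<close>

lemma qnum_nonzero: "qnum k \<noteq> 0"
proof -
  have "(\<Sum>i\<in>A. Fract [:f i:] 1) = Fract [:\<Sum>i\<in>A. f i:] 1" if "finite A" for f :: "nat \<Rightarrow> rat poly" and A
    using that by (induction A) (simp_all add: Zero_fract_def)
  then have q: "qnum k = Fract [:\<Sum>i<Suc k. [:0, 1:] ^ i:] 1"
    by (simp only: qnum_def tt_power finite_lessThan)
  have "poly (\<Sum>i<Suc k. [:0, 1:] ^ i) 1 = (of_nat (Suc k) :: rat)"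
    unfolding poly_sum by simp
  then have "(\<Sum>i<Suc k. [:0, 1 :: rat:] ^ i) \<noteq> 0" by (metis of_nat_0 of_nat_eq_iff nat.distinct(1) poly_0)
  then show ?thesis unfolding q by (simp add: Zero_fract_def eq_fract)
qed

section \<open>Chromatic quasisymmetric functions as stable families\<close>

lemma chr_hpoly:
  assumes "e \<in> unit_interval_fun n" "1 \<le> m"
  shows "chr e m n \<in> hpoly UNIV m n"
  using phi_Bop_word[OF assms(2), of "map (lneigh e) [1..<n + 1]"] chr_eq_Bop[OF assms] by simp

lemma phi_chr:
  assumes "e \<in> unit_interval_fun n" "1 \<le> m"
  shows "phi m (chr e m n) = Wop 1 m (map (lneigh e) [1..<n + 1])"
  using phi_Bop_word[OF assms(2), of "map (lneigh e) [1..<n + 1]"] chr_eq_Bop[OF assms] by simp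

lemma chr_symh:
  assumes "e \<in> unit_interval_fun n" "1 \<le> m"
  shows "chr e m n \<in> symh m n"
  using hpoly_symmetric_in_ring[OF chr_hpoly[OF assms] chr_symmetric[OF assms]] chr_hpoly[OF assms]
  by (simp add: symh_iff_sym_poly_ring hpoly_def)

abbreviation uie :: "(nat \<Rightarrow> int) \<Rightarrow> nat \<Rightarrow> (nat \<times> nat) set" where
  "uie e n \<equiv> unit_interval_edges n e"

lemma prod_loc:
  "(\<Prod>i\<in>{1..n}. loc e f i) = (if \<forall>(v, w)\<in>uie e n. f v \<noteq> f w
     then lconst (tt ^ asc (uie e n) f) * (\<Prod>i\<in>{1..n}. lvar (f i)) else 0)"
proof (cases "\<forall>(v, w)\<in>uie e n. f v \<noteq> f w")
  case True
  have edge: "(j, i) \<in> uie e n" if "i \<in> {1..n}" "j \<in> nb e i" for i j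
    using that by (auto simp: unit_interval_edges_def nb_def)
  have l: "loc e f i = tvar ^ card {j \<in> nb e i. f j < f i} * lvar (f i)" if "i \<in> {1..n}" for i
    using True edge[OF that] by (force simp: loc_def)
  have "{(v, w) \<in> uie e n. f v < f w} = (\<lambda>(w, v). (v, w)) ` (SIGMA i:{1..n}. {j \<in> nb e i. f j < f i})"
    by (auto simp: unit_interval_edges_def nb_def image_iff)
  then have "asc (uie e n) f = card (SIGMA i:{1..n}. {j \<in> nb e i. f j < f i})"
    unfolding asc_def by (simp add: card_image inj_on_def split_def)
  also have "\<dots> = (\<Sum>i\<in>{1..n}. card {j \<in> nb e i. f j < f i})"
    by (rule card_SigmaI) auto
  finally have a: "tvar ^ asc (uie e n) f = (\<Prod>i\<in>{1..n}. tvar ^ card {j \<in> nb e i. f j < f i})"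
    by (simp add: power_sum)
  have "(\<Prod>i\<in>{1..n}. loc e f i) = (\<Prod>i\<in>{1..n}. tvar ^ card {j \<in> nb e i. f j < f i} * lvar (f i))"
    by (rule prod.cong) (use l in auto)
  then show ?thesis using True a by (simp add: prod.distrib tl_power)
next
  case False
  then obtain v w where vw: "(v, w) \<in> uie e n" "f v = f w" by auto
  then have "w \<in> {1..n}" "v \<in> nb e w" by (auto simp: unit_interval_edges_def nb_def)
  moreover have "loc e f w = 0" using imageI[OF calculation(2), of f] vw(2) by (simp add: loc_def)
  ultimately have "(\<Prod>i\<in>{1..n}. loc e f i) = 0" by (intro prod_zero) auto
  then show ?thesis unfolding if_not_P[OF False] .
qed

text \<open>The monomial determines the set of colors used, so a monomial in the first
  \<open>m\<close> variables sees only colorings with \<open>m\<close> colors.\<close>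

lemma lookup_chr:
  "lookup (chr e m n) \<mu> = (if keys \<mu> \<subseteq> {1..m} then chromatic_qsym {1..n} (uie e n) \<mu> else 0)"
proof -
  let ?E = "uie e n" and ?x = "\<lambda>f :: nat \<Rightarrow> nat. \<Sum>v\<in>{1..n}. Poly_Mapping.single (f v) (1::int)"
  let ?ok = "\<lambda>f. (\<forall>(v, w)\<in>?E. f v \<noteq> f w) \<and> ?x f = \<mu>"
  have pl: "(\<Prod>i\<in>A. lvar (f i)) = Poly_Mapping.single (\<Sum>i\<in>A. Poly_Mapping.single (f i) 1) 1"
    if "finite A" for A and f :: "nat \<Rightarrow> nat"
    using that by (induction A) (simp_all add: lvar_single)
  have "lookup (\<Prod>i\<in>{1..n}. loc e f i) \<mu> = (if ?ok f then tt ^ asc ?E f else 0)" for f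
    unfolding prod_loc pl[OF finite_atLeastAtMost]
    by (auto simp: lookup_lconst_mult lookup_single when_def)
  then have L: "lookup (chr e m n) \<mu> = (\<Sum>f\<in>{1..n} \<rightarrow>\<^sub>E {1..m}. if ?ok f then tt ^ asc ?E f else 0)"
    by (simp add: chr_def lookup_sum)
  have fin: "finite ({1..n} \<rightarrow>\<^sub>E {1..m})" by (rule finite_PiE) auto
  have L2: "lookup (chr e m n) \<mu> = (\<Sum>f | f \<in> {1..n} \<rightarrow>\<^sub>E {1..m} \<and> ?ok f. tt ^ asc ?E f)"
    unfolding L using fin by (simp add: sum.If_cases Int_def)
  have lx: "f v \<in> keys (?x f)" if "v \<in> {1..n}" for f v
  proof -
    have "1 \<le> (\<Sum>w\<in>{1..n}. lookup (Poly_Mapping.single (f w) (1::int)) (f v))"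
    proof -
      have "lookup (Poly_Mapping.single (f v) (1::int)) (f v) \<le> (\<Sum>w\<in>{1..n}. lookup (Poly_Mapping.single (f w) (1::int)) (f v))"
        by (rule member_le_sum) (use that in \<open>auto simp: lookup_single when_def\<close>)
      then show ?thesis by simp
    qed
    then show ?thesis by (simp add: in_keys_iff lookup_sum)
  qed
  have kx: "keys (?x f) \<subseteq> f ` {1..n}" for f
    using keys_sum[of "\<lambda>v. Poly_Mapping.single (f v) (1::int)" "{1..n}"] by (auto split: if_splits)
  show ?thesis
  proof (cases "keys \<mu> \<subseteq> {1..m}")
    case True
    have "{f. f \<in> {1..n} \<rightarrow>\<^sub>E {1..m} \<and> ?ok f} = {\<kappa>. \<kappa> \<in> proper_colorings {1..n} ?E \<and> ?x \<kappa> = \<mu>}"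
    proof (intro equalityI subsetI)
      fix f assume "f \<in> {f. f \<in> {1..n} \<rightarrow>\<^sub>E {1..m} \<and> ?ok f}"
      then show "f \<in> {\<kappa>. \<kappa> \<in> proper_colorings {1..n} ?E \<and> ?x \<kappa> = \<mu>}"
        by (auto simp: proper_colorings_def PiE_iff)
    next
      fix f assume f: "f \<in> {\<kappa>. \<kappa> \<in> proper_colorings {1..n} ?E \<and> ?x \<kappa> = \<mu>}"
      then have "f v \<in> {1..m}" if "v \<in> {1..n}" for v using lx[OF that, of f] True by blast
      then show "f \<in> {f. f \<in> {1..n} \<rightarrow>\<^sub>E {1..m} \<and> ?ok f}"
        using f by (auto simp: proper_colorings_def PiE_iff)
    qed
    then show ?thesis using True L2 by (simp add: chromatic_qsym_def)
  next
    case False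
    have emp: "{f. f \<in> {1..n} \<rightarrow>\<^sub>E {1..m} \<and> ?ok f} = {}"
      using False kx by (fastforce simp: PiE_iff)
    show ?thesis unfolding L2 emp using False by simp
  qed
qed

lemma chr_stable:
  assumes "e \<in> unit_interval_fun n"
  shows "stable n (\<lambda>m. chr e m n)"
  unfolding stable_def
proof (intro conjI allI impI)
  fix m m' :: nat assume m: "1 \<le> m' \<and> m' < m"
  have H: "chr e m n \<in> hpoly UNIV m n" using assms m by (intro chr_hpoly) auto
  show "proj m' (chr e m n) = chr e m' n"
  proof (rule poly_mapping_eqI)
    fix \<mu> :: "nat \<Rightarrow>\<^sub>0 int"
    have "keys \<mu> \<subseteq> {..m'} \<and> keys \<mu> \<subseteq> {1..m} \<longleftrightarrow> keys \<mu> \<subseteq> {1..m'}" using m by force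
    then show "lookup (proj m' (chr e m n)) \<mu> = lookup (chr e m' n) \<mu>"
      unfolding lookup_proj[OF H] lookup_chr by auto
  qed
qed (use chr_symh[OF assms] in simp)

lemma series_family_chr: "series_family (chromatic_qsym {1..n} (uie e n)) = (\<lambda>m\<in>{1..}. chr e m n)"
  unfolding series_family_def lookup_chr[symmetric] lookup_inverse ..

lemma Wop_stable:
  assumes "q \<noteq> 0" "dyck 0 ds"
  shows "stable (length ds) (\<lambda>m. Wop q m ds)"
  unfolding stable_def
proof (intro conjI allI impI)
  fix m :: nat assume m: "1 \<le> m"
  have H: "Wop q m ds \<in> hpoly UNIV m (length ds)"
    using assms m by (intro hpoly_Wop coeff_module_UNIV) auto
  show "Wop q m ds \<in> symh m (length ds)"
    using hpoly_symmetric_in_ring[OF H Wop_symmetric[OF assms(1) m assms(2)]] H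
    by (simp add: symh_iff_sym_poly_ring hpoly_def)
qed (use proj_Wop assms in auto)

lemma stable_lconst_mult: "stable d f \<Longrightarrow> stable d (\<lambda>m. lconst c * f m)"
  by (simp add: stable_def symh_lconst_mult proj_lconst_mult)

lemma complete_interval: "(\<lambda>_. 0) \<in> unit_interval_fun r"
  by (auto simp: unit_interval_fun_def)

lemma lneigh_complete: "map (lneigh (\<lambda>_. 0)) [1..<r + 1] = [0..<r]"
  by (rule nth_equalityI) (auto simp: lneigh_def nth_upt)

text \<open>Adds up the exponents of the extra factors \<open>t^{r-1-j}\<close> of the
  \<open>r\<close> letters; this is the exponent in \<open>N(e_r)\<close>.\<close>

lemma sum_staircase: "(\<Sum>j<r. r - 1 - j) = r * (r - 1) div (2 :: nat)"
proof -
  have "(\<Sum>j<r. r - Suc j) = (\<Sum>j<r. j)" by (rule sum.nat_diff_reindex)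
  then have "(\<Sum>j<r. r - 1 - j) = (\<Sum>j<r. j)" by (simp add: One_nat_def)
  also have "\<dots> = r * (r - 1) div 2" using Sum_Ico_nat[of 0 r] by (simp add: atLeast0LessThan)
  finally show ?thesis .
qed

text \<open>Both sides are read off from the complete graph on \<open>r\<close> vertices, where by stability the case of
  \<open>r\<close> variables suffices.\<close>

lemma phi_Er:
  assumes m: "1 \<le> m" and r: "1 \<le> r"
  shows "phi m (Er r m) = lconst (tt ^ (r * (r - 1) div 2)) * Er r m"
proof -
  define c where "c = (\<Prod>j<r. qnum j)"
  define s where "s = r * (r - 1) div 2"
  have c0: "c \<noteq> 0" by (simp add: c_def qnum_nonzero)
  let ?K = "\<lambda>_ :: nat. 0 :: int"
  have EM: "Er r r = Mprod r" by (simp add: Er_top Mprod_def)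
  have "chr ?K r r = lconst c * Er r r"
    using chr_eq_Bop[OF complete_interval r] foldr_Bop_complete[of r r]
    unfolding lneigh_complete by (simp add: c_def EM)
  then have 1: "chr ?K m r = lconst c * Er r m"
    using stable_eqI[OF chr_stable[OF complete_interval] stable_lconst_mult[OF Er_stable] r _ m] by blast
  have dy: "dyck 0 [0..<r]" using dyck_lneigh[OF complete_interval, of r] unfolding lneigh_complete .
  have "Wop 1 r [0..<r] = lconst (tt ^ s * c) * Er r r"
    using foldr_Aop_complete[of r r] sum_staircase[of r] by (simp add: Wop_def c_def s_def EM)
  then have 2: "Wop 1 m [0..<r] = lconst (tt ^ s * c) * Er r m"
    using stable_eqI[OF Wop_stable[OF one_neq_zero dy] _ _ _ m, of "\<lambda>m. lconst (tt ^ s * c) * Er r m"]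
      stable_lconst_mult[OF Er_stable] r by simp
  have "lconst c * phi m (Er r m) = lconst c * (lconst (tt ^ s) * Er r m)"
    using phi_chr[OF complete_interval m, of r] m unfolding 1 lneigh_complete 2
    by (simp add: lconst_mult mult.left_commute mult.assoc)
  then show ?thesis using c0 by (simp add: s_def)
qed

section \<open>The ring of symmetric functions\<close>

text \<open>Elements of \<open>Lambda\<close> are extensional on \<open>{1..}\<close>;
  \<open>RL\<close> normalizes a family accordingly, since \<open>stable\<close> and
  \<open>espan\<close> families carry a value at \<open>0\<close> as well.\<close>

definition RL :: "(nat \<Rightarrow> laurent) \<Rightarrow> nat \<Rightarrow> laurent" where
  "RL f = (\<lambda>m\<in>{1..}. f m)"

lemma RL_apply [simp]: "1 \<le> m \<Longrightarrow> RL f m = f m"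
  by (simp add: RL_def)

lemma RL_cong: "(\<And>m. 1 \<le> m \<Longrightarrow> f m = g m) \<Longrightarrow> RL f = RL g"
  unfolding RL_def by (rule restrict_ext) simp

lemma zero_Lambda_deg: "(\<lambda>m\<in>{1..}. 0) \<in> Lambda_deg d"
  using symh_0 by (auto simp: Lambda_deg_def symh_iff_sym_poly_ring proj_def)

lemma stable_Lambda_deg: "stable d f \<Longrightarrow> RL f \<in> Lambda_deg d"
  unfolding Lambda_deg_def stable_def symh_iff_sym_poly_ring
  by (auto simp: RL_def)

lemma Lambda_deg_carrier:
  assumes "f \<in> Lambda_deg d"
  shows "f \<in> carrier Lambda"
proof -
  have fx: "f \<in> extensional {1..}" using assms by (simp add: Lambda_deg_def)
  let ?g = "\<lambda>k. if k = d then f else (\<lambda>m\<in>{1..}. 0)"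
  have "f = (\<lambda>m\<in>{1..}. \<Sum>k\<le>d. ?g k m)"
  proof
    fix m
    have "(\<Sum>k\<le>d. ?g k m) = (\<Sum>k\<le>d. if k = d then f m else 0)" if "1 \<le> m"
      by (rule sum.cong) (use that in auto)
    then show "f m = (\<lambda>m\<in>{1..}. \<Sum>k\<le>d. ?g k m) m"
      using fx by (auto simp: extensional_def)
  qed
  moreover have "\<forall>k\<le>d. ?g k \<in> Lambda_deg k" using assms zero_Lambda_deg by simp
  ultimately have "\<exists>D g. (\<forall>k\<le>D. g k \<in> Lambda_deg k) \<and> f = (\<lambda>m\<in>{1..}. \<Sum>k\<le>D. g k m)"
    by (intro exI[of _ d] exI[of _ ?g] conjI)
  then show ?thesis unfolding Lambda_def partial_object.simps mem_Collect_eq .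
qed

lemma stable_carrier: "stable d f \<Longrightarrow> RL f \<in> carrier Lambda"
  by (rule Lambda_deg_carrier[OF stable_Lambda_deg])

lemma carrier_extensional: "f \<in> carrier Lambda \<Longrightarrow> f = RL f"
  by (auto simp: Lambda_def RL_def fun_eq_iff)

lemma RL_ops:
  "RL f \<otimes>\<^bsub>Lambda\<^esub> RL g = RL (\<lambda>m. f m * g m)" "RL f \<oplus>\<^bsub>Lambda\<^esub> RL g = RL (\<lambda>m. f m + g m)"
  "\<one>\<^bsub>Lambda\<^esub> = RL (\<lambda>m. 1)" "Lambda_smult c (RL f) = RL (\<lambda>m. lconst c * f m)" "elem_sym r = RL (Er r)"
  by (auto simp: Lambda_def RL_def Lambda_smult_def elem_sym_def Er_def fun_eq_iff)

lemma central_symh: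
  assumes "1 \<le> m" "F \<in> symh m d"
  shows "central m F"
proof -
  have "F \<in> sym_poly_ring m" using assms(2) by (simp add: symh_iff_sym_poly_ring)
  then have "rho 1 m F = F" using rho_1_symmetric[OF assms(1), of F] by (simp add: sym_poly_ring_def)
  then show ?thesis using assms by (simp add: central_def symh_def)
qed

text \<open>\<open>N\<close> and \<open>phi\<close> are linear, are multiplicative here and agree on
  the \<open>e_r\<close>. Centrality of the value is part of the induction because
  \<open>phi_mult\<close> requires it of the second factor.\<close>

lemma N_espan:
  assumes N: "is_N N" and m: "1 \<le> m" and p: "espan d p"
  shows "central m (phi m (p m)) \<and> N (RL p) m = phi m (p m)"
  using p
proof (induction rule: espan.induct)
  case (zero d)
  have "RL (\<lambda>m. 0) = Lambda_smult 0 (RL (\<lambda>m. 1))" by (simp add: RL_ops)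
  moreover have "RL (\<lambda>m. 1) \<in> carrier Lambda" using stable_carrier[OF espan_stable[OF espan.one]] .
  ultimately have "N (RL (\<lambda>m. 0)) = Lambda_smult 0 (N (RL (\<lambda>m. 1)))" using N by (simp add: is_N_def)
  then show ?case using m by (simp add: Lambda_smult_def central_def)
next
  case one
  have "N \<one>\<^bsub>Lambda\<^esub> = \<one>\<^bsub>Lambda\<^esub>" using N by (auto simp: is_N_def ring_iso_def ring_hom_def)
  then show ?case using m by (simp add: RL_ops central_def)
next
  case (add d p p')
  have "RL p \<in> carrier Lambda" "RL p' \<in> carrier Lambda" using add stable_carrier espan_stable by blast+
  then have "N (RL p \<oplus>\<^bsub>Lambda\<^esub> RL p') = N (RL p) \<oplus>\<^bsub>Lambda\<^esub> N (RL p')"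
    using N by (auto simp: is_N_def ring_iso_def ring_hom_def)
  then have "N (RL (\<lambda>m. p m + p' m)) m = N (RL p) m + N (RL p') m"
    using m by (simp add: RL_ops) (simp add: Lambda_def)
  then show ?case using add m by (auto simp: central_def)
next
  case (smult d p c)
  have "RL p \<in> carrier Lambda" using smult stable_carrier espan_stable by blast
  then have "N (Lambda_smult c (RL p)) = Lambda_smult c (N (RL p))" using N by (simp add: is_N_def)
  then have "N (RL (\<lambda>m. lconst c * p m)) m = lconst c * N (RL p) m"
    using m by (simp add: RL_ops) (simp add: Lambda_smult_def)
  then show ?case using smult m by (auto simp: central_def)
next
  case (mult r d p)
  have "RL p \<in> carrier Lambda" "RL (Er r) \<in> carrier Lambda"
    using mult stable_carrier espan_stable Er_stable by blast+
  then have "N (RL (Er r) \<otimes>\<^bsub>Lambda\<^esub> RL p) = N (RL (Er r)) \<otimes>\<^bsub>Lambda\<^esub> N (RL p)"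
    using N by (auto simp: is_N_def ring_iso_def ring_hom_def)
  moreover have "N (RL (Er r)) = Lambda_smult (tt ^ (r * (r - 1) div 2)) (RL (Er r))"
    using N mult RL_ops(5) by (simp add: is_N_def)
  ultimately have n: "N (RL (\<lambda>m. Er r m * p m)) m = phi m (Er r m) * phi m (p m)"
    using m mult phi_Er[OF m] by (simp add: RL_ops) (simp add: Lambda_def)
  have "phi m (Er r m * p m) = phi m (Er r m) * phi m (p m)"
    using phi_mult[OF m symh_hpoly[OF Er_symh] symh_hpoly[OF espan_symh[OF mult(2)]]] mult by blast
  moreover have "central m (phi m (Er r m))"
    unfolding phi_Er[OF m mult(1)] using central_symh[OF m symh_lconst_mult[OF Er_symh]] .
  ultimately show ?case using n mult m by (auto simp: central_def)
qed

lemma N_stable: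
  assumes "is_N N" "1 \<le> m" "stable d f" "1 \<le> d"
  shows "N (RL f) m = phi m (f m)"
proof -
  obtain p where p: "espan d p" "\<And>m. 1 \<le> m \<Longrightarrow> f m = p m" using stable_espan[OF assms(3,4)] by blast
  have "RL f = RL p" by (rule RL_cong) (rule p(2))
  then show ?thesis using N_espan[OF assms(1,2) p(1)] p(2) assms(2) by simp
qed

section \<open>Coefficients\<close>

lemma qt_integral_shift:
  assumes "c \<in> qt_integral"
  shows "inverse qq ^ k * tt powi l * c \<in> qt_integral"
proof -
  obtain A a where A: "finite A" and c: "c = (\<Sum>(i, j)\<in>A. of_int (a (i, j)) * inverse qq ^ i * tt powi j)"
    using assms by (auto simp: qt_integral_def)
  \<comment> \<open>Multiplication by a monomial translates the exponents, and \<open>a'\<close>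
    reads the coefficients back; the truncated difference \<open>i - k\<close> is exact on the image
    of \<open>h\<close>.\<close>
  define h where "h = (\<lambda>(i :: nat, j :: int). (i + k, j + l))"
  define a' where "a' = (\<lambda>(i, j). a (i - k, j - l))"
  have inj: "inj_on h A" by (auto simp: h_def inj_on_def)
  have "(\<Sum>(i, j)\<in>h ` A. of_int (a' (i, j)) * inverse qq ^ i * tt powi j)
     = (\<Sum>(i, j)\<in>A. of_int (a (i, j)) * inverse qq ^ (i + k) * tt powi (j + l))"
    unfolding sum.reindex[OF inj] by (rule sum.cong) (auto simp: h_def a'_def)
  also have "\<dots> = inverse qq ^ k * tt powi l * c"
    unfolding c sum_distrib_left
    by (rule sum.cong) (auto simp: power_add power_int_add mult_ac)
  finally show ?thesis using A unfolding qt_integral_def by (intro CollectI exI[of _ "h ` A"] exI[of _ a']) auto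
qed

lemma qt_integral_add:
  assumes "c \<in> qt_integral" "d \<in> qt_integral"
  shows "c + d \<in> qt_integral"
proof -
  let ?m = "\<lambda>(i :: nat, j :: int). inverse qq ^ i * tt powi j"
  obtain A a where A: "finite A" and c: "c = (\<Sum>(i, j)\<in>A. of_int (a (i, j)) * inverse qq ^ i * tt powi j)"
    using assms by (auto simp: qt_integral_def)
  obtain B b where B: "finite B" and d: "d = (\<Sum>(i, j)\<in>B. of_int (b (i, j)) * inverse qq ^ i * tt powi j)"
    using assms by (auto simp: qt_integral_def)
  have c': "c = (\<Sum>x\<in>A \<union> B. of_int (if x \<in> A then a x else 0) * ?m x)"
    unfolding c using A B by (intro sum.mono_neutral_cong_left) (auto simp: mult.assoc)
  have d': "d = (\<Sum>x\<in>A \<union> B. of_int (if x \<in> B then b x else 0) * ?m x)"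
    unfolding d using A B by (intro sum.mono_neutral_cong_left) (auto simp: mult.assoc)
  let ?f = "\<lambda>x. (if x \<in> A then a x else 0) + (if x \<in> B then b x else 0)"
  have "c + d = (\<Sum>(i, j)\<in>A \<union> B. of_int (?f (i, j)) * inverse qq ^ i * tt powi j)"
    unfolding c' d' sum.distrib[symmetric]
    by (rule sum.cong) (auto simp: distrib_right mult.assoc)
  moreover have "finite (A \<union> B)" using A B by simp
  ultimately show ?thesis
    unfolding qt_integral_def by (intro CollectI exI[of _ "A \<union> B"] exI[of _ ?f] conjI)
qed

lemma qt_integral_basic: "0 \<in> qt_integral" "1 \<in> qt_integral" "c \<in> qt_integral \<Longrightarrow> - c \<in> qt_integral"
proof -
  show "0 \<in> qt_integral" unfolding qt_integral_def by (intro CollectI exI[of _ "{}"]) auto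
  show "1 \<in> qt_integral" unfolding qt_integral_def
    by (intro CollectI exI[of _ "{(0, 0)}"] exI[of _ "\<lambda>_. 1"]) auto
  assume "c \<in> qt_integral"
  then obtain A a where A: "finite A" and c: "c = (\<Sum>(i, j)\<in>A. of_int (a (i, j)) * inverse qq ^ i * tt powi j)"
    by (auto simp: qt_integral_def)
  have "- c = (\<Sum>(i, j)\<in>A. of_int (- a (i, j)) * inverse qq ^ i * tt powi j)"
    unfolding c sum_negf[symmetric] by (rule sum.cong) auto
  then show "- c \<in> qt_integral" using A unfolding qt_integral_def
    by (intro CollectI exI[of _ A] exI[of _ "\<lambda>x. - a x"]) auto
qed

lemma coeff_module_qt_integral: "coeff_module qq qt_integral"
  unfolding coeff_module_def
  using qt_integral_basic qt_integral_add qt_integral_shift[of _ 0 1] qt_integral_shift[of _ 0 "-1"] qt_integral_shift[of _ 1 0]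
  by (auto simp: power_int_minus)

section \<open>Specialization at q = 1\<close>

definition reg1 :: "qt set" where
  "reg1 = {c. \<exists>a b. poly b 1 \<noteq> 0 \<and> c = Fract a b}"

text \<open>Cross multiplication survives evaluation at \<open>q = 1\<close>, so the description in
  \<open>spec_q1\<close> is unambiguous on \<open>reg1\<close>.\<close>

lemma spec_Fract:
  assumes "poly b 1 \<noteq> 0"
  shows "spec_q1 (Fract a b) = Fract [:poly a 1:] [:poly b 1:]"
  unfolding spec_q1_def
proof (rule the_equality)
  show "\<exists>a' b'. poly b' 1 \<noteq> 0 \<and> Fract a b = Fract a' b' \<and> Fract [:poly a 1:] [:poly b 1:] = Fract [:poly a' 1:] [:poly b' 1:]"
    using assms by blast
  fix d assume "\<exists>a' b'. poly b' 1 \<noteq> 0 \<and> Fract a b = Fract a' b' \<and> d = Fract [:poly a' 1:] [:poly b' 1:]"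
  then obtain a' b' where b': "poly b' 1 \<noteq> 0" and e: "Fract a b = Fract a' b'"
    and d: "d = Fract [:poly a' 1:] [:poly b' 1:]" by blast
  have "b \<noteq> 0" "b' \<noteq> 0" using assms b' by auto
  then have "a * b' = a' * b" using e by (simp add: eq_fract)
  then have "poly a 1 * poly b' 1 = poly a' 1 * poly b 1" by (metis poly_mult)
  then show "d = Fract [:poly a 1:] [:poly b 1:]" using assms b' d by (simp add: eq_fract mult.commute)
qed

lemma Fract_reg1: "poly b 1 \<noteq> 0 \<Longrightarrow> Fract a b \<in> reg1"
  by (auto simp: reg1_def)

lemma spec_add:
  assumes "c \<in> reg1" "d \<in> reg1"
  shows "spec_q1 (c + d) = spec_q1 c + spec_q1 d \<and> c + d \<in> reg1"
proof -
  obtain a b a' b' where c: "c = Fract a b" "poly b 1 \<noteq> 0" and d: "d = Fract a' b'" "poly b' 1 \<noteq> 0"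
    using assms by (auto simp: reg1_def)
  then have nz: "b \<noteq> 0" "b' \<noteq> 0" by auto
  have e: "c + d = Fract (a * b' + a' * b) (b * b')" using c d nz by simp
  have n: "poly (b * b') 1 \<noteq> 0" using c d by simp
  show ?thesis unfolding e spec_Fract[OF n] using Fract_reg1[OF n] c d
    by (simp add: spec_Fract mult.commute)
qed

lemma spec_mult:
  assumes "c \<in> reg1" and "poly b 1 \<noteq> 0"
  shows "spec_q1 (Fract a b * c) = Fract [:poly a 1:] [:poly b 1:] * spec_q1 c \<and> Fract a b * c \<in> reg1"
proof -
  obtain a' b' where c: "c = Fract a' b'" "poly b' 1 \<noteq> 0"
    using assms by (auto simp: reg1_def)
  have e: "Fract a b * c = Fract (a * a') (b * b')" using c by simp
  have n: "poly (b * b') 1 \<noteq> 0" using c assms by simp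
  show ?thesis unfolding e spec_Fract[OF n] using Fract_reg1[OF n] c assms(2)
    by (simp add: spec_Fract mult.commute)
qed

lemma spec_tt: "c \<in> reg1 \<Longrightarrow> spec_q1 (tt * c) = tt * spec_q1 c \<and> tt * c \<in> reg1"
  unfolding tt_def using spec_mult[of c 1 "[:[:0, 1:]:]"] by (simp add: one_pCons)

lemma spec_inverse_tt: "c \<in> reg1 \<Longrightarrow> spec_q1 (inverse tt * c) = inverse tt * spec_q1 c \<and> inverse tt * c \<in> reg1"
  unfolding tt_def using spec_mult[of c "[:[:0, 1:]:]" 1] by (simp add: one_pCons)

lemma spec_inverse_qq: "c \<in> reg1 \<Longrightarrow> spec_q1 (inverse qq * c) = spec_q1 c \<and> inverse qq * c \<in> reg1"
proof -
  have "Fract [:[:1 :: rat:]:] [:[:1:]:] = 1" by (simp add: One_fract_def one_pCons)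
  then show "c \<in> reg1 \<Longrightarrow> spec_q1 (inverse qq * c) = spec_q1 c \<and> inverse qq * c \<in> reg1"
    unfolding qq_def using spec_mult[of c "[:0, 1:]" 1] by (simp add: one_pCons)
qed

lemma spec_0: "spec_q1 0 = 0" "0 \<in> reg1"
  using spec_Fract[of 1 0] Fract_reg1[of 1 0] by (simp_all add: Zero_fract_def one_pCons)

lemma spec_1: "spec_q1 1 = 1" "1 \<in> reg1"
  using spec_Fract[of 1 1] Fract_reg1[of 1 1] by (simp_all add: One_fract_def one_pCons)

lemma spec_uminus: "c \<in> reg1 \<Longrightarrow> spec_q1 (- c) = - spec_q1 c \<and> - c \<in> reg1"
  unfolding reg1_def by (auto simp: spec_Fract) blast

lemma coeff_module_reg1: "coeff_module qq reg1"
  by (simp add: coeff_module_def spec_add spec_tt spec_inverse_tt spec_inverse_qq spec_0 spec_uminus)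

text \<open>Outside \<open>reg1\<close> the value of \<open>spec_q1\<close> is arbitrary, so
  additivity of \<open>Sp\<close> is available for coefficients in \<open>reg1\<close>; hence the
  hypotheses with \<open>hpoly reg1\<close>.\<close>

abbreviation Sp :: "laurent \<Rightarrow> laurent" where
  "Sp \<equiv> Poly_Mapping.map spec_q1"

lemma lookup_Sp: "lookup (Sp F) \<mu> = spec_q1 (lookup F \<mu>)"
  by (simp add: Poly_Mapping.map.rep_eq when_def spec_0)

lemma Sp_0: "Sp 0 = 0"
  by (rule poly_mapping_eqI) (simp add: lookup_Sp spec_0)

lemma Sp_lconst: "Sp (lconst c) = lconst (spec_q1 c)"
  by (rule poly_mapping_eqI) (simp add: lookup_Sp lconst_def lookup_single when_def spec_0)

lemma Sp_lvar_mult: "Sp (lvar j * F) = lvar j * Sp F"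
  by (rule poly_mapping_eqI) (simp add: lookup_Sp lookup_lvar_mult)

lemma Sp_add: "F \<in> hpoly reg1 m d \<Longrightarrow> G \<in> hpoly reg1 m d \<Longrightarrow> Sp (F + G) = Sp F + Sp G"
  by (rule poly_mapping_eqI) (use spec_add in \<open>simp add: lookup_Sp lookup_add hpoly_iff\<close>)

lemma Sp_tl: "F \<in> hpoly reg1 m d \<Longrightarrow> Sp (tvar * F) = tvar * Sp F"
  by (rule poly_mapping_eqI) (use spec_tt in \<open>simp add: lookup_Sp tvar_def lookup_lconst_mult hpoly_iff\<close>)

lemma Sp_inverse_qq: "F \<in> hpoly reg1 m d \<Longrightarrow> Sp (lconst (inverse qq) * F) = Sp F"
  by (rule poly_mapping_eqI) (use spec_inverse_qq in \<open>simp add: lookup_Sp lookup_lconst_mult hpoly_iff\<close>)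

lemma Sp_uminus: "F \<in> hpoly reg1 m d \<Longrightarrow> Sp (- F) = - Sp F"
  by (rule poly_mapping_eqI) (use spec_uminus in \<open>simp add: lookup_Sp hpoly_iff\<close>)

lemmas hpR = hpoly_0[OF qq_nonzero coeff_module_reg1] hpoly_add[OF qq_nonzero coeff_module_reg1]
  hpoly_uminus[OF qq_nonzero coeff_module_reg1] hpoly_diff[OF qq_nonzero coeff_module_reg1]
  hpoly_tl[OF qq_nonzero coeff_module_reg1] hpoly_tl1[OF qq_nonzero coeff_module_reg1]
  hpoly_dl[OF qq_nonzero coeff_module_reg1] hpoly_dlt[OF qq_nonzero coeff_module_reg1]
  hpoly_tl_power[OF qq_nonzero coeff_module_reg1] hpoly_up[OF qq_nonzero coeff_module_reg1]
  hpoly_rho[OF qq_nonzero coeff_module_reg1] hpoly_PQ[OF qq_nonzero coeff_module_reg1]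
  hpoly_sum[OF qq_nonzero coeff_module_reg1]

lemma Sp_diff: "F \<in> hpoly reg1 m d \<Longrightarrow> G \<in> hpoly reg1 m d \<Longrightarrow> Sp (F - G) = Sp F - Sp G"
  using Sp_add[of F m d "- G"] Sp_uminus[of G m d] hpR(3)[of G m d] by simp

lemma Sp_tl1: "F \<in> hpoly reg1 m d \<Longrightarrow> Sp ((tvar - 1) * F) = (tvar - 1) * Sp F"
  using Sp_diff[OF hpR(5), of F m d F] Sp_tl[of F m d] by (simp add: left_diff_distrib)

lemma Sp_sum:
  assumes "finite A" "\<And>x. x \<in> A \<Longrightarrow> f x \<in> hpoly reg1 m d"
  shows "Sp (sum f A) = (\<Sum>x\<in>A. Sp (f x))"
  using assms
proof (induction A)
  case (insert x A)
  then have "Sp (f x + sum f A) = Sp (f x) + Sp (sum f A)" by (intro Sp_add hpR) auto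
  then show ?case using insert by simp
qed (simp add: Sp_0)

lemma Sp_dl:
  assumes "F \<in> hpoly reg1 m d" "a \<noteq> b" "1 \<le> a" "a \<le> m" "1 \<le> b" "b \<le> m"
  shows "Sp (dl a b F) = dl a b (Sp F)"
  using assms(1)
proof (induction d F rule: hpoly_induct)
  case (zero d)
  then show ?case using assms by (simp add: Sp_0)
next
  case (const c)
  then have "lconst c \<in> hpoly reg1 m 0" using spec_0 by (intro hpoly_lconst) auto
  then show ?case using assms by (simp add: Sp_tl Sp_lconst)
next
  case (add d F G)
  then show ?case using assms Sp_add[OF hpR(7)[OF add(1)] hpR(7)[OF add(2)]] Sp_add[OF add(1,2)] by simp
next
  case (var d j F)
  have F': "dl a b F \<in> hpoly reg1 m d" "dlt a b F \<in> hpoly reg1 m d" using var assms by (auto intro!: hpR)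
  have t: "Sp (dlt a b F) = dlt a b (Sp F)"
    using Sp_diff[OF F'(1) hpR(6)[OF var(3)]] Sp_tl1[OF var(3)] var.IH by (simp add: dlt_def)
  have x: "lvar a * dl a b F \<in> hpoly reg1 m (Suc d)" "(tvar - 1) * (lvar b * F) \<in> hpoly reg1 m (Suc d)"
    "lvar b * F \<in> hpoly reg1 m (Suc d)"
    using F' var assms by (auto intro!: hpR hpoly_lvar_mult)
  consider "j = a" | "j = b" | "j \<noteq> a" "j \<noteq> b" by blast
  then show ?case
  proof cases
    case 1
    then show ?thesis using assms t by (simp add: dl_a Sp_lvar_mult)
  next
    case 2
    then show ?thesis using assms var.IH Sp_add[OF x(1,2)] Sp_tl1[OF x(3)] by (simp add: dl_b Sp_lvar_mult)
  next
    case 3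
    then show ?thesis using assms var.IH by (simp add: Sp_lvar_mult)
  qed
qed (use coeff_module_reg1 in \<open>auto simp: coeff_module_def\<close>)

lemma Sp_dlt:
  assumes "F \<in> hpoly reg1 m d" "a \<noteq> b" "1 \<le> a" "a \<le> m" "1 \<le> b" "b \<le> m"
  shows "Sp (dlt a b F) = dlt a b (Sp F)"
  unfolding dlt_def Sp_diff[OF hpR(7)[OF assms] hpR(6)[OF assms(1)]] Sp_tl1[OF assms(1)] Sp_dl[OF assms] ..

lemma Sp_up: "F \<in> hpoly reg1 m d \<Longrightarrow> k < m \<Longrightarrow> Sp (up k F) = up k (Sp F)"
proof (induction k)
  case (Suc k)
  then have "up k F \<in> hpoly reg1 m d" by (intro hpR(10)) auto
  from Sp_dlt[OF this, of "Suc k" "Suc (Suc k)"] show ?case using Suc by simp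
qed simp

text \<open>The specialization touches \<open>q\<close> at one place, the factor
  \<open>inverse q\<close> of the variable that wraps around.\<close>

lemma Sp_rho:
  assumes "F \<in> hpoly reg1 m d" "1 \<le> m"
  shows "Sp (rho qq m F) = rho 1 m (Sp F)"
  using assms(1)
proof (induction d F rule: hpoly_induct)
  case (zero d)
  then show ?case using assms by (simp add: Sp_0)
next
  case (const c)
  then show ?case using assms by (simp add: Sp_lconst)
next
  case (add d F G)
  then show ?case using assms Sp_add[OF hpR(11)[OF add(1)] hpR(11)[OF add(2)]] Sp_add[OF add(1,2)] by simp
next
  case (var d j F)
  have R: "rho qq m F \<in> hpoly reg1 m d" using var assms by (auto intro!: hpR)
  show ?case
  proof (cases "j = m")
    case True
    have "lvar 1 * rho qq m F \<in> hpoly reg1 m (Suc d)" using R assms by (intro hpoly_lvar_mult) auto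
    from Sp_inverse_qq[OF this] show ?thesis using True assms var
      by (simp add: rho_lvar Sp_lvar_mult mult.assoc)
  next
    case False
    then show ?thesis using assms var by (simp add: rho_lvar Sp_lvar_mult)
  qed
qed (use coeff_module_reg1 in \<open>auto simp: coeff_module_def\<close>)

lemma Sp_tl_power: "F \<in> hpoly reg1 m d \<Longrightarrow> Sp (tvar ^ k * F) = tvar ^ k * Sp F"
proof (induction k)
  case (Suc k)
  have "Sp (tvar * (tvar ^ k * F)) = tvar * Sp (tvar ^ k * F)" by (rule Sp_tl[OF hpR(9)[OF Suc(2)]])
  then show ?case using Suc by (simp add: mult.assoc)
qed simp

lemma Sp_Aop:
  assumes "F \<in> hpoly reg1 m d" "1 \<le> m"
  shows "Sp (Aop qq m k F) = Aop 1 m k (Sp F)"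
proof -
  have P: "PQ qq m F \<in> hpoly reg1 m (Suc d)" using assms by (intro hpR)
  have SP: "Sp (PQ qq m F) = PQ 1 m (Sp F)" using assms by (simp add: PQ_def Sp_lvar_mult Sp_rho)
  have U: "up l (PQ qq m F) \<in> hpoly reg1 m (Suc d)" if "l < m" for l by (rule hpR(10)[OF P that])
  have "Sp (tvar ^ (m - 1 - l) * up l (PQ qq m F)) = tvar ^ (m - 1 - l) * up l (PQ 1 m (Sp F))" if "l < m" for l
    using Sp_tl_power[OF U[OF that]] Sp_up[OF P that] SP by simp
  moreover have "Sp (\<Sum>l<m - k. tvar ^ (m - 1 - l) * up l (PQ qq m F)) = (\<Sum>l<m - k. Sp (tvar ^ (m - 1 - l) * up l (PQ qq m F)))"
    using U by (intro Sp_sum[of _ _ m "Suc d"] hpR(9)) auto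
  ultimately show ?thesis by (simp add: Aop_def Sp_0)
qed

lemma Sp_Wop:
  assumes "1 \<le> m"
  shows "Sp (Wop qq m ds) = Wop 1 m ds"
proof (induction ds)
  case Nil
  then show ?case using Sp_lconst[of 1] by (simp add: Wop_def spec_1)
next
  case (Cons d ds)
  have "Wop qq m ds \<in> hpoly reg1 m (length ds)"
    using hpoly_Wop[OF qq_nonzero coeff_module_reg1] spec_1 assms by blast
  then show ?case using Cons Sp_Aop assms by (simp add: Wop_def)
qed

theorem theorem1:
  fixes n :: nat and e :: "nat \<Rightarrow> int"
  assumes "1 \<le> n" and "e \<in> unit_interval_fun n"
  shows
    "(\<forall>m\<ge>1. XG_qt m n e \<in> sym_poly_ring m \<and>
        (\<forall>\<mu>. Poly_Mapping.lookup (XG_qt m n e) \<mu> \<in> qt_integral)) \<and>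
     (\<forall>m m'. 0 < m' \<and> m' < m \<longrightarrow> proj m' (XG_qt m n e) = XG_qt m' n e) \<and>
     XG_lim n e \<in> carrier Lambda \<and>
     series_family (chromatic_qsym {1..n} (unit_interval_edges n e)) \<in> carrier Lambda \<and>
     (\<forall>N. is_N N \<longrightarrow>
        Lambda_spec_q1 (XG_lim n e) =
          N (series_family (chromatic_qsym {1..n} (unit_interval_edges n e))))"
proof -
  let ?ds = "map (lneigh e) [1..<n + 1]"
  have X: "XG_qt m n e = Wop qq m ?ds" if "1 \<le> m" for m
    using XG_qt_eq_Wop[OF that] e_bounds[OF assms(2)] by blast
  have st: "stable n (\<lambda>m. Wop qq m ?ds)"
    using Wop_stable[OF qq_nonzero dyck_lneigh[OF assms(2)]] by simp
  have lim: "XG_lim n e = RL (\<lambda>m. Wop qq m ?ds)"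
    unfolding XG_lim_def RL_def by (rule restrict_ext) (simp add: X)
  have ser: "series_family (chromatic_qsym {1..n} (unit_interval_edges n e)) = RL (\<lambda>m. chr e m n)"
    by (simp only: series_family_chr RL_def)
  have 1: "XG_qt m n e \<in> sym_poly_ring m" if "1 \<le> m" for m
    using st that by (simp add: X stable_def symh_iff_sym_poly_ring)
  have 2: "lookup (XG_qt m n e) \<mu> \<in> qt_integral" if "1 \<le> m" for m \<mu>
    using hpoly_Wop[OF qq_nonzero coeff_module_qt_integral qt_integral_basic(2) that, of ?ds]
    unfolding X[OF that] hpoly_iff by blast
  have 3: "proj m' (XG_qt m n e) = XG_qt m' n e" if "0 < m' \<and> m' < m" for m m'
  proof -
    have "1 \<le> m'" "1 \<le> m" "m' < m" using that by auto
    then show ?thesis using st by (simp add: X stable_def)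
  qed
  have 4: "XG_lim n e \<in> carrier Lambda" unfolding lim by (rule stable_carrier[OF st])
  have 5: "RL (\<lambda>m. chr e m n) \<in> carrier Lambda" by (rule stable_carrier[OF chr_stable[OF assms(2)]])
  have 6: "Lambda_spec_q1 (XG_lim n e) = N (RL (\<lambda>m. chr e m n))" if N: "is_N N" for N
  proof -
    have "N (RL (\<lambda>m. chr e m n)) \<in> carrier Lambda"
      using N 5 by (auto simp: is_N_def ring_iso_def ring_hom_def)
    then have "N (RL (\<lambda>m. chr e m n)) = RL (N (RL (\<lambda>m. chr e m n)))" by (rule carrier_extensional)
    also have "\<dots> = RL (\<lambda>m. Wop 1 m ?ds)"
    proof (rule RL_cong)
      fix m :: nat assume m: "1 \<le> m"
      show "N (RL (\<lambda>m. chr e m n)) m = Wop 1 m ?ds"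
        using N_stable[OF N m chr_stable[OF assms(2)] assms(1)] phi_chr[OF assms(2) m] by simp
    qed
    also have "\<dots> = Lambda_spec_q1 (XG_lim n e)"
      unfolding Lambda_spec_q1_def lim by (simp add: RL_def Sp_Wop cong: restrict_cong)
    finally show ?thesis by simp
  qed
  show ?thesis unfolding ser using 1 2 3 4 5 6 by blast
qed

end
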